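(* Let $m\in L^\infty(\mathbb{R})\cap C^1(\mathbb{R}\setminus\{0\})$ satisfy $|m'(x)|\le C|x|^{-1}$ for all $x\neq 0$, for some $C>0$. Then for every $1<r<\infty$, $m$ is a SAFT multiplier for $L^r(\mathbb{R})$.
   Context: $A=\{a,b,c,d,p,q\}$ are real parameters with $ad-bc=1$ and $b\neq0$. The special affine Fourier transform (SAFT) is $\mathcal{F}_Af(\omega)=\frac{1}{\sqrt{|b|}}\int_{\mathbb{R}}f(t)e^{\frac{\pi i}{b}(at^2+2pt-2\omega t+2(bq-dp)\omega+d\omega^2)}\,dt$ for $f\in L^1(\mathbb{R})$, extended to a unitary operator on $L^2(\mathbb{R})$. A function $m\in L^\infty(\mathbb{R})$ is called a SAFT multiplier for $L^r(\mathbb{R})$, $1\le r<\infty$, if the operator $T_{A,m}$ defined by $\mathcal{F}_A(T_{A,m}f)(\omega)=m(\omega)\mathcal{F}_A(f)(\omega)$ for $f\in L^2(\mathbb{R})\cap L^r(\mathbb{R})$ extends to a bounded linear operator on $L^r(\mathbb{R})$. *)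

theory Defs
  imports "HOL-Analysis.Analysis" "HOL-Probability.Essential_Supremum"
begin

text \<open>
  Elements of \<open>L\<^sup>r(\<real>)\<close> are represented by Borel measurable functions and compared up to
  almost-everywhere equality (every Lebesgue measurable function agrees a.e. with a Borel one).
\<close>

definition Lr :: "real \<Rightarrow> (real \<Rightarrow> complex) set" where
  "Lr r = {f \<in> borel_measurable lborel. integrable lborel (\<lambda>x. norm (f x) powr r)}"

definition Lr_norm :: "real \<Rightarrow> (real \<Rightarrow> complex) \<Rightarrow> real" where
  "Lr_norm r f = (LINT x|lborel. norm (f x) powr r) powr (1 / r)"

definition Linf :: "(real \<Rightarrow> complex) set" where
  "Linf = {f \<in> borel_measurable lborel. esssup lborel (\<lambda>x. ereal (norm (f x))) < \<infinity>}"

text \<open>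
  Membership is required explicitly because \<open>Lr_norm\<close> is \<open>0\<close> outside \<open>Lr\<close>.
\<close>

definition Lr_tendsto :: "real \<Rightarrow> (nat \<Rightarrow> real \<Rightarrow> complex) \<Rightarrow> (real \<Rightarrow> complex) \<Rightarrow> bool" where
  "Lr_tendsto r u f \<longleftrightarrow> (\<forall>n. u n \<in> Lr r) \<and> f \<in> Lr r \<and>
     (\<lambda>n. Lr_norm r (\<lambda>x. u n x - f x)) \<longlonglongrightarrow> 0"

text \<open>
  The components of a parameter tuple are \<open>(a, b, c, d, p, q)\<close>. The integral below is the
  transform on \<open>L\<^sup>1\<close>; the constraints \<open>a d - b c = 1\<close> and \<open>b \<noteq> 0\<close> are imposed where
  parameters are introduced.
\<close>

type_synonym saft_params = "real \<times> real \<times> real \<times> real \<times> real \<times> real"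

fun saft :: "saft_params \<Rightarrow> (real \<Rightarrow> complex) \<Rightarrow> real \<Rightarrow> complex" where
  "saft (a, b, c, d, p, q) f \<omega> =
     of_real (1 / sqrt \<bar>b\<bar>) *
     (LINT t|lborel. f t * exp (of_real pi * \<i> / of_real b *
        of_real (a * t\<^sup>2 + 2 * p * t - 2 * \<omega> * t + 2 * (b * q - d * p) * \<omega> + d * \<omega>\<^sup>2)))"

text \<open>
  Extension to \<open>L\<^sup>2\<close> by density: the transform of \<open>f \<in> L\<^sup>2\<close> is the \<open>L\<^sup>2\<close>-limit of the
  transforms of functions in \<open>L\<^sup>1 \<inter> L\<^sup>2\<close> converging to \<open>f\<close> in \<open>L\<^sup>2\<close>. By Plancherel the
  limit exists and is determined up to a.e. equality, so the choice below only selects a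
  representative of its class.
\<close>

definition is_saft_L2 :: "saft_params \<Rightarrow> (real \<Rightarrow> complex) \<Rightarrow> (real \<Rightarrow> complex) \<Rightarrow> bool" where
  "is_saft_L2 A f F \<longleftrightarrow>
     (\<exists>u. (\<forall>n. u n \<in> Lr 1 \<inter> Lr 2) \<and> Lr_tendsto 2 u f \<and> Lr_tendsto 2 (\<lambda>n. saft A (u n)) F)"

definition saft_L2 :: "saft_params \<Rightarrow> (real \<Rightarrow> complex) \<Rightarrow> real \<Rightarrow> complex" where
  "saft_L2 A f = (SOME F. is_saft_L2 A f F)"

text \<open>
  Compatibility of \<open>T\<close> with a.e. equality need not be required separately: it follows from
  additivity and the norm bound applied to the difference of two representatives.
\<close>

definition bounded_linear_Lr :: "real \<Rightarrow> ((real \<Rightarrow> complex) \<Rightarrow> real \<Rightarrow> complex) \<Rightarrow> bool" where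
  "bounded_linear_Lr r T \<longleftrightarrow>
     (\<forall>f\<in>Lr r. T f \<in> Lr r) \<and>
     (\<forall>f\<in>Lr r. \<forall>g\<in>Lr r. AE x in lborel. T (\<lambda>y. f y + g y) x = T f x + T g x) \<and>
     (\<forall>f\<in>Lr r. \<forall>z. AE x in lborel. T (\<lambda>y. z * f y) x = z * T f x) \<and>
     (\<exists>K. \<forall>f\<in>Lr r. Lr_norm r (T f) \<le> K * Lr_norm r f)"

text \<open>
  \<open>saft_mult_op A m f g\<close> says that \<open>g \<in> L\<^sup>2\<close> is (a representative of) \<open>T\<^bsub>A,m\<^esub> f\<close>, i.e.
  that the transform of \<open>g\<close> is \<open>m\<close> times the transform of \<open>f\<close>.
\<close>

definition saft_mult_op ::
  "saft_params \<Rightarrow> (real \<Rightarrow> complex) \<Rightarrow> (real \<Rightarrow> complex) \<Rightarrow> (real \<Rightarrow> complex) \<Rightarrow> bool" where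
  "saft_mult_op A m f g \<longleftrightarrow>
     g \<in> Lr 2 \<and> (AE \<omega> in lborel. saft_L2 A g \<omega> = m \<omega> * saft_L2 A f \<omega>)"

definition saft_multiplier :: "saft_params \<Rightarrow> real \<Rightarrow> (real \<Rightarrow> complex) \<Rightarrow> bool" where
  "saft_multiplier A r m \<longleftrightarrow> m \<in> Linf \<and>
     (\<exists>T. bounded_linear_Lr r T \<and> (\<forall>f\<in>Lr 2 \<inter> Lr r. saft_mult_op A m f (T f)))"

end

theory Submission
  imports Defs "HOL-Probability.Probability" "HOL-Real_Asymp.Real_Asymp"
begin

text \<open>
  Conjugating by the chirp \<open>exp (\<pi> i (a t\<^sup>2 + 2 p t) / b)\<close> and rescaling the frequency by \<open>2 \<pi> / b\<close>
  turns the special affine Fourier transform into the ordinary one, up to a unimodular factor, and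
  \<open>m\<close> into a dilate that satisfies the same hypotheses. What remains is Mikhlin's theorem on the line.

  For the regularised symbols \<open>m / (1 + \<epsilon> \<xi>\<^sup>2)\<close> the operator is convolution with a bounded kernel \<open>K\<close>.
  Splitting the symbol with the cutoff \<open>1 / (1 + y\<^sup>2 \<xi>\<^sup>2)\<close>, both pieces of \<open>K (x - y) - K x\<close> have symbols
  whose derivative is at most \<open>const |y| / sqrt (1 + y\<^sup>2 \<xi>\<^sup>2)\<close>, and Plancherel's inequality gives Hoermander's
  condition with a constant independent of \<open>\<epsilon>\<close>. On step functions the Calderon-Zygmund decomposition is
  a finite induction over halved intervals; it bounds the distribution function of the image, and
  integrating that bound over all levels yields \<open>1 < r < 2\<close>. The case \<open>r > 2\<close> follows by duality, and the
  limits \<open>\<epsilon> \<rightarrow> 0\<close> and from step functions to \<open>L\<^sup>r\<close> by Fatou's lemma.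
\<close>

section \<open>The spaces \<open>L\<^sup>r\<close>\<close>

text \<open>The obstacle is that \<open>m\<close> has only one derivative. Its kernel K need not
  satisfy a pointwise bound such as |K'(x)| <= const / x^2, so differences of K are controlled only
  in integrated form, over |x| > 2 |y|. One derivative of the symbol is worth one power of x on the
  kernel side, and Cauchy-Schwarz turns the weighted L^2 bound into an L^1 bound on that tail.
  Without a cutoff this breaks down: the derivative of m (exp(-i y xi) - 1) contains a term of size
  |y| |m|, whose L^2 norm has no bound independent of the regularisation. At high frequencies the
  difference is therefore given up and both translates are estimated separately. The distributional
  estimate retains the truncations of f to |f| <= l and |f| > l / 2. They make the integrals over
  all levels converge without a further splitting of f at each level. Step functions take the place
  of Lebesgue's differentiation theorem: halving ends at cells on which f is constant, where a bound
  on the average is a pointwise bound.\<close>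

text \<open>
  Limits are measured by the integral of \<open>|f|\<^sup>r\<close> rather than by its \<open>r\<close>-th root: the quasi-triangle
  inequality with factor \<open>2\<^sup>r\<close> is enough throughout, so that Minkowski's inequality is not needed.
\<close>

definition Lr_int :: "real \<Rightarrow> (real \<Rightarrow> complex) \<Rightarrow> ennreal" where
  "Lr_int r f = (\<integral>\<^sup>+x. ennreal (norm (f x) powr r) \<partial>lborel)"

lemma Lr_iff: "f \<in> Lr r \<longleftrightarrow> f \<in> borel_measurable borel \<and> Lr_int r f < \<infinity>"
proof -
  have "integrable lborel (\<lambda>x. norm (f x) powr r) \<longleftrightarrow> Lr_int r f < \<infinity>"
    if [measurable]: "f \<in> borel_measurable borel"
    unfolding integrable_iff_bounded Lr_int_def by simp
  then show ?thesis
    unfolding Lr_def by auto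
qed

lemma LrD:
  assumes "f \<in> Lr r"
  shows "f \<in> borel_measurable borel" and "Lr_int r f < \<infinity>"
  using assms by (auto simp: Lr_iff)

lemma Lr_norm_eq: "f \<in> Lr r \<Longrightarrow> Lr_norm r f = enn2real (Lr_int r f) powr (1 / r)"
  unfolding Lr_norm_def Lr_int_def Lr_def
  by (subst integral_eq_nn_integral) auto

lemma Lr_int_mono:
  "0 \<le> r \<Longrightarrow> (\<And>x. norm (f x) \<le> norm (g x)) \<Longrightarrow> Lr_int r f \<le> Lr_int r g"
  unfolding Lr_int_def by (intro nn_integral_mono ennreal_leI powr_mono2) auto

lemma powr_add_le:
  fixes x y r :: real
  assumes "r > 0" "x \<ge> 0" "y \<ge> 0"
  shows "(x + y) powr r \<le> 2 powr r * (x powr r + y powr r)"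
proof -
  have "(x + y) powr r \<le> (2 * max x y) powr r"
    using assms by (intro powr_mono2) auto
  also have "\<dots> = 2 powr r * max x y powr r"
    using assms by (simp add: powr_mult)
  also have "max x y powr r \<le> x powr r + y powr r"
    by (auto simp: max_def)
  finally show ?thesis by simp
qed

lemma Lr_int_add_le:
  assumes [measurable]: "f \<in> borel_measurable borel" "g \<in> borel_measurable borel" and "r > 0"
  shows "Lr_int r (\<lambda>x. f x + g x) \<le> ennreal (2 powr r) * (Lr_int r f + Lr_int r g)"
proof -
  have "Lr_int r (\<lambda>x. f x + g x)
      \<le> (\<integral>\<^sup>+x. ennreal (2 powr r) * (ennreal (norm (f x) powr r) + ennreal (norm (g x) powr r)) \<partial>lborel)"
    unfolding Lr_int_def
  proof (intro nn_integral_mono)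
    fix x
    have "norm (f x + g x) powr r \<le> (norm (f x) + norm (g x)) powr r"
      using \<open>r > 0\<close> by (intro powr_mono2 norm_triangle_ineq) auto
    also have "\<dots> \<le> 2 powr r * (norm (f x) powr r + norm (g x) powr r)"
      using \<open>r > 0\<close> by (intro powr_add_le) auto
    finally show "ennreal (norm (f x + g x) powr r)
        \<le> ennreal (2 powr r) * (ennreal (norm (f x) powr r) + ennreal (norm (g x) powr r))"
      by (simp add: ennreal_mult'[symmetric] ennreal_plus[symmetric] del: ennreal_plus) 
  qed
  also have "\<dots> = ennreal (2 powr r) * (Lr_int r f + Lr_int r g)"
    unfolding Lr_int_def by (simp add: nn_integral_cmult nn_integral_add)
  finally show ?thesis .
qed

lemma Lr_int_minus_commute: "Lr_int r (\<lambda>x. f x - g x) = Lr_int r (\<lambda>x. g x - f x)"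
  unfolding Lr_int_def by (simp add: norm_minus_commute)

lemma Lr_int_cmult: "f \<in> borel_measurable borel \<Longrightarrow>
    Lr_int r (\<lambda>x. z * f x) = ennreal (norm z powr r) * Lr_int r f"
  unfolding Lr_int_def
  by (simp add: norm_mult powr_mult ennreal_mult nn_integral_cmult)

lemma Lr_int_triangle:
  assumes [measurable]: "f \<in> borel_measurable borel" "g \<in> borel_measurable borel"
    "h \<in> borel_measurable borel" and "r > 0"
  shows "Lr_int r (\<lambda>x. f x - h x)
    \<le> ennreal (2 powr r) * (Lr_int r (\<lambda>x. f x - g x) + Lr_int r (\<lambda>x. g x - h x))"
  using Lr_int_add_le[of "\<lambda>x. f x - g x" "\<lambda>x. g x - h x" r] assms by simp

lemma Lr_int_le_diff:
  assumes [measurable]: "f \<in> borel_measurable borel" "g \<in> borel_measurable borel" and "r > 0"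
  shows "Lr_int r f \<le> ennreal (2 powr r) * (Lr_int r (\<lambda>x. f x - g x) + Lr_int r g)"
  using Lr_int_add_le[of "\<lambda>x. f x - g x" g r] assms by simp

lemma Lr_add: "f \<in> Lr r \<Longrightarrow> g \<in> Lr r \<Longrightarrow> r > 0 \<Longrightarrow> (\<lambda>x. f x + g x) \<in> Lr r"
  using Lr_int_add_le[of f g r]
  by (auto simp: Lr_iff ennreal_mult_less_top intro: order.strict_trans1)

lemma Lr_cmult: "f \<in> Lr r \<Longrightarrow> (\<lambda>x. z * f x) \<in> Lr r"
  by (auto simp: Lr_iff Lr_int_cmult ennreal_mult_less_top)

lemma Lr_diff: "f \<in> Lr r \<Longrightarrow> g \<in> Lr r \<Longrightarrow> r > 0 \<Longrightarrow> (\<lambda>x. f x - g x) \<in> Lr r"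
  using Lr_add[of f r "\<lambda>x. (-1) * g x"] Lr_cmult[of g r "-1"] by simp

lemma Lr_mono: "g \<in> Lr r \<Longrightarrow> 0 \<le> r \<Longrightarrow> f \<in> borel_measurable borel \<Longrightarrow>
    (\<And>x. norm (f x) \<le> norm (g x)) \<Longrightarrow> f \<in> Lr r"
  using Lr_int_mono[of r f g] by (auto simp: Lr_iff intro: order.strict_trans1)

lemma Lr_int_eq_0_iff: "f \<in> borel_measurable borel \<Longrightarrow> Lr_int r f = 0 \<longleftrightarrow> (AE x in lborel. f x = 0)"
  unfolding Lr_int_def by (subst nn_integral_0_iff_AE) (auto simp: powr_eq_0_iff)

lemma Lr_int_1: "Lr_int 1 f = (\<integral>\<^sup>+x. ennreal (norm (f x)) \<partial>lborel)"
  unfolding Lr_int_def by simp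

lemma Lr_int_2: "Lr_int 2 f = (\<integral>\<^sup>+x. ennreal ((norm (f x))\<^sup>2) \<partial>lborel)"
  unfolding Lr_int_def by (simp add: powr_numeral)

lemma Lr_1_iff: "f \<in> Lr 1 \<longleftrightarrow> integrable lborel f"
  unfolding Lr_iff Lr_int_1 integrable_iff_bounded by simp

section \<open>Convergence in L^r\<close>

lemma Lr_tendsto_iff:
  assumes "r > 0"
  shows "Lr_tendsto r u f \<longleftrightarrow> (\<forall>n. u n \<in> Lr r) \<and> f \<in> Lr r \<and>
    (\<lambda>n. Lr_int r (\<lambda>x. u n x - f x)) \<longlonglongrightarrow> 0"
proof -
  have "((\<lambda>n. Lr_norm r (\<lambda>x. u n x - f x)) \<longlonglongrightarrow> 0) \<longleftrightarrow>
        ((\<lambda>n. Lr_int r (\<lambda>x. u n x - f x)) \<longlonglongrightarrow> 0)"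
    if u: "\<forall>n. u n \<in> Lr r" and f: "f \<in> Lr r"
  proof -
    have d: "(\<lambda>x. u n x - f x) \<in> Lr r" for n
      using u f assms by (intro Lr_diff) auto
    let ?e = "\<lambda>n. enn2real (Lr_int r (\<lambda>x. u n x - f x))"
    have n: "Lr_norm r (\<lambda>x. u n x - f x) = ?e n powr (1 / r)" for n
      using d by (rule Lr_norm_eq)
    have e: "Lr_int r (\<lambda>x. u n x - f x) = ennreal (?e n)" for n
      using d[of n] by (auto simp: Lr_iff)
    have "((\<lambda>n. ?e n powr (1 / r)) \<longlonglongrightarrow> 0) \<longleftrightarrow> (?e \<longlonglongrightarrow> 0)"
    proof
      assume *: "(\<lambda>n. ?e n powr (1 / r)) \<longlonglongrightarrow> 0"
      have "(\<lambda>n. (?e n powr (1 / r)) powr r) \<longlonglongrightarrow> 0 powr r"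
        using assms by (intro tendsto_powr2 * tendsto_const) auto
      then show "?e \<longlonglongrightarrow> 0"
        using assms by (simp add: powr_powr)
    next
      assume *: "?e \<longlonglongrightarrow> 0"
      have "(\<lambda>n. ?e n powr (1 / r)) \<longlonglongrightarrow> 0 powr (1 / r)"
        using assms by (intro tendsto_powr2 * tendsto_const) auto
      then show "(\<lambda>n. ?e n powr (1 / r)) \<longlonglongrightarrow> 0"
        by simp
    qed
    also have "(?e \<longlonglongrightarrow> 0) \<longleftrightarrow> ((\<lambda>n. Lr_int r (\<lambda>x. u n x - f x)) \<longlonglongrightarrow> 0)"
    proof -
      have "(\<lambda>n. Lr_int r (\<lambda>x. u n x - f x)) = (\<lambda>n. ennreal (?e n))"
        using e by (rule ext)
      then show ?thesis
        using ennreal_tendsto_0_iff[of ?e] by (simp only: enn2real_nonneg)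
    qed
    finally show ?thesis
      unfolding n .
  qed
  then show ?thesis
    unfolding Lr_tendsto_def by auto
qed

lemma Lr_tendstoI:
  "r > 0 \<Longrightarrow> (\<And>n. u n \<in> Lr r) \<Longrightarrow> f \<in> Lr r \<Longrightarrow>
    (\<lambda>n. Lr_int r (\<lambda>x. u n x - f x)) \<longlonglongrightarrow> 0 \<Longrightarrow> Lr_tendsto r u f"
  by (auto simp: Lr_tendsto_iff)

lemma Lr_tendstoD:
  assumes "Lr_tendsto r u f" "r > 0"
  shows "u n \<in> Lr r" "f \<in> Lr r" "(\<lambda>n. Lr_int r (\<lambda>x. u n x - f x)) \<longlonglongrightarrow> 0"
  using assms by (auto simp: Lr_tendsto_iff)

lemma tendsto_0_le_ennreal:
  fixes f g :: "nat \<Rightarrow> ennreal"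
  assumes "g \<longlonglongrightarrow> 0" "\<And>n. f n \<le> ennreal c * g n"
  shows "f \<longlonglongrightarrow> 0"
proof (rule tendsto_sandwich[OF _ _ tendsto_const])
  have "(\<lambda>n. ennreal c * g n) \<longlonglongrightarrow> ennreal c * 0"
    by (intro ennreal_tendsto_cmult assms) auto
  then show "(\<lambda>n. ennreal c * g n) \<longlonglongrightarrow> 0" by simp
qed (use assms in auto)

lemma Lr_tendsto_const: "f \<in> Lr r \<Longrightarrow> r > 0 \<Longrightarrow> Lr_tendsto r (\<lambda>n. f) f"
  by (rule Lr_tendstoI) (auto simp: Lr_int_def)

lemma Lr_tendsto_dominated:
  assumes "Lr_tendsto r u f" "r > 0" "\<And>n. v n \<in> Lr r" "g \<in> Lr r"
    and "\<And>n. Lr_int r (\<lambda>x. v n x - g x) \<le> ennreal c * Lr_int r (\<lambda>x. u n x - f x)"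
  shows "Lr_tendsto r v g"
  using assms by (intro Lr_tendstoI tendsto_0_le_ennreal[OF Lr_tendstoD(3)[OF assms(1,2)] assms(5)]) auto

lemma Lr_tendsto_add:
  assumes u: "Lr_tendsto r u f" and v: "Lr_tendsto r v g" and r: "r > 0"
  shows "Lr_tendsto r (\<lambda>n x. u n x + v n x) (\<lambda>x. f x + g x)"
proof (rule Lr_tendstoI)
  note * = Lr_tendstoD[OF u r] Lr_tendstoD[OF v r]
  have [measurable]: "f \<in> borel_measurable borel" "g \<in> borel_measurable borel"
      "u n \<in> borel_measurable borel" "v n \<in> borel_measurable borel" for n
    using *(1,2,4,5) by (auto simp: Lr_iff)
  have "(\<lambda>n. Lr_int r (\<lambda>x. u n x - f x) + Lr_int r (\<lambda>x. v n x - g x)) \<longlonglongrightarrow> 0 + 0"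
    by (intro tendsto_add *)
  then have "(\<lambda>n. Lr_int r (\<lambda>x. u n x - f x) + Lr_int r (\<lambda>x. v n x - g x)) \<longlonglongrightarrow> 0"
    by simp
  then show "(\<lambda>n. Lr_int r (\<lambda>x. u n x + v n x - (f x + g x))) \<longlonglongrightarrow> 0"
  proof (rule tendsto_0_le_ennreal)
    fix n
    show "Lr_int r (\<lambda>x. u n x + v n x - (f x + g x))
        \<le> ennreal (2 powr r) * (Lr_int r (\<lambda>x. u n x - f x) + Lr_int r (\<lambda>x. v n x - g x))"
      unfolding add_diff_add by (rule Lr_int_add_le) (use r in measurable)
  qed
next
  show "(\<lambda>x. f x + g x) \<in> Lr r"
    by (rule Lr_add[OF Lr_tendstoD(2)[OF u r] Lr_tendstoD(2)[OF v r] r])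
next
  fix n
  show "(\<lambda>x. u n x + v n x) \<in> Lr r"
    by (rule Lr_add[OF Lr_tendstoD(1)[OF u r] Lr_tendstoD(1)[OF v r] r])
qed (rule r)

lemma Lr_tendsto_cmult:
  assumes u: "Lr_tendsto r u f" and r: "r > 0"
  shows "Lr_tendsto r (\<lambda>n x. z * u n x) (\<lambda>x. z * f x)"
proof (rule Lr_tendsto_dominated[OF u r])
  fix n
  note * = Lr_tendstoD(1,2)[OF u r, THEN LrD(1)]
  have [measurable]: "f \<in> borel_measurable borel" "u n \<in> borel_measurable borel"
    using * by auto
  show "Lr_int r (\<lambda>x. z * u n x - z * f x) \<le> ennreal (norm z powr r) * Lr_int r (\<lambda>x. u n x - f x)"
    unfolding right_diff_distrib[symmetric] by (subst Lr_int_cmult) auto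
qed (auto intro!: Lr_cmult Lr_tendstoD(1,2)[OF u r])

lemma Lr_tendsto_diff:
  assumes u: "Lr_tendsto r u f" and v: "Lr_tendsto r v g" and r: "r > 0"
  shows "Lr_tendsto r (\<lambda>n x. u n x - v n x) (\<lambda>x. f x - g x)"
  using Lr_tendsto_add[OF u Lr_tendsto_cmult[OF v r, of "-1"] r] by simp

text \<open>Convergence in L^r is L^1 convergence of \<open>norm (u n x - f x) powr r\<close> to
  zero, so the subsequence theorem for L^1 applies.\<close>

lemma Lr_tendsto_AE_subseq:
  assumes u: "Lr_tendsto r u f" and r: "r > 0"
  obtains k where "strict_mono k" "AE x in lborel. (\<lambda>n. u (k n) x) \<longlonglongrightarrow> f x"
proof -
  have d: "(\<lambda>x. u n x - f x) \<in> Lr r" for n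
    using Lr_tendstoD[OF u r] r by (intro Lr_diff) auto
  have "(\<lambda>n. enn2real (Lr_int r (\<lambda>x. u n x - f x))) \<longlonglongrightarrow> enn2real 0"
    using tendsto_enn2real[of "\<lambda>n. Lr_int r (\<lambda>x. u n x - f x)" 0] Lr_tendstoD(3)[OF u r] by simp
  moreover have "enn2real (Lr_int r (\<lambda>x. u n x - f x)) = (LINT x|lborel. norm (norm (u n x - f x) powr r))" for n
    using d[of n] unfolding Lr_def Lr_int_def by (subst integral_eq_nn_integral) auto
  ultimately have "(\<lambda>n. LINT x|lborel. norm (norm (u n x - f x) powr r)) \<longlonglongrightarrow> 0"
    by simp
  moreover have "integrable lborel (\<lambda>x. norm (u n x - f x) powr r)" for n
    using d[of n] by (simp add: Lr_def)
  ultimately obtain k where k: "strict_mono k"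
      "AE x in lborel. (\<lambda>n. norm (u (k n) x - f x) powr r) \<longlonglongrightarrow> 0"
    using tendsto_L1_AE_subseq[of lborel "\<lambda>n x. norm (u n x - f x) powr r"] by blast
  have conv: "(\<lambda>n. u (k n) x) \<longlonglongrightarrow> f x" if *: "(\<lambda>n. norm (u (k n) x - f x) powr r) \<longlonglongrightarrow> 0" for x
  proof -
    have "(\<lambda>n. (norm (u (k n) x - f x) powr r) powr (1 / r)) \<longlonglongrightarrow> 0 powr (1 / r)"
      using r by (intro tendsto_powr2 * tendsto_const) auto
    then have "(\<lambda>n. norm (u (k n) x - f x)) \<longlonglongrightarrow> 0"
      using r by (simp add: powr_powr)
    then show ?thesis
      using Lim_null tendsto_norm_zero_iff by blast
  qed
  have "AE x in lborel. (\<lambda>n. u (k n) x) \<longlonglongrightarrow> f x"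
    using k(2) by eventually_elim (rule conv)
  then show ?thesis
    using k(1) that by blast
qed

lemma Lr_int_Fatou:
  assumes [measurable]: "\<And>n. u n \<in> borel_measurable borel"
    and ae: "AE x in lborel. (\<lambda>n. u n x) \<longlonglongrightarrow> f x" and r: "r > 0"
  shows "Lr_int r f \<le> liminf (\<lambda>n. Lr_int r (u n))"
proof -
  have "Lr_int r f = (\<integral>\<^sup>+x. liminf (\<lambda>n. ennreal (norm (u n x) powr r)) \<partial>lborel)"
    unfolding Lr_int_def
  proof (intro nn_integral_cong_AE, use ae in eventually_elim)
    fix x assume "(\<lambda>n. u n x) \<longlonglongrightarrow> f x"
    then have "(\<lambda>n. ennreal (norm (u n x) powr r)) \<longlonglongrightarrow> ennreal (norm (f x) powr r)"
      using r by (intro tendsto_ennrealI tendsto_powr2 tendsto_norm tendsto_const) auto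
    from lim_imp_Liminf[OF trivial_limit_sequentially this]
    show "ennreal (norm (f x) powr r) = liminf (\<lambda>n. ennreal (norm (u n x) powr r))"
      by (rule sym)
  qed
  also have "\<dots> \<le> liminf (\<lambda>n. Lr_int r (u n))"
    unfolding Lr_int_def by (intro nn_integral_liminf) measurable
  finally show ?thesis .
qed

text \<open>The two exponents differ on purpose: convergence in \<open>s\<close> supplies an a.e.
  convergent subsequence, and Fatou's lemma carries a bound in \<open>r\<close> to the limit, of
  which membership in \<open>Lr r\<close> is not known beforehand.\<close>

lemma Lr_int_Fatou_le:
  assumes u: "Lr_tendsto s u f" and s: "s > 0" and r: "r > 0"
    and le: "\<And>n. Lr_int r (u n) \<le> c n" and c: "c \<longlonglongrightarrow> l"
  shows "Lr_int r f \<le> l"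
proof -
  obtain k where k: "strict_mono k" "AE x in lborel. (\<lambda>n. u (k n) x) \<longlonglongrightarrow> f x"
    using Lr_tendsto_AE_subseq[OF u s] .
  have "Lr_int r f \<le> liminf (\<lambda>n. Lr_int r (u (k n)))"
    using k(2) by (intro Lr_int_Fatou Lr_tendstoD(1)[OF u s, THEN LrD(1)] r)
  also have "\<dots> \<le> liminf (\<lambda>n. c (k n))"
    by (intro Liminf_mono always_eventually allI le)
  also have "\<dots> = l"
    using LIMSEQ_subseq_LIMSEQ[OF c k(1)] by (intro lim_imp_Liminf) (auto simp: o_def)
  finally show ?thesis .
qed

text \<open>The factor \<open>2 powr r\<close> is the price of the quasi-triangle inequality:
  \<open>Lr_int r (u n)\<close> is compared with \<open>Lr_int r f\<close> up to this factor instead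
  of being shown to converge to it.\<close>

lemma Lr_int_le_transfer:
  assumes v: "Lr_tendsto s v g" and u: "Lr_tendsto r u f" and pos: "s > 0" "r > 0" "t > 0" and A: "A \<ge> 0"
    and le: "\<And>n. Lr_int t (v n) \<le> ennreal A * Lr_int r (u n)"
  shows "Lr_int t g \<le> ennreal (A * 2 powr r) * Lr_int r f"
proof (rule Lr_int_Fatou_le[OF v pos(1,3)])
  fix n
  have "Lr_int r (u n) \<le> ennreal (2 powr r) * (Lr_int r (\<lambda>x. u n x - f x) + Lr_int r f)"
    by (intro Lr_int_le_diff pos Lr_tendstoD(1,2)[OF u pos(2), THEN LrD(1)])
  then have "Lr_int t (v n) \<le> ennreal A * (ennreal (2 powr r) * (Lr_int r (\<lambda>x. u n x - f x) + Lr_int r f))"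
    by (intro order_trans[OF le] mult_left_mono) auto
  then show "Lr_int t (v n) \<le> ennreal (A * 2 powr r) * (Lr_int r (\<lambda>x. u n x - f x) + Lr_int r f)"
    using A by (simp add: ennreal_mult mult.assoc)
next
  have "(\<lambda>n. ennreal (A * 2 powr r) * (Lr_int r (\<lambda>x. u n x - f x) + Lr_int r f))
      \<longlonglongrightarrow> ennreal (A * 2 powr r) * (0 + Lr_int r f)"
    by (intro ennreal_tendsto_cmult tendsto_add tendsto_const Lr_tendstoD(3)[OF u pos(2)]) auto
  then show "(\<lambda>n. ennreal (A * 2 powr r) * (Lr_int r (\<lambda>x. u n x - f x) + Lr_int r f))
      \<longlonglongrightarrow> ennreal (A * 2 powr r) * Lr_int r f"
    by simp
qed

section \<open>Completeness and dominated convergence\<close>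

lemma Lr_complete:
  assumes u: "\<And>n. u n \<in> Lr r" and r: "r > 0"
    and cauchy: "\<And>e. e > 0 \<Longrightarrow> \<exists>M. \<forall>m\<ge>M. \<forall>n\<ge>M. Lr_int r (\<lambda>x. u m x - u n x) \<le> ennreal e"
  obtains f where "Lr_tendsto r u f"
proof -
  have [measurable]: "u n \<in> borel_measurable borel" for n
    using u by (auto simp: Lr_iff)
  \<comment> \<open>Chosen so that \<open>(2 powr r) ^ j * a j = (1 / 2) ^ j\<close>. The increments
    weighted by \<open>(2 powr r) ^ j\<close> are then summable a.e., hence each increment is
    eventually at most \<open>(1 / 2) ^ j\<close>; no triangle inequality for the norm
    enters.\<close>
  define a :: "nat \<Rightarrow> real" where "a j = (2 powr (- r)) ^ j / 2 ^ j" for j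
  have a: "a j > 0" for j by (simp add: a_def)
  have "\<forall>j. \<exists>M. \<forall>m\<ge>M. \<forall>n\<ge>M. Lr_int r (\<lambda>x. u m x - u n x) \<le> ennreal (a j)"
    using cauchy a by blast
  then obtain M where M: "\<And>j m n. m \<ge> M j \<Longrightarrow> n \<ge> M j \<Longrightarrow> Lr_int r (\<lambda>x. u m x - u n x) \<le> ennreal (a j)"
    by metis
  \<comment> \<open>Summing \<open>Suc (M i)\<close> makes the indices strictly increasing and keeps
    \<open>k j\<close> beyond \<open>M j\<close>.\<close>
  define k where "k j = (\<Sum>i\<le>j. Suc (M i))" for j
  have k1: "strict_mono k"
    by (rule strict_monoI_Suc) (simp add: k_def)
  have "M j \<le> k j" for j
    unfolding k_def using member_le_sum[of j "{..j}" "\<lambda>i. Suc (M i)"] by auto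
  then have kM: "Lr_int r (\<lambda>x. u (k (Suc j)) x - u (k j) x) \<le> ennreal (a j)" for j
    using k1 by (intro M) (auto intro: order_trans[OF _ less_imp_le] simp: strict_mono_def)
  define d where "d j x = norm (u (k (Suc j)) x - u (k j) x)" for j x
  have [measurable]: "d j \<in> borel_measurable borel" for j
    unfolding d_def by measurable
  have "(\<integral>\<^sup>+x. (\<Sum>j. ennreal ((2 powr r) ^ j * d j x powr r)) \<partial>lborel)
      = (\<Sum>j. \<integral>\<^sup>+x. ennreal ((2 powr r) ^ j * d j x powr r) \<partial>lborel)"
    by (intro nn_integral_suminf) auto
  also have "\<dots> \<le> (\<Sum>j. ennreal ((1 / 2) ^ j))"
  proof (intro suminf_le allI)
    fix j
    have "(\<integral>\<^sup>+x. ennreal ((2 powr r) ^ j * d j x powr r) \<partial>lborel)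
        = ennreal ((2 powr r) ^ j) * Lr_int r (\<lambda>x. u (k (Suc j)) x - u (k j) x)"
      unfolding Lr_int_def d_def by (subst nn_integral_cmult[symmetric]) (auto simp: ennreal_mult)
    also have "\<dots> \<le> ennreal ((2 powr r) ^ j) * ennreal (a j)"
      by (intro mult_left_mono kM) auto
    also have "\<dots> = ennreal ((2 powr r) ^ j * a j)"
      using a[of j] by (simp add: ennreal_mult)
    also have "(2 powr r) ^ j * a j = (2 powr r * 2 powr (- r)) ^ j / 2 ^ j"
      by (simp add: a_def power_mult_distrib)
    also have "\<dots> = (1 / 2) ^ j"
      by (simp add: powr_add[symmetric] power_divide)
    finally show "(\<integral>\<^sup>+x. ennreal ((2 powr r) ^ j * d j x powr r) \<partial>lborel) \<le> ennreal ((1 / 2) ^ j)" .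
  qed auto
  also have "\<dots> = ennreal (\<Sum>j. (1 / 2) ^ j)"
    by (intro suminf_ennreal_eq sums_ennreal[THEN iffD2] ) (auto intro!: summable_sums summable_geometric)
  also have "\<dots> < \<infinity>" by simp
  finally have fin: "(\<integral>\<^sup>+x. (\<Sum>j. ennreal ((2 powr r) ^ j * d j x powr r)) \<partial>lborel) \<noteq> \<infinity>"
    by auto
  have "AE x in lborel. (\<Sum>j. ennreal ((2 powr r) ^ j * d j x powr r)) \<noteq> \<infinity>"
    by (rule nn_integral_PInf_AE[OF _ fin]) measurable
  then have conv: "AE x in lborel. convergent (\<lambda>j. u (k j) x)"
  proof eventually_elim
    fix x assume "(\<Sum>j. ennreal ((2 powr r) ^ j * d j x powr r)) \<noteq> \<infinity>"
    then have "summable (\<lambda>j. (2 powr r) ^ j * d j x powr r)"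
      by (intro summable_suminf_not_top) (auto simp: top_ennreal_def)
    then have "(\<lambda>j. (2 powr r) ^ j * d j x powr r) \<longlonglongrightarrow> 0"
      by (rule summable_LIMSEQ_zero)
    then have "\<forall>\<^sub>F j in sequentially. (2 powr r) ^ j * d j x powr r < 1"
      by (rule order_tendstoD) auto
    then have "\<forall>\<^sub>F j in sequentially. norm (d j x) \<le> (1 / 2) ^ j"
    proof eventually_elim
      fix j assume *: "(2 powr r) ^ j * d j x powr r < 1"
      have "(2 powr r) ^ j = (2 ^ j) powr r"
        by (simp add: powr_powr mult.commute flip: powr_realpow)
      then have "(2 powr r) ^ j * d j x powr r = (2 ^ j * d j x) powr r"
        by (simp add: powr_mult d_def)
      with * have "(2 ^ j * d j x) powr r < 1 powr r" by simp
      then have "2 ^ j * d j x < 1"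
        using r powr_mono2[of r 1 "2 ^ j * d j x"] by (auto simp: not_less[symmetric])
      then show "norm (d j x) \<le> (1 / 2) ^ j"
        by (simp add: d_def field_simps)
    qed
    then have "summable (\<lambda>j. norm (u (k (Suc j)) x - u (k j) x))"
      unfolding d_def
      by (intro summable_comparison_test_ev[OF _ summable_geometric[of "1 / 2 :: real"]]) auto
    then have "summable (\<lambda>j. u (k (Suc j)) x - u (k j) x)"
      by (rule summable_norm_cancel)
    then have "convergent (\<lambda>n. (\<Sum>j<n. u (k (Suc j)) x - u (k j) x) + u (k 0) x)"
      by (intro convergent_add convergent_const) (simp add: summable_iff_convergent)
    then show "convergent (\<lambda>j. u (k j) x)"
      by (simp add: sum_lessThan_telescope[of "\<lambda>j. u (k j) x"])
  qed
  define f where "f x = lim (\<lambda>j. u (k j) x)" for x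
  have [measurable]: "f \<in> borel_measurable borel"
    unfolding f_def by measurable
  have ae: "AE x in lborel. (\<lambda>j. u (k j) x) \<longlonglongrightarrow> f x"
    using conv by eventually_elim (simp add: f_def convergent_LIMSEQ_iff)
  have le: "Lr_int r (\<lambda>x. u m x - f x) \<le> ennreal e"
    if "\<And>m n. m \<ge> N \<Longrightarrow> n \<ge> N \<Longrightarrow> Lr_int r (\<lambda>x. u m x - u n x) \<le> ennreal e" "m \<ge> N" for m N e
  proof -
    have "Lr_int r (\<lambda>x. u m x - f x) \<le> liminf (\<lambda>j. Lr_int r (\<lambda>x. u m x - u (k j) x))"
      by (rule Lr_int_Fatou) (use ae r in \<open>auto intro!: tendsto_intros elim!: eventually_mono\<close>)
    also have "\<dots> \<le> liminf (\<lambda>j. ennreal e)"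
      using that seq_suble[OF k1]
      by (intro Liminf_mono eventually_sequentiallyI[of N]) (auto intro!: that intro: order_trans)
    also have "\<dots> = ennreal e"
      by (simp add: Liminf_const)
    finally show ?thesis .
  qed
  have lim: "(\<lambda>m. Lr_int r (\<lambda>x. u m x - f x)) \<longlonglongrightarrow> 0"
  proof (rule order_tendstoI)
    fix c :: ennreal assume "0 < c"
    then obtain e where e: "0 < e" "ennreal e < c"
      by (metis dense ennreal_cases ennreal_less_zero_iff not_gr_zero order.strict_trans top.not_eq_extremum)
    obtain N where "\<forall>m\<ge>N. \<forall>n\<ge>N. Lr_int r (\<lambda>x. u m x - u n x) \<le> ennreal e"
      using cauchy[OF e(1)] by blast
    then have "\<forall>m\<ge>N. Lr_int r (\<lambda>x. u m x - f x) \<le> ennreal e"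
      using le by blast
    then show "\<forall>\<^sub>F m in sequentially. Lr_int r (\<lambda>x. u m x - f x) < c"
      using e(2) by (auto simp: eventually_sequentially intro: order.strict_trans1)
  qed auto
  obtain N where N: "\<And>m n. m \<ge> N \<Longrightarrow> n \<ge> N \<Longrightarrow> Lr_int r (\<lambda>x. u m x - u n x) \<le> ennreal 1"
    using cauchy[of 1] by auto
  have "Lr_int r (\<lambda>x. u N x - f x) \<le> ennreal 1"
    using le[OF N] by auto
  then have "(\<lambda>x. u N x - f x) \<in> Lr r"
    by (auto simp: Lr_iff intro: order.strict_trans1)
  from Lr_diff[OF u[of N] this r] have "(\<lambda>x. u N x - (u N x - f x)) \<in> Lr r" .
  then have "f \<in> Lr r" by simp
  then show ?thesis
    using that[OF Lr_tendstoI[OF r u _ lim]] by blast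
qed

text \<open>The tool for extending operators: images of a convergent sequence are Cauchy as soon as
  their differences are dominated by the differences of the arguments, possibly in another
  exponent.\<close>

lemma Lr_complete_dominated:
  assumes u: "Lr_tendsto s u f" and s: "s > 0" and v: "\<And>n. v n \<in> Lr r" and r: "r > 0" and c: "c \<ge> 0"
    and le: "\<And>m n. Lr_int r (\<lambda>x. v m x - v n x) \<le> ennreal c * Lr_int s (\<lambda>x. u m x - u n x)"
  obtains g where "Lr_tendsto r v g"
proof (rule Lr_complete[OF v r])
  fix e :: real assume e: "e > 0"
  \<comment> \<open>\<open>c + 1\<close> keeps the divisor positive when \<open>c = 0\<close>; the
    other factors compensate the quasi-triangle inequality and its two summands.\<close>
  define c' where "c' = (c + 1) * 2 powr s * 2"
  have c': "c' > 0" using c by (simp add: c'_def)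
  have "\<forall>\<^sub>F n in sequentially. Lr_int s (\<lambda>x. u n x - f x) < ennreal (e / c')"
    using Lr_tendstoD(3)[OF u s] by (rule order_tendstoD) (use e c' in auto)
  then obtain N where N: "\<And>n. n \<ge> N \<Longrightarrow> Lr_int s (\<lambda>x. u n x - f x) \<le> ennreal (e / c')"
    by (auto simp: eventually_sequentially intro: less_imp_le)
  have "Lr_int r (\<lambda>x. v m x - v n x) \<le> ennreal e" if "m \<ge> N" "n \<ge> N" for m n
  proof -
    have [measurable]: "u n \<in> borel_measurable borel" "f \<in> borel_measurable borel" for n
      using Lr_tendstoD[OF u s] by (auto simp: Lr_iff)
    have "Lr_int r (\<lambda>x. v m x - v n x) \<le> ennreal c * Lr_int s (\<lambda>x. u m x - u n x)"
      by (rule le)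
    also have "\<dots> \<le> ennreal c * (ennreal (2 powr s) * (Lr_int s (\<lambda>x. u m x - f x) + Lr_int s (\<lambda>x. f x - u n x)))"
      using s by (intro mult_left_mono Lr_int_triangle) auto
    also have "\<dots> \<le> ennreal c * (ennreal (2 powr s) * (ennreal (e / c') + ennreal (e / c')))"
      using that N[of m] N[of n] by (intro mult_left_mono add_mono) (auto simp: Lr_int_minus_commute[of s f])
    also have "\<dots> = ennreal (c * (2 powr s * (e / c' + e / c')))"
      using c e c' by (simp add: ennreal_mult[symmetric] ennreal_plus[symmetric] del: ennreal_plus)
    also have "c * (2 powr s * (e / c' + e / c')) = e * (c / (c + 1))"
      using c by (simp add: c'_def divide_simps)
    also have "\<dots> \<le> e"
      using c e by (intro mult_left_le) auto
    finally show ?thesis by (simp add: ennreal_leI)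
  qed
  then show "\<exists>M. \<forall>m\<ge>M. \<forall>n\<ge>M. Lr_int r (\<lambda>x. v m x - v n x) \<le> ennreal e"
    by blast
qed (use that in blast)

text \<open>The zero sequence \<open>u n x - u n x\<close> converges to \<open>f x - g x\<close>,
  and Fatou's lemma then makes the integral of the difference vanish.\<close>

lemma Lr_tendsto_unique:
  assumes "Lr_tendsto r u f" "Lr_tendsto r u g" "r > 0"
  shows "AE x in lborel. f x = g x"
proof -
  have "Lr_tendsto r (\<lambda>n x. u n x - u n x) (\<lambda>x. f x - g x)"
    using assms by (intro Lr_tendsto_diff)
  then have "Lr_int r (\<lambda>x. f x - g x) \<le> 0"
    by (rule Lr_int_Fatou_le[OF _ assms(3,3) _ tendsto_const]) (simp add: Lr_int_def)
  moreover have "(\<lambda>x. f x - g x) \<in> borel_measurable borel"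
    using Lr_tendstoD(2)[OF assms(1,3)] Lr_tendstoD(2)[OF assms(2,3)]
    by (intro borel_measurable_diff LrD(1))
  ultimately show ?thesis
    using Lr_int_eq_0_iff[of "\<lambda>x. f x - g x" r] by auto
qed

lemma Lr_tendsto_dct:
  assumes [measurable]: "\<And>n. u n \<in> borel_measurable borel" "f \<in> borel_measurable borel"
    and g: "g \<in> Lr r" and r: "r > 0"
    and ae: "AE x in lborel. (\<lambda>n. u n x) \<longlonglongrightarrow> f x"
    and u: "\<And>n x. norm (u n x) \<le> norm (g x)" and f: "\<And>x. norm (f x) \<le> norm (g x)"
  shows "Lr_tendsto r u f"
proof (rule Lr_tendstoI[OF r])
  show "u n \<in> Lr r" for n
    using u r by (intro Lr_mono[OF g]) auto
  show "f \<in> Lr r"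
    using f r by (intro Lr_mono[OF g]) auto
  have [measurable]: "g \<in> borel_measurable borel"
    using g by (rule LrD)
  define w where "w x = (2 powr r * 2) * norm (g x) powr r" for x
  have "(\<lambda>n. \<integral>\<^sup>+x. ennreal (norm (u n x - f x) powr r) \<partial>lborel) \<longlonglongrightarrow> (\<integral>\<^sup>+x. 0 \<partial>(lborel :: real measure))"
  proof (rule nn_integral_dominated_convergence[where w="\<lambda>x. ennreal (w x)"])
    show "AE x in lborel. ennreal (norm (u j x - f x) powr r) \<le> ennreal (w x)" for j
    proof (rule AE_I2)
      fix x
      have "norm (u j x - f x) powr r \<le> (norm (g x) + norm (g x)) powr r"
        using r norm_triangle_ineq4[of "u j x" "f x"] u[of j x] f[of x] by (intro powr_mono2) auto
      also have "\<dots> \<le> w x"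
        using powr_add_le[of r "norm (g x)" "norm (g x)"] r by (simp add: w_def)
      finally show "ennreal (norm (u j x - f x) powr r) \<le> ennreal (w x)"
        by (rule ennreal_leI)
    qed
    have "(\<integral>\<^sup>+x. ennreal (w x) \<partial>lborel) = ennreal (2 powr r * 2) * Lr_int r g"
      unfolding w_def Lr_int_def by (subst nn_integral_cmult[symmetric]) (auto simp: ennreal_mult')
    also have "\<dots> < \<infinity>"
      using g by (simp add: Lr_iff ennreal_mult_less_top)
    finally show "(\<integral>\<^sup>+x. ennreal (w x) \<partial>lborel) < \<infinity>" .
    show "AE x in lborel. (\<lambda>n. ennreal (norm (u n x - f x) powr r)) \<longlonglongrightarrow> 0"
      using ae
    proof eventually_elim
      fix x assume "(\<lambda>n. u n x) \<longlonglongrightarrow> f x"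
      then have "(\<lambda>n. norm (u n x - f x)) \<longlonglongrightarrow> 0"
        by (simp add: LIM_zero tendsto_norm_zero)
      then have "(\<lambda>n. norm (u n x - f x) powr r) \<longlonglongrightarrow> 0 powr r"
        using r by (intro tendsto_powr2 tendsto_const) auto
      then have "(\<lambda>n. ennreal (norm (u n x - f x) powr r)) \<longlonglongrightarrow> ennreal (0 powr r)"
        by (rule tendsto_ennrealI)
      then show "(\<lambda>n. ennreal (norm (u n x - f x) powr r)) \<longlonglongrightarrow> 0"
        by simp
    qed
  qed (auto simp: w_def)
  then show "(\<lambda>n. Lr_int r (\<lambda>x. u n x - f x)) \<longlonglongrightarrow> 0"
    by (simp add: Lr_int_def)
qed

section \<open>Step functions\<close>

text \<open>The working class between step functions and \<open>Lr r\<close>: it is contained in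
  every \<open>Lr r\<close> with \<open>r > 0\<close>, and it accommodates the good and bad parts of
  a decomposition and the truncated dual functions.\<close>

definition bounded_support :: "(real \<Rightarrow> complex) \<Rightarrow> bool" where
  "bounded_support f \<longleftrightarrow> f \<in> borel_measurable borel \<and>
     (\<exists>B R. \<forall>x. norm (f x) \<le> B * indicator {-R..R} x)"

lemma bounded_supportE:
  assumes "bounded_support f"
  obtains B R where "f \<in> borel_measurable borel" "B > 0" "R > 0"
    "\<And>x. norm (f x) \<le> B * indicator {-R..R} x" "\<And>x. norm (f x) \<le> B"
proof -
  obtain B R where f: "f \<in> borel_measurable borel" "\<And>x. norm (f x) \<le> B * indicator {-R..R} x"
    using assms by (auto simp: bounded_support_def)
  have le: "norm (f x) \<le> max B 1 * indicator {-max R 1..max R 1} x" for x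
    using f(2)[of x] by (cases "x \<in> {-R..R}") (auto simp: indicator_def)
  have "norm (f x) \<le> max B 1" for x
    using f(2)[of x] by (cases "x \<in> {-R..R}") auto
  with f(1) le show ?thesis
    by (intro that[of "max B 1" "max R 1"]) auto
qed

lemma bounded_supportI:
  assumes "f \<in> borel_measurable borel" "\<And>x. norm (f x) \<le> B" "\<And>x. x \<notin> {-R..R} \<Longrightarrow> f x = 0"
  shows "bounded_support f"
proof -
  have "norm (f x) \<le> B * indicator {-R..R} x" for x
    using assms(2)[of x] assms(3)[of x] by (auto simp: indicator_def)
  then show ?thesis
    using assms(1) by (auto simp: bounded_support_def)
qed

lemma bounded_support_add:
  assumes u: "bounded_support u" and v: "bounded_support v"
  shows "bounded_support (\<lambda>x. u x + v x)"
proof -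
  obtain B R where 1: "\<And>x. norm (u x) \<le> B * indicator {-R..R} x" "\<And>x. norm (u x) \<le> B"
    using bounded_supportE[OF u] by metis
  obtain B' R' where 2: "\<And>x. norm (v x) \<le> B' * indicator {-R'..R'} x" "\<And>x. norm (v x) \<le> B'"
    using bounded_supportE[OF v] by metis
  show ?thesis
  proof (rule bounded_supportI[of _ "B + B'" "max R R'"])
    show "(\<lambda>x. u x + v x) \<in> borel_measurable borel"
      using u v by (auto simp: bounded_support_def)
    show "norm (u x + v x) \<le> B + B'" for x
      by (rule order_trans[OF norm_triangle_ineq add_mono[OF 1(2) 2(2)]])
    fix x assume "x \<notin> {- max R R'..max R R'}"
    then have "x \<notin> {-R..R}" "x \<notin> {-R'..R'}" by auto
    then show "u x + v x = 0" using 1(1)[of x] 2(1)[of x] by simp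
  qed
qed

lemma indicator_Icc_Lr:
  assumes "r > 0"
  shows "(\<lambda>x. complex_of_real (B * indicator {a..b::real} x)) \<in> Lr r"
proof -
  have "Lr_int r (\<lambda>x. complex_of_real (B * indicator {a..b} x))
      = (\<integral>\<^sup>+x. ennreal (\<bar>B\<bar> powr r) * indicator {a..b} x \<partial>lborel)"
    unfolding Lr_int_def
    by (intro nn_integral_cong) (auto simp: indicator_def norm_mult)
  also have "\<dots> < \<infinity>"
    by (simp add: nn_integral_cmult_indicator ennreal_mult_less_top emeasure_lborel_Icc_eq)
  finally show ?thesis
    by (simp add: Lr_iff)
qed

lemma bounded_support_Lr:
  assumes "bounded_support f" "r > 0"
  shows "f \<in> Lr r"
proof -
  obtain B R where f: "f \<in> borel_measurable borel" "B > 0" "R > 0"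
      "\<And>x. norm (f x) \<le> B * indicator {-R..R} x"
    using assms bounded_supportE by metis
  have "norm (f x) \<le> norm (complex_of_real (B * indicator {-R..R} x))" for x
    using f(2,4) by (simp add: norm_mult)
  then show ?thesis
    using assms(2) f(1) by (intro Lr_mono[OF indicator_Icc_Lr[of r B "-R" R]]) auto
qed

lemma bounded_support_integrable: "bounded_support f \<Longrightarrow> integrable lborel f"
  using bounded_support_Lr[of f 1] by (simp add: Lr_1_iff)

text \<open>Constancy on the dyadic cells of length \<open>1 / 2 ^ N\<close>, expressed by reading
  \<open>f\<close> at the left end of the cell of \<open>x\<close>. These are the cells that
  repeated halving of an interval from \<open>-(2 ^ k)\<close> to \<open>2 ^ k\<close> arrives
  at.\<close>

definition step_fun :: "(real \<Rightarrow> complex) \<Rightarrow> bool" where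
  "step_fun f \<longleftrightarrow> (\<exists>N k. (\<forall>x. f x = f (of_int \<lfloor>x * 2 ^ N\<rfloor> / 2 ^ N)) \<and>
     (\<forall>x. x \<notin> {-(2 ^ k)..<2 ^ k} \<longrightarrow> f x = 0))"

text \<open>The bounds \<open>-(2 ^ k)\<close> and \<open>2 ^ k\<close> are grid points, so a
  half-open cell lies wholly inside or wholly outside the interval.\<close>

lemma floor_dyadic_mem_iff:
  fixes x :: real
  shows "of_int \<lfloor>x * 2 ^ N\<rfloor> / 2 ^ N \<in> {-(2 ^ k)..<(2 :: real) ^ k} \<longleftrightarrow> x \<in> {-(2 ^ k)..<(2 :: real) ^ k}"
proof -
  have "- (2 ^ k) \<le> of_int \<lfloor>x * 2 ^ N\<rfloor> / (2 :: real) ^ N \<longleftrightarrow> of_int (- (2 ^ k * 2 ^ N)) \<le> (of_int \<lfloor>x * 2 ^ N\<rfloor> :: real)"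
    by (simp add: le_divide_eq)
  also have "\<dots> \<longleftrightarrow> - (2 ^ k * 2 ^ N) \<le> \<lfloor>x * 2 ^ N\<rfloor>"
    by (simp only: of_int_le_iff)
  also have "\<dots> \<longleftrightarrow> - (2 ^ k) \<le> x"
    by (simp add: le_floor_iff) (metis mult_le_cancel_right_pos mult_minus_left zero_less_numeral zero_less_power)
  finally have 1: "- (2 ^ k) \<le> of_int \<lfloor>x * 2 ^ N\<rfloor> / (2 :: real) ^ N \<longleftrightarrow> - (2 ^ k) \<le> x" .
  have "of_int \<lfloor>x * 2 ^ N\<rfloor> / (2 :: real) ^ N < 2 ^ k \<longleftrightarrow> (of_int \<lfloor>x * 2 ^ N\<rfloor> :: real) < of_int (2 ^ k * 2 ^ N)"
    by (simp add: divide_less_eq)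
  also have "\<dots> \<longleftrightarrow> \<lfloor>x * 2 ^ N\<rfloor> < 2 ^ k * 2 ^ N"
    by (simp only: of_int_less_iff)
  also have "\<dots> \<longleftrightarrow> x < 2 ^ k"
    by (simp add: floor_less_iff)
  finally show ?thesis using 1 by simp
qed

lemma step_fun_bounded_support:
  assumes "step_fun f"
  shows "bounded_support f"
proof -
  obtain N k where f: "\<And>x. f x = f (of_int \<lfloor>x * 2 ^ N\<rfloor> / 2 ^ N)"
      "\<And>x. x \<notin> {-(2 ^ k)..<2 ^ k} \<Longrightarrow> f x = 0"
    using assms unfolding step_fun_def by blast
  have 1: "(\<lambda>j :: int. f (of_int j / 2 ^ N)) \<in> measurable (count_space UNIV) borel"
    by simp
  have 2: "(\<lambda>x :: real. \<lfloor>x * 2 ^ N\<rfloor>) \<in> measurable borel (count_space UNIV)"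
    by measurable
  have "f = (\<lambda>x. f (of_int \<lfloor>x * 2 ^ N\<rfloor> / 2 ^ N))"
    using f(1) by (rule ext)
  with measurable_compose[OF 2 1] have meas: "f \<in> borel_measurable borel"
    by (rule back_subst[where P="\<lambda>g. g \<in> borel_measurable borel", OF _ sym])
  define S where "S = insert 0 ((\<lambda>j :: int. f (of_int j / 2 ^ N)) ` {- (2 ^ (k + N))..<2 ^ (k + N)})"
  have mem: "f x \<in> S" for x
  proof (cases "x \<in> {-(2 ^ k)..<2 ^ k}")
    case True
    then have *: "of_int \<lfloor>x * 2 ^ N\<rfloor> / 2 ^ N \<in> {-(2 ^ k)..<(2::real) ^ k}"
      by (simp only: floor_dyadic_mem_iff)
    have "- (2 ^ (k + N)) \<le> real_of_int \<lfloor>x * 2 ^ N\<rfloor>" "real_of_int \<lfloor>x * 2 ^ N\<rfloor> < 2 ^ (k + N)"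
      using * by (auto simp: power_add field_simps)
    then have "\<lfloor>x * 2 ^ N\<rfloor> \<in> {- (2 ^ (k + N))..<2 ^ (k + N)}"
      by (metis (mono_tags, opaque_lifting) atLeastLessThan_iff of_int_le_iff of_int_less_iff of_int_minus of_int_numeral of_int_power)
    then show ?thesis
      using f(1)[of x] unfolding S_def by blast
  next
    case False
    then show ?thesis using f(2) by (simp add: S_def)
  qed
  have "finite S" by (simp add: S_def)
  then obtain B where B: "\<And>z. z \<in> S \<Longrightarrow> norm z \<le> B"
    using finite_imp_bounded bounded_iff by metis
  show ?thesis
    by (rule bounded_supportI[OF meas, of B "2 ^ k"]) (use B mem f(2) in auto)
qed

text \<open>A measurable function is an a.e. limit of continuous ones; clipping and cutting off
  restore the bound and the support and provide the dominating function. A continuous function is in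
  turn the limit of its samples at the left ends of dyadic cells.\<close>

lemma step_fun_L1_approx:
  assumes [measurable]: "f \<in> borel_measurable borel" and B: "B > 0" "\<And>x. norm (f x) \<le> B"
    and supp: "\<And>x. x \<notin> {-(2 ^ k)..<2 ^ k} \<Longrightarrow> f x = 0" and e: "e > 0"
  obtains s where "step_fun s" "\<And>x. norm (s x) \<le> B" "\<And>x. x \<notin> {-(2 ^ k)..<2 ^ k} \<Longrightarrow> s x = 0"
    "Lr_int 1 (\<lambda>x. s x - f x) \<le> ennreal e"
proof -
  \<comment> \<open>The radial retraction onto the ball of radius \<open>B\<close>: continuous, and
    the identity on all values of \<open>f\<close>.\<close>
  define clip where "clip z = z * complex_of_real (B / max B (norm z))" for z :: complex
  have clip_cont: "continuous_on UNIV clip"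
    unfolding clip_def using B(1) by (intro continuous_intros) auto
  have clip_le: "norm (clip z) \<le> B" for z
    using B(1) by (auto simp: clip_def norm_mult max_def field_simps norm_divide)
  have clip_id: "clip z = z" if "norm z \<le> B" for z
    using that B(1) by (simp add: clip_def max_def)
  define J where "J x = complex_of_real (indicator {-(2 ^ k)..<2 ^ k} x)" for x :: real
  have [measurable]: "J \<in> borel_measurable borel"
    unfolding J_def by measurable
  have J_le: "norm (J x) \<le> 1" for x
    by (auto simp: J_def indicator_def)
  have dom: "(\<lambda>x. complex_of_real (B * indicator {-(2 ^ k)..2 ^ k} x)) \<in> Lr 1"
    by (rule indicator_Icc_Lr) auto
  have Jdom: "norm (J x * clip z) \<le> norm (complex_of_real (B * indicator {-(2 ^ k)..2 ^ k} x))" for x z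
    using clip_le[of z] B(1) by (auto simp: J_def indicator_def norm_mult)
  have fJ: "J x * clip (f x) = f x" for x
    using supp[of x] B(2)[of x] by (auto simp: J_def indicator_def clip_id)
  have fdom: "norm (f x) \<le> norm (complex_of_real (B * indicator {-(2 ^ k)..2 ^ k} x))" for x
    using Jdom[of x "f x"] by (simp add: fJ)
  have pick: "\<exists>n. Lr_int 1 (\<lambda>x. u n x - h x) \<le> ennreal (e / 4)"
    if "Lr_tendsto 1 u h" for u :: "nat \<Rightarrow> real \<Rightarrow> complex" and h
  proof -
    have "\<forall>\<^sub>F n in sequentially. Lr_int 1 (\<lambda>x. u n x - h x) < ennreal (e / 4)"
      using Lr_tendstoD(3)[OF that] by (rule order_tendstoD) (use e in auto)
    then show ?thesis
      using eventually_happens'[OF sequentially_bot] less_imp_le by blast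
  qed
  have "f measurable_on UNIV"
    by (simp add: measurable_on_iff_borel_measurable measurable_completion lebesgue_on_UNIV_eq)
  then obtain N g where N: "negligible N" and g: "\<And>n. continuous_on UNIV (g n)"
      "\<And>x. x \<notin> N \<Longrightarrow> (\<lambda>n. g n x) \<longlonglongrightarrow> f x"
    unfolding measurable_on_def by auto
  have [measurable]: "g n \<in> borel_measurable borel" "clip \<in> borel_measurable borel" for n
    using g(1) clip_cont by (auto intro: borel_measurable_continuous_onI)
  have "AE x in lebesgue. x \<notin> N"
    using N by (simp add: negligible_iff_null_sets AE_not_in)
  then have "AE x in lborel. x \<notin> N"
    by (rule AE_completion_iff[THEN iffD1])
  then have "AE x in lborel. (\<lambda>n. J x * clip (g n x)) \<longlonglongrightarrow> f x"
  proof eventually_elim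
    fix x assume "x \<notin> N"
    then have "(\<lambda>n. clip (g n x)) \<longlonglongrightarrow> clip (f x)"
      by (intro continuous_on_tendsto_compose[OF clip_cont g(2)]) auto
    then have "(\<lambda>n. J x * clip (g n x)) \<longlonglongrightarrow> J x * clip (f x)"
      by (intro tendsto_intros)
    then show "(\<lambda>n. J x * clip (g n x)) \<longlonglongrightarrow> f x"
      by (simp add: fJ)
  qed
  then have "Lr_tendsto 1 (\<lambda>n x. J x * clip (g n x)) f"
    by (intro Lr_tendsto_dct[OF _ _ dom] Jdom fdom) auto
  from pick[OF this] obtain n where n: "Lr_int 1 (\<lambda>x. J x * clip (g n x) - f x) \<le> ennreal (e / 4)"
    by blast
  define h where "h x = J x * clip (g n x)" for x
  define s where "s M x = J x * clip (g n (of_int \<lfloor>x * 2 ^ M\<rfloor> / 2 ^ M))" for M :: nat and x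
  have [measurable]: "h \<in> borel_measurable borel" "s M \<in> borel_measurable borel" for M
    unfolding h_def s_def by measurable
  have fl: "(\<lambda>M. of_int \<lfloor>x * 2 ^ M\<rfloor> / 2 ^ M) \<longlonglongrightarrow> x" for x :: real
  proof (rule tendsto_sandwich[of "\<lambda>M. x - (1 / 2) ^ M" _ _ "\<lambda>M. x"])
    have "(\<lambda>M. x - (1 / 2) ^ M) \<longlonglongrightarrow> x - 0"
      by (intro tendsto_intros LIMSEQ_power_zero) auto
    then show "(\<lambda>M. x - (1 / 2) ^ M) \<longlonglongrightarrow> x" by simp
    have "(x * 2 ^ M - 1) / 2 ^ M \<le> of_int \<lfloor>x * 2 ^ M\<rfloor> / 2 ^ M" for M :: nat
      by (intro divide_right_mono) (linarith, simp)
    then show "\<forall>\<^sub>F M in sequentially. x - (1 / 2) ^ M \<le> of_int \<lfloor>x * 2 ^ M\<rfloor> / 2 ^ M"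
      by (intro always_eventually allI) (simp add: diff_divide_distrib power_divide)
  qed (auto intro!: always_eventually simp: field_simps)
  have "(\<lambda>M. s M x) \<longlonglongrightarrow> h x" for x
  proof -
    have "(\<lambda>M. g n (of_int \<lfloor>x * 2 ^ M\<rfloor> / 2 ^ M)) \<longlonglongrightarrow> g n x"
      by (rule continuous_on_tendsto_compose[OF g(1) fl[of x]]) auto
    then have "(\<lambda>M. clip (g n (of_int \<lfloor>x * 2 ^ M\<rfloor> / 2 ^ M))) \<longlonglongrightarrow> clip (g n x)"
      by (rule continuous_on_tendsto_compose[OF clip_cont]) auto
    then show ?thesis
      unfolding s_def h_def by (intro tendsto_intros)
  qed
  then have "Lr_tendsto 1 s h"
    by (intro Lr_tendsto_dct[OF _ _ dom]) (use Jdom in \<open>auto simp: s_def h_def simp del: of_real_mult norm_of_real\<close>)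
  from pick[OF this] obtain M where M: "Lr_int 1 (\<lambda>x. s M x - h x) \<le> ennreal (e / 4)"
    by blast
  have "J x = J (of_int \<lfloor>x * 2 ^ M\<rfloor> / 2 ^ M)" for x
    unfolding J_def using floor_dyadic_mem_iff[of x M k] by (simp only: indicator_def)
  then have "step_fun (s M)"
    unfolding step_fun_def by (intro exI[of _ M] exI[of _ k]) (auto simp: s_def J_def)
  moreover have "Lr_int 1 (\<lambda>x. s M x - f x) \<le> ennreal e"
  proof -
    have "Lr_int 1 (\<lambda>x. s M x - f x)
        \<le> ennreal (2 powr 1) * (Lr_int 1 (\<lambda>x. s M x - h x) + Lr_int 1 (\<lambda>x. h x - f x))"
      by (rule Lr_int_triangle) auto
    also have "\<dots> \<le> ennreal (2 powr 1) * (ennreal (e / 4) + ennreal (e / 4))"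
      using M n by (intro mult_left_mono add_mono) (auto simp: h_def)
    also have "\<dots> = ennreal e"
    proof -
      have "ennreal (e / 4) + ennreal (e / 4) = ennreal (e / 2)"
        using e by (simp flip: ennreal_plus)
      moreover have "ennreal (2 powr 1) * ennreal (e / 2) = ennreal (2 powr 1 * (e / 2))"
        using e by (intro ennreal_mult[symmetric]) auto
      ultimately show ?thesis by simp
    qed
    finally show ?thesis .
  qed
  moreover have "norm (s M x) \<le> B" for x
    using B(1) clip_le[of "g n (of_int \<lfloor>x * 2 ^ M\<rfloor> / 2 ^ M)"] by (auto simp: s_def J_def indicator_def)
  moreover have "s M x = 0" if "x \<notin> {-(2 ^ k)..<2 ^ k}" for x
    using that by (simp add: s_def J_def)
  ultimately show ?thesis
    using that by blast
qed

text \<open>A crude interpolation between L^1 and the sup norm; it lets a single L^1 approximation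
  serve several exponents at once.\<close>

lemma Lr_int_le_L1:
  assumes [measurable]: "f \<in> borel_measurable borel" and B: "\<And>x. norm (f x) \<le> B" "B \<ge> 1" and r: "r \<ge> 1"
  shows "Lr_int r f \<le> ennreal (B powr r) * Lr_int 1 f"
proof -
  have "norm (f x) powr r \<le> B powr r * norm (f x)" for x
  proof (cases "f x = 0")
    case False
    then have "norm (f x) powr r = norm (f x) powr (r - 1) * norm (f x)"
      by (simp add: powr_diff)
    also have "norm (f x) powr (r - 1) \<le> B powr (r - 1)"
      using B r by (intro powr_mono2) auto
    also have "B powr (r - 1) \<le> B powr r"
      using B by (intro powr_mono) auto
    finally show ?thesis by (simp add: mult_right_mono)
  qed auto
  then have "Lr_int r f \<le> (\<integral>\<^sup>+x. ennreal (B powr r) * ennreal (norm (f x)) \<partial>lborel)"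
    unfolding Lr_int_def by (intro nn_integral_mono) (simp add: ennreal_mult[symmetric])
  also have "\<dots> = ennreal (B powr r) * Lr_int 1 f"
    by (simp add: nn_integral_cmult Lr_int_1)
  finally show ?thesis .
qed

text \<open>One sequence has to serve two exponents: convergence in L^2 identifies the limit of the
  images, convergence in L^r provides the bound.\<close>

lemma step_fun_dense:
  assumes f: "f \<in> Lr r" "f \<in> Lr q" and r: "r \<ge> 1" and q: "q \<ge> 1"
  obtains s where "\<And>n. step_fun (s n)" "Lr_tendsto r s f" "Lr_tendsto q s f"
proof -
  have [measurable]: "f \<in> borel_measurable borel"
    using f(1) by (rule LrD)
  define b where "b n = 2 * (real n + 1)" for n
  \<comment> \<open>So small that, even after multiplication by \<open>b n powr p\<close> with
    \<open>p = r\<close> or \<open>p = q\<close>, the error is at most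
    \<open>1 / (real n + 1)\<close>. Here \<open>b n\<close> bounds the difference of two functions
    of size at most \<open>real n + 1\<close>.\<close>
  define e where "e n = 1 / ((real n + 1) * (b n powr r + b n powr q))" for n
  have b: "b n \<ge> 1" for n by (simp add: b_def)
  have bp: "b n powr r + b n powr q > 0" for n
    using b[of n] by (intro add_pos_nonneg) auto
  have e: "e n > 0" for n
    using bp[of n] by (simp add: e_def)
  define t where "t n x = (if norm (f x) \<le> real n + 1 \<and> x \<in> {-(2 ^ n)..<2 ^ n} then f x else 0)" for n x
  have [measurable]: "t n \<in> borel_measurable borel" for n
    unfolding t_def by measurable
  have "\<exists>s. step_fun s \<and> (\<forall>x. norm (s x) \<le> real n + 1) \<and> Lr_int 1 (\<lambda>x. s x - t n x) \<le> ennreal (e n)" for n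
  proof -
    obtain s where "step_fun s" "\<And>x. norm (s x) \<le> real n + 1" "Lr_int 1 (\<lambda>x. s x - t n x) \<le> ennreal (e n)"
      by (rule step_fun_L1_approx[of "t n" "real n + 1" n "e n"]) (use e in \<open>auto simp: t_def\<close>)
    then show ?thesis by blast
  qed
  then obtain s where s: "\<And>n. step_fun (s n)" "\<And>n x. norm (s n x) \<le> real n + 1"
      "\<And>n. Lr_int 1 (\<lambda>x. s n x - t n x) \<le> ennreal (e n)"
    by metis
  have [measurable]: "s n \<in> borel_measurable borel" for n
    using step_fun_bounded_support[OF s(1)] by (simp add: bounded_support_def)
  have lim: "(\<lambda>n. t n x) \<longlonglongrightarrow> f x" for x
  proof (rule tendsto_eventually)

    obtain n1 where n1: "norm (f x) \<le> real n1" using real_arch_simple by blast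
    obtain n2 where n2: "\<bar>x\<bar> < 2 ^ n2" using real_arch_pow[of 2 "\<bar>x\<bar>"] by auto
    have "t n x = f x" if "n \<ge> max n1 n2" for n
    proof -
      have "(2 :: real) ^ n2 \<le> 2 ^ n" using that by (intro power_increasing) auto
      then have "- (2 ^ n) \<le> x" "x < 2 ^ n" using n2 by linarith+
      then have "x \<in> {-(2 ^ n)..<2 ^ n}" by simp
      moreover have "norm (f x) \<le> real n + 1" using that n1 by linarith
      ultimately show ?thesis
        by (simp add: t_def)
    qed
    then show "\<forall>\<^sub>F n in sequentially. t n x = f x"
      by (rule eventually_sequentiallyI)
  qed
  have tend: "Lr_tendsto p s f" if p: "p = r \<or> p = q" for p
  proof (rule Lr_tendstoI)
    have p1: "p \<ge> 1" "p > 0" and pf: "f \<in> Lr p" using p r q f by auto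
    have t: "Lr_tendsto p t f"
      by (rule Lr_tendsto_dct[OF _ _ pf]) (use p1 lim in \<open>auto simp: t_def\<close>)
    have "Lr_int p (\<lambda>x. s n x - t n x) \<le> ennreal (1 / (real n + 1))" for n
    proof -
      have "norm (s n x - t n x) \<le> b n" for x
        using norm_triangle_ineq4[of "s n x" "t n x"] s(2)[of n x] by (auto simp: t_def b_def split: if_splits)
      then have "Lr_int p (\<lambda>x. s n x - t n x) \<le> ennreal (b n powr p) * Lr_int 1 (\<lambda>x. s n x - t n x)"
        using b p1 by (intro Lr_int_le_L1) auto
      also have "\<dots> \<le> ennreal (b n powr p) * ennreal (e n)"
        by (intro mult_left_mono s) auto
      also have "\<dots> = ennreal (b n powr p * e n)"
        using e[of n] by (simp add: ennreal_mult)
      also have "b n powr p * e n \<le> 1 / (real n + 1)"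
      proof -
        have "b n powr p \<le> b n powr r + b n powr q"
          using p by auto
        then show ?thesis
          using bp[of n] by (simp add: e_def divide_simps)
      qed
      finally show ?thesis by (simp add: ennreal_leI)
    qed
    moreover have "(\<lambda>n. ennreal (1 / (real n + 1))) \<longlonglongrightarrow> ennreal 0"
      by (intro tendsto_ennrealI) real_asymp
    then have "(\<lambda>n. ennreal (1 / (real n + 1))) \<longlonglongrightarrow> 0"
      by simp
    ultimately have "(\<lambda>n. Lr_int p (\<lambda>x. s n x - t n x)) \<longlonglongrightarrow> 0"
      using tendsto_0_le_ennreal[of "\<lambda>n. ennreal (1 / (real n + 1))" _ 1] by simp
    then have "(\<lambda>n. Lr_int p (\<lambda>x. s n x - t n x) + Lr_int p (\<lambda>x. t n x - f x)) \<longlonglongrightarrow> 0 + 0"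
      by (intro tendsto_add Lr_tendstoD(3)[OF t p1(2)])
    then have "(\<lambda>n. Lr_int p (\<lambda>x. s n x - t n x) + Lr_int p (\<lambda>x. t n x - f x)) \<longlonglongrightarrow> 0"
      by simp
    then show "(\<lambda>n. Lr_int p (\<lambda>x. s n x - f x)) \<longlonglongrightarrow> 0"
      by (rule tendsto_0_le_ennreal) (rule Lr_int_triangle, use p1 in auto)
    show "s n \<in> Lr p" for n
      by (rule bounded_support_Lr[OF step_fun_bounded_support[OF s(1)] p1(2)])
  qed (use p r q f in auto)
  show ?thesis
    using that[of s] s(1) tend by blast
qed

section \<open>The Fourier transform\<close>

text \<open>Angular frequency without a normalising factor: Plancherel carries
  \<open>2 * pi\<close>, and the inverse transform is the reflected transform times
  \<open>1 / (2 * pi)\<close>.\<close>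

definition ft :: "(real \<Rightarrow> complex) \<Rightarrow> real \<Rightarrow> complex" where
  "ft f \<xi> = (LINT t|lborel. f t * cis (- (\<xi> * t)))"

lemma borel_measurable_cis [measurable (raw)]:
  "f \<in> borel_measurable M \<Longrightarrow> (\<lambda>x. cis (f x)) \<in> borel_measurable M"
  unfolding cis_conv_exp by measurable

lemma borel_measurable_cnj [measurable (raw)]:
  "f \<in> borel_measurable M \<Longrightarrow> (\<lambda>x. cnj (f x)) \<in> borel_measurable M"
  by (rule borel_measurable_continuous_on[of cnj]) (auto intro: continuous_intros)

lemma integrable_mult_bounded:
  fixes f g :: "real \<Rightarrow> complex"
  assumes f: "integrable lborel f" and g: "g \<in> borel_measurable borel" "\<And>x. norm (g x) \<le> B"
  shows "integrable lborel (\<lambda>x. f x * g x)"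
proof (rule Bochner_Integration.integrable_bound)
  show "integrable lborel (\<lambda>x. complex_of_real B * f x)"
    using f by simp
  have "norm (g x) \<le> \<bar>B\<bar>" for x
    using g(2)[of x] by linarith
  then show "AE x in lborel. norm (f x * g x) \<le> norm (complex_of_real B * f x)"
    by (intro AE_I2) (auto simp: norm_mult mult.commute[of "norm (f _)"] intro!: mult_right_mono)
qed (use f g in auto)

lemma ft_measurable [measurable]: "f \<in> borel_measurable borel \<Longrightarrow> ft f \<in> borel_measurable borel"
proof -
  assume [measurable]: "f \<in> borel_measurable borel"
  have "(\<lambda>p. f (snd p) * cis (- (fst p * snd p))) \<in> borel_measurable (borel \<Otimes>\<^sub>M borel)"
    by measurable
  also have "borel_measurable (borel \<Otimes>\<^sub>M borel) = (borel_measurable (borel \<Otimes>\<^sub>M lborel) :: (real \<times> real \<Rightarrow> complex) set)"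
    by (intro measurable_cong_sets sets_pair_measure_cong) auto
  finally show ?thesis
    unfolding ft_def by (intro lborel.borel_measurable_lebesgue_integral) (simp add: split_beta')
qed

lemma ft_integrand: "integrable lborel f \<Longrightarrow> integrable lborel (\<lambda>t. f t * cis (- (\<xi> * t)))"
  by (rule integrable_mult_bounded[where B=1]) auto

lemma ft_bound: "norm (ft f \<xi>) \<le> (LINT t|lborel. norm (f t))"
  unfolding ft_def by (rule order_trans[OF integral_norm_bound]) (simp add: norm_mult)

lemma ft_add: "integrable lborel f \<Longrightarrow> integrable lborel g \<Longrightarrow> ft (\<lambda>t. f t + g t) \<xi> = ft f \<xi> + ft g \<xi>"
  unfolding ft_def by (simp add: distrib_right ft_integrand)

lemma ft_diff: "integrable lborel f \<Longrightarrow> integrable lborel g \<Longrightarrow> ft (\<lambda>t. f t - g t) \<xi> = ft f \<xi> - ft g \<xi>"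
  unfolding ft_def by (simp add: left_diff_distrib ft_integrand)

lemma ft_cmult: "ft (\<lambda>t. z * f t) \<xi> = z * ft f \<xi>"
  unfolding ft_def by (simp add: mult.assoc)

lemma ft_modulate: "ft (\<lambda>t. f t * cis (a * t)) \<xi> = ft f (\<xi> - a)"
  unfolding ft_def by (simp add: mult.assoc cis_mult algebra_simps)

lemma ft_reflect_cnj: "ft (\<lambda>t. cnj (f (- t))) \<xi> = cnj (ft f \<xi>)"
proof -
  have "ft (\<lambda>t. cnj (f (- t))) \<xi> = (LINT t|lborel. cnj (f (- t) * cis (\<xi> * t)))"
    unfolding ft_def by (simp add: cis_cnj)
  also have "\<dots> = cnj (LINT t|lborel. f (- t) * cis (\<xi> * t))"
    by (rule Bochner_Integration.integral_cnj)
  also have "(LINT t|lborel. f (- t) * cis (\<xi> * t)) = ft f \<xi>"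
    unfolding ft_def
    using lborel_integral_real_affine[of "-1" "\<lambda>t. f t * cis (- (\<xi> * t))" 0] by simp
  finally show ?thesis .
qed

lemma integrable_pair_bounded:
  fixes f g :: "real \<Rightarrow> complex" and k :: "real \<Rightarrow> real \<Rightarrow> complex"
  assumes f: "integrable lborel f" and g: "integrable lborel g"
    and k [measurable]: "case_prod k \<in> borel_measurable (lborel \<Otimes>\<^sub>M lborel)"
    and B: "\<And>x y. norm (k x y) \<le> B"
  shows "integrable (lborel \<Otimes>\<^sub>M lborel) (\<lambda>(x, y). f x * g y * k x y)"
proof -
  have [measurable]: "f \<in> borel_measurable borel" "g \<in> borel_measurable borel"
    using f g by auto
  have "integrable (lborel \<Otimes>\<^sub>M lborel) (\<lambda>(x, y). complex_of_real B * (f x * g y))"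
  proof (rule lborel_pair.Fubini_integrable)
    show "(\<lambda>(x, y). complex_of_real B * (f x * g y)) \<in> borel_measurable (lborel \<Otimes>\<^sub>M lborel)"
      by measurable
    have "(\<lambda>x. LINT y|lborel. norm (case (x, y) of (x, y) \<Rightarrow> complex_of_real B * (f x * g y)))
        = (\<lambda>x. \<bar>B\<bar> * (LINT y|lborel. norm (g y)) * norm (f x))"
      by (simp add: norm_mult mult_ac)
    then show "integrable lborel (\<lambda>x. LINT y|lborel. norm (case (x, y) of (x, y) \<Rightarrow> complex_of_real B * (f x * g y)))"
      using f by simp
    show "AE x in lborel. integrable lborel (\<lambda>y. case (x, y) of (x, y) \<Rightarrow> complex_of_real B * (f x * g y))"
      using g by simp
  qed
  then show ?thesis
  proof (rule Bochner_Integration.integrable_bound)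
    have "norm (k x y) \<le> \<bar>B\<bar>" for x y
      using B[of x y] by linarith
    then show "AE p in lborel \<Otimes>\<^sub>M lborel. norm (case p of (x, y) \<Rightarrow> f x * g y * k x y)
        \<le> norm (case p of (x, y) \<Rightarrow> complex_of_real B * (f x * g y))"
      by (intro AE_I2) (auto simp: norm_mult mult.commute intro!: mult_right_mono)
  qed measurable
qed

text \<open>Applied to two kernels: the exponential gives the multiplication formula, and
  \<open>kernel m (x - y)\<close> passes from a convolution operator to its transpose.\<close>

lemma Fubini_bounded_kernel:
  fixes f g :: "real \<Rightarrow> complex" and k :: "real \<Rightarrow> real \<Rightarrow> complex"
  assumes f: "integrable lborel f" and g: "integrable lborel g"
    and k: "case_prod k \<in> borel_measurable (lborel \<Otimes>\<^sub>M lborel)"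
    and B: "\<And>x y. norm (k x y) \<le> B"
  shows "(LINT y|lborel. g y * (LINT x|lborel. f x * k x y)) = (LINT x|lborel. f x * (LINT y|lborel. g y * k x y))"
proof -
  have "(LINT y|lborel. LINT x|lborel. f x * g y * k x y) = (LINT x|lborel. LINT y|lborel. f x * g y * k x y)"
    using lborel_pair.Fubini_integral[OF integrable_pair_bounded[OF assms]] by simp
  moreover have "(LINT x|lborel. f x * g y * k x y) = g y * (LINT x|lborel. f x * k x y)" for y
    by (subst integral_mult_right_zero[symmetric]) (simp only: mult_ac)
  moreover have "(LINT y|lborel. f x * g y * k x y) = f x * (LINT y|lborel. g y * k x y)" for x
    by (subst integral_mult_right_zero[symmetric]) (simp only: mult_ac)
  ultimately show ?thesis by simp
qed

lemma ft_mult_formula: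
  assumes "integrable lborel f" "integrable lborel g"
  shows "(LINT \<xi>|lborel. g \<xi> * ft f \<xi>) = (LINT t|lborel. f t * ft g t)"
proof -
  have "(LINT y|lborel. g y * (LINT x|lborel. f x * cis (- (y * x))))
      = (LINT x|lborel. f x * (LINT y|lborel. g y * cis (- (y * x))))"
    by (rule Fubini_bounded_kernel[OF assms, of _ 1]) auto
  then show ?thesis
    unfolding ft_def by (simp only: mult.commute[of _ _])
qed

section \<open>Gaussian regularisation and Plancherel's inequality\<close>

definition gauss :: "real \<Rightarrow> real \<Rightarrow> real" where
  "gauss e z = exp (- (z / e)\<^sup>2 / 2) / e"

lemma gauss_nonneg: "e > 0 \<Longrightarrow> gauss e z \<ge> 0"
  by (simp add: gauss_def)

lemma gauss_measurable [measurable]: "gauss e \<in> borel_measurable borel"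
  unfolding gauss_def by measurable

lemma gauss_eq: "e > 0 \<Longrightarrow> gauss e z = sqrt (2 * pi) * std_normal_density (z / e) / e"
  by (simp add: gauss_def std_normal_density_def)

lemma nn_integral_gauss:
  assumes "e > 0"
  shows "(\<integral>\<^sup>+z. ennreal (gauss e (t + z)) \<partial>lborel) = ennreal (sqrt (2 * pi))"
proof -
  have "(\<integral>\<^sup>+z. ennreal (gauss e (t + z)) \<partial>lborel)
      = \<bar>e\<bar> * (\<integral>\<^sup>+z. ennreal (gauss e (t + (- t + e * z))) \<partial>lborel)"
    using assms by (intro nn_integral_real_affine) auto
  also have "(\<integral>\<^sup>+z. ennreal (gauss e (t + (- t + e * z))) \<partial>lborel)
      = (\<integral>\<^sup>+z. ennreal (sqrt (2 * pi) / e) * ennreal (std_normal_density z) \<partial>lborel)"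
    using assms by (intro nn_integral_cong) (simp add: gauss_eq ennreal_mult[symmetric])
  also have "\<dots> = ennreal (sqrt (2 * pi) / e)"
    using nn_integral_eq_integral[of lborel std_normal_density] integrable_normal_density[of 1 0]
    by (simp add: nn_integral_cmult integral_normal_density)
  also have "ennreal \<bar>e\<bar> * ennreal (sqrt (2 * pi) / e) = ennreal (sqrt (2 * pi))"
    using assms by (simp add: ennreal_mult[symmetric])
  finally show ?thesis .
qed

text \<open>Read off from the characteristic function of the standard normal distribution by
  rescaling. This fixes the normalisation of \<open>gauss\<close>, whose mass is
  \<open>sqrt (2 * pi)\<close> for every width.\<close>

lemma ft_std_normal:
  assumes "e > 0"
  shows "ft (\<lambda>t. complex_of_real (std_normal_density (e * t))) \<xi> = complex_of_real (gauss e \<xi>)"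
proof -
  have "complex_of_real (exp (- (s\<^sup>2) / 2)) = (LINT t|lborel. complex_of_real (std_normal_density t) * cis (s * t))" for s
  proof -
    have "complex_of_real (exp (- (s\<^sup>2) / 2)) = char std_normal_distribution s"
      by (simp add: char_std_normal_distribution)
    also have "\<dots> = (LINT t|lborel. std_normal_density t *\<^sub>R iexp (s * t))"
      unfolding char_def by (subst integral_density) (auto simp: normal_density_nonneg)
    finally show ?thesis
      by (simp add: scaleR_conv_of_real cis_conv_exp)
  qed
  from this[of "- \<xi> / e"]
  have "complex_of_real (exp (- ((\<xi> / e)\<^sup>2) / 2)) = (LINT t|lborel. complex_of_real (std_normal_density t) * cis (- \<xi> / e * t))"
    by (simp add: power_divide)
  also have "\<dots> = e *\<^sub>R (LINT t|lborel. complex_of_real (std_normal_density (e * t)) * cis (- (\<xi> * t)))"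
    using assms by (subst lborel_integral_real_affine[of e _ 0]) auto
  finally show ?thesis
    using assms unfolding ft_def gauss_def by (simp add: scaleR_conv_of_real field_simps)
qed

lemma std_normal_integrable:
  "e > 0 \<Longrightarrow> integrable lborel (\<lambda>t. complex_of_real (std_normal_density (e * t)))"
  using lborel_integrable_real_affine[of "\<lambda>t. complex_of_real (std_normal_density t)" e 0]
    integrable_normal_density[of 1 0] by simp

text \<open>The Gaussian factor makes the transform integrable, so that the multiplication formula
  applies. Transforming twice reflects, hence \<open>x + y\<close> where a convolution would have a
  difference.\<close>

lemma ft_gauss_regularised:
  assumes u: "integrable lborel u" and e: "e > 0"
  shows "ft (\<lambda>\<xi>. complex_of_real (std_normal_density (e * \<xi>)) * ft u \<xi>) y
    = (LINT x|lborel. u x * complex_of_real (gauss e (x + y)))"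
proof -
  let ?g = "\<lambda>\<xi>. complex_of_real (std_normal_density (e * \<xi>)) * cis (- y * \<xi>)"
  have g: "integrable lborel ?g"
    by (rule integrable_mult_bounded[OF std_normal_integrable[OF e], of _ 1]) auto
  have "ft (\<lambda>\<xi>. complex_of_real (std_normal_density (e * \<xi>)) * ft u \<xi>) y = (LINT \<xi>|lborel. ?g \<xi> * ft u \<xi>)"
    unfolding ft_def[of "\<lambda>\<xi>. _ \<xi> * ft u \<xi>"] by (simp add: mult_ac)
  also have "\<dots> = (LINT x|lborel. u x * ft ?g x)"
    by (rule ft_mult_formula[OF u g])
  also have "ft ?g = (\<lambda>x. complex_of_real (gauss e (x + y)))"
    by (intro ext, subst ft_modulate) (simp add: ft_std_normal[OF e])
  finally show ?thesis .
qed

text \<open>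
  Against a Gaussian weight the left-hand side is a double integral of \<open>u\<close> with a Gaussian kernel, to
  which Schur's test applies after \<open>2 |u x| |u y| \<le> |u x|\<^sup>2 + |u y|\<^sup>2\<close>.
\<close>

lemma Plancherel_le_gauss:
  assumes u: "integrable lborel u" and e: "e > 0"
  shows "(\<integral>\<^sup>+\<xi>. ennreal (std_normal_density (e * \<xi>) * (norm (ft u \<xi>))\<^sup>2) \<partial>lborel)
    \<le> ennreal (sqrt (2 * pi)) * Lr_int 2 u"
proof -
  have [measurable]: "u \<in> borel_measurable borel"
    using u by auto
  let ?S = "\<lambda>\<xi>. complex_of_real (std_normal_density (e * \<xi>))"
  \<comment> \<open>The transform of the reflected conjugate is the conjugate of the transform, so
    the squared modulus of \<open>ft u\<close> becomes a product to which
    \<open>ft_mult_formula\<close> applies.\<close>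
  let ?v = "\<lambda>y. cnj (u (- y))"
  have v: "integrable lborel ?v"
    using lborel_integrable_real_affine[OF u, of "-1" 0] by simp
  have g: "integrable lborel (\<lambda>\<xi>. ?S \<xi> * ft u \<xi>)"
    by (rule integrable_mult_bounded[OF std_normal_integrable[OF e] _ ft_bound]) auto
  have i: "integrable lborel (\<lambda>\<xi>. (?S \<xi> * ft u \<xi>) * cnj (ft u \<xi>))"
    by (rule integrable_mult_bounded[OF g, of _ "LINT t|lborel. norm (u t)"]) (measurable, simp add: ft_bound)
  have sq: "(?S \<xi> * ft u \<xi>) * cnj (ft u \<xi>) = complex_of_real (std_normal_density (e * \<xi>) * (norm (ft u \<xi>))\<^sup>2)" for \<xi>
    by (simp add: complex_norm_square[symmetric] mult.assoc)
  have i': "integrable lborel (\<lambda>\<xi>. std_normal_density (e * \<xi>) * (norm (ft u \<xi>))\<^sup>2)"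
    using i unfolding sq by (simp only: complex_of_real_integrable_eq)
  have "(\<integral>\<^sup>+\<xi>. ennreal (std_normal_density (e * \<xi>) * (norm (ft u \<xi>))\<^sup>2) \<partial>lborel)
      = ennreal (LINT \<xi>|lborel. std_normal_density (e * \<xi>) * (norm (ft u \<xi>))\<^sup>2)"
    by (intro nn_integral_eq_integral i') (auto simp: normal_density_nonneg)
  also have "\<dots> \<le> ennreal (norm (LINT \<xi>|lborel. (?S \<xi> * ft u \<xi>) * cnj (ft u \<xi>)))"
    unfolding sq integral_complex_of_real by (intro ennreal_leI) simp
  also have "(LINT \<xi>|lborel. (?S \<xi> * ft u \<xi>) * cnj (ft u \<xi>)) = (LINT \<xi>|lborel. (?S \<xi> * ft u \<xi>) * ft ?v \<xi>)"
    by (simp add: ft_reflect_cnj)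
  also have "\<dots> = (LINT y|lborel. ?v y * ft (\<lambda>\<xi>. ?S \<xi> * ft u \<xi>) y)"
    by (rule ft_mult_formula[OF v g])
  also have "ennreal (norm \<dots>) \<le> (\<integral>\<^sup>+y. ennreal (norm (?v y * ft (\<lambda>\<xi>. ?S \<xi> * ft u \<xi>) y)) \<partial>lborel)"
    by (intro integral_norm_bound_ennreal integrable_mult_bounded[OF v _ ft_bound]) auto
  also have "\<dots> \<le> (\<integral>\<^sup>+y. \<integral>\<^sup>+x. ennreal ((norm (u (- y)))\<^sup>2 / 2 * gauss e (x + y))
                        + ennreal ((norm (u x))\<^sup>2 / 2 * gauss e (x + y)) \<partial>lborel \<partial>lborel)"
  proof (rule nn_integral_mono)
    fix y
    have "ennreal (norm (?v y * ft (\<lambda>\<xi>. ?S \<xi> * ft u \<xi>) y))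
        = ennreal (norm (LINT x|lborel. ?v y * (u x * complex_of_real (gauss e (x + y)))))"
      by (simp add: ft_gauss_regularised[OF u e])
    also have "\<dots> \<le> (\<integral>\<^sup>+x. ennreal (norm (?v y * (u x * complex_of_real (gauss e (x + y))))) \<partial>lborel)"
    proof (intro integral_norm_bound_ennreal integrable_mult_right impI)
      have "gauss e z \<le> 1 / e" for z
        using e by (simp add: gauss_def divide_right_mono)
      then show "integrable lborel (\<lambda>x. u x * complex_of_real (gauss e (x + y)))"
        using e by (intro integrable_mult_bounded[OF u, of _ "1 / e"]) (auto simp: gauss_nonneg)
    qed
    also have "\<dots> \<le> (\<integral>\<^sup>+x. ennreal ((norm (u (- y)))\<^sup>2 / 2 * gauss e (x + y))
                        + ennreal ((norm (u x))\<^sup>2 / 2 * gauss e (x + y)) \<partial>lborel)"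
    proof (rule nn_integral_mono)
      fix x
      have "norm (u (- y)) * norm (u x) \<le> (norm (u (- y)))\<^sup>2 / 2 + (norm (u x))\<^sup>2 / 2"
        using sum_squares_bound[of "norm (u (- y))" "norm (u x)"] by simp
      then have "norm (u (- y)) * norm (u x) * gauss e (x + y)
          \<le> ((norm (u (- y)))\<^sup>2 / 2 + (norm (u x))\<^sup>2 / 2) * gauss e (x + y)"
        using e by (intro mult_right_mono gauss_nonneg)
      then show "ennreal (norm (?v y * (u x * complex_of_real (gauss e (x + y)))))
          \<le> ennreal ((norm (u (- y)))\<^sup>2 / 2 * gauss e (x + y)) + ennreal ((norm (u x))\<^sup>2 / 2 * gauss e (x + y))"
        using e by (simp add: ennreal_plus[symmetric] norm_mult gauss_nonneg distrib_right mult.assoc del: ennreal_plus)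
    qed
    finally show "ennreal (norm (?v y * ft (\<lambda>\<xi>. ?S \<xi> * ft u \<xi>) y)) \<le> \<dots>" .
  qed
  also have "\<dots> = (\<integral>\<^sup>+y. \<integral>\<^sup>+x. ennreal ((norm (u (- y)))\<^sup>2 / 2 * gauss e (x + y)) \<partial>lborel \<partial>lborel)
                + (\<integral>\<^sup>+y. \<integral>\<^sup>+x. ennreal ((norm (u x))\<^sup>2 / 2 * gauss e (x + y)) \<partial>lborel \<partial>lborel)"
    by (simp add: nn_integral_add)
  also have "(\<integral>\<^sup>+y. \<integral>\<^sup>+x. ennreal ((norm (u x))\<^sup>2 / 2 * gauss e (x + y)) \<partial>lborel \<partial>lborel)
      = (\<integral>\<^sup>+x. \<integral>\<^sup>+y. ennreal ((norm (u x))\<^sup>2 / 2 * gauss e (x + y)) \<partial>lborel \<partial>lborel)"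
    by (rule lborel_pair.Fubini') measurable
  also have "\<dots> = (\<integral>\<^sup>+x. ennreal (sqrt (2 * pi) / 2) * ennreal ((norm (u x))\<^sup>2) \<partial>lborel)"
  proof (rule nn_integral_cong)
    fix x
    have "(\<integral>\<^sup>+y. ennreal ((norm (u x))\<^sup>2 / 2 * gauss e (x + y)) \<partial>lborel)
        = (\<integral>\<^sup>+y. ennreal ((norm (u x))\<^sup>2 / 2) * ennreal (gauss e (x + y)) \<partial>lborel)"
      using e by (intro nn_integral_cong) (simp add: gauss_nonneg flip: ennreal_mult)
    also have "\<dots> = ennreal (sqrt (2 * pi) / 2) * ennreal ((norm (u x))\<^sup>2)"
      by (subst nn_integral_cmult) (simp_all add: nn_integral_gauss[OF e] ennreal_mult[symmetric] mult.commute)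
    finally show "(\<integral>\<^sup>+y. ennreal ((norm (u x))\<^sup>2 / 2 * gauss e (x + y)) \<partial>lborel) = \<dots>" .
  qed
  also have "\<dots> = ennreal (sqrt (2 * pi) / 2) * Lr_int 2 u"
    by (simp add: nn_integral_cmult Lr_int_2)
  also have "(\<integral>\<^sup>+y. \<integral>\<^sup>+x. ennreal ((norm (u (- y)))\<^sup>2 / 2 * gauss e (x + y)) \<partial>lborel \<partial>lborel)
      = (\<integral>\<^sup>+y. ennreal (sqrt (2 * pi) / 2) * ennreal ((norm (u (- y)))\<^sup>2) \<partial>lborel)"
  proof (rule nn_integral_cong)
    fix y
    have "(\<integral>\<^sup>+x. ennreal ((norm (u (- y)))\<^sup>2 / 2 * gauss e (x + y)) \<partial>lborel)
        = (\<integral>\<^sup>+x. ennreal ((norm (u (- y)))\<^sup>2 / 2) * ennreal (gauss e (y + x)) \<partial>lborel)"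
      using e by (intro nn_integral_cong) (simp add: gauss_nonneg add.commute flip: ennreal_mult)
    also have "\<dots> = ennreal (sqrt (2 * pi) / 2) * ennreal ((norm (u (- y)))\<^sup>2)"
      by (subst nn_integral_cmult) (simp_all add: nn_integral_gauss[OF e] ennreal_mult[symmetric] mult.commute)
    finally show "(\<integral>\<^sup>+x. ennreal ((norm (u (- y)))\<^sup>2 / 2 * gauss e (x + y)) \<partial>lborel) = \<dots>" .
  qed
  also have "\<dots> = ennreal (sqrt (2 * pi) / 2) * (\<integral>\<^sup>+y. ennreal ((norm (u (- y)))\<^sup>2) \<partial>lborel)"
    by (simp add: nn_integral_cmult)
  also have "(\<integral>\<^sup>+y. ennreal ((norm (u (- y)))\<^sup>2) \<partial>lborel) = Lr_int 2 u"
    unfolding Lr_int_2 using nn_integral_real_affine[of "\<lambda>y. ennreal ((norm (u y))\<^sup>2)" "-1" 0] by simp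
  also have "ennreal (sqrt (2 * pi) / 2) * Lr_int 2 u + ennreal (sqrt (2 * pi) / 2) * Lr_int 2 u
      = ennreal (sqrt (2 * pi)) * Lr_int 2 u"
    by (simp add: distrib_right[symmetric] ennreal_plus[symmetric] del: ennreal_plus)
  finally show ?thesis .
qed

text \<open>As the weight flattens out, \<open>std_normal_density (e n * \<xi>)\<close> tends to
  \<open>1 / sqrt (2 * pi)\<close>, and Fatou's lemma passes to the limit. This factor, moved to the
  other side, joins \<open>sqrt (2 * pi)\<close> to give \<open>2 * pi\<close>.\<close>

lemma Plancherel_le:
  assumes u: "integrable lborel u"
  shows "Lr_int 2 (ft u) \<le> ennreal (2 * pi) * Lr_int 2 u"
proof -
  have [measurable]: "u \<in> borel_measurable borel"
    using u by auto
  define e where "e n = 1 / (real n + 1)" for n :: nat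
  have e: "e n > 0" for n by (simp add: e_def)
  have e0: "e \<longlonglongrightarrow> 0" unfolding e_def by real_asymp
  have lim: "(\<lambda>n. ennreal (std_normal_density (e n * \<xi>) * (norm (ft u \<xi>))\<^sup>2))
      \<longlonglongrightarrow> ennreal (1 / sqrt (2 * pi) * (norm (ft u \<xi>))\<^sup>2)" for \<xi>
  proof -
    have "(\<lambda>n. 1 / sqrt (2 * pi) * exp (- (e n * \<xi>)\<^sup>2 / 2)) \<longlonglongrightarrow> 1 / sqrt (2 * pi) * exp (- (0 * \<xi>)\<^sup>2 / 2)"
      by (intro tendsto_intros e0) auto
    then have "(\<lambda>n. std_normal_density (e n * \<xi>)) \<longlonglongrightarrow> 1 / sqrt (2 * pi)"
      by (simp add: std_normal_density_def)
    then show ?thesis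
      by (intro tendsto_ennrealI tendsto_mult tendsto_const)
  qed
  have "ennreal (1 / sqrt (2 * pi)) * Lr_int 2 (ft u)
      = (\<integral>\<^sup>+\<xi>. liminf (\<lambda>n. ennreal (std_normal_density (e n * \<xi>) * (norm (ft u \<xi>))\<^sup>2)) \<partial>lborel)"
    unfolding lim_imp_Liminf[OF trivial_limit_sequentially lim] Lr_int_2
    by (subst nn_integral_cmult[symmetric]) (auto simp: ennreal_mult'[symmetric])
  also have "\<dots> \<le> liminf (\<lambda>n. \<integral>\<^sup>+\<xi>. ennreal (std_normal_density (e n * \<xi>) * (norm (ft u \<xi>))\<^sup>2) \<partial>lborel)"
    by (intro nn_integral_liminf) measurable
  also have "\<dots> \<le> liminf (\<lambda>n. ennreal (sqrt (2 * pi)) * Lr_int 2 u)"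
    by (intro Liminf_mono always_eventually allI Plancherel_le_gauss u e)
  also have "\<dots> = ennreal (sqrt (2 * pi)) * Lr_int 2 u"
    by (simp add: Liminf_const)
  finally have "ennreal (sqrt (2 * pi)) * (ennreal (1 / sqrt (2 * pi)) * Lr_int 2 (ft u))
      \<le> ennreal (sqrt (2 * pi)) * (ennreal (sqrt (2 * pi)) * Lr_int 2 u)"
    by (rule mult_left_mono) simp
  then show ?thesis
    by (simp add: mult.assoc[symmetric] ennreal_mult[symmetric])
qed

section \<open>The transform on L^2\<close>

lemma ft_Lr2: "u \<in> Lr 1 \<Longrightarrow> u \<in> Lr 2 \<Longrightarrow> ft u \<in> Lr 2"
  using Plancherel_le[of u] by (auto simp: Lr_iff Lr_1_iff[symmetric] ennreal_mult_less_top intro: order.strict_trans1)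

text \<open>A relation rather than a function, because the transform on L^2 is determined only up to
  null sets. The shape is that of \<open>is_saft_L2\<close>, so that the two can be translated into
  each other along the approximating sequence.\<close>

definition ft2 :: "(real \<Rightarrow> complex) \<Rightarrow> (real \<Rightarrow> complex) \<Rightarrow> bool" where
  "ft2 f F \<longleftrightarrow> (\<exists>u. (\<forall>n. u n \<in> Lr 1 \<inter> Lr 2) \<and> Lr_tendsto 2 u f \<and> Lr_tendsto 2 (\<lambda>n. ft (u n)) F)"

lemma ft2I: "(\<And>n. u n \<in> Lr 1) \<Longrightarrow> (\<And>n. u n \<in> Lr 2) \<Longrightarrow> Lr_tendsto 2 u f \<Longrightarrow>
    Lr_tendsto 2 (\<lambda>n. ft (u n)) F \<Longrightarrow> ft2 f F"
  unfolding ft2_def by blast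

lemma ft2_Lr: "ft2 f F \<Longrightarrow> f \<in> Lr 2" "ft2 f F \<Longrightarrow> F \<in> Lr 2"
  unfolding ft2_def Lr_tendsto_def by blast+

lemma ft2_ft: "u \<in> Lr 1 \<Longrightarrow> u \<in> Lr 2 \<Longrightarrow> ft2 u (ft u)"
  by (rule ft2I[of "\<lambda>n. u"]) (auto intro: Lr_tendsto_const ft_Lr2)

lemma ft2_add:
  assumes "ft2 f F" "ft2 g G"
  shows "ft2 (\<lambda>x. f x + g x) (\<lambda>x. F x + G x)"
proof -
  obtain u where u: "\<And>n. u n \<in> Lr 1" "\<And>n. u n \<in> Lr 2" "Lr_tendsto 2 u f" "Lr_tendsto 2 (\<lambda>n. ft (u n)) F"
    using assms(1) unfolding ft2_def by blast
  obtain v where v: "\<And>n. v n \<in> Lr 1" "\<And>n. v n \<in> Lr 2" "Lr_tendsto 2 v g" "Lr_tendsto 2 (\<lambda>n. ft (v n)) G"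
    using assms(2) unfolding ft2_def by blast
  show ?thesis
  proof (rule ft2I[of "\<lambda>n x. u n x + v n x"])
    have "ft (\<lambda>x. u n x + v n x) = (\<lambda>x. ft (u n) x + ft (v n) x)" for n
      using u(1) v(1) by (intro ext ft_add) (auto simp: Lr_1_iff)
    then show "Lr_tendsto 2 (\<lambda>n. ft (\<lambda>x. u n x + v n x)) (\<lambda>x. F x + G x)"
      using Lr_tendsto_add[OF u(4) v(4)] by simp
    show "Lr_tendsto 2 (\<lambda>n x. u n x + v n x) (\<lambda>x. f x + g x)"
      using Lr_tendsto_add[OF u(3) v(3)] by simp
  qed (rule Lr_add[OF u(1) v(1)] Lr_add[OF u(2) v(2)], simp)+
qed

lemma ft2_cmult:
  assumes "ft2 f F"
  shows "ft2 (\<lambda>x. z * f x) (\<lambda>x. z * F x)"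
proof -
  obtain u where u: "\<And>n. u n \<in> Lr 1" "\<And>n. u n \<in> Lr 2" "Lr_tendsto 2 u f" "Lr_tendsto 2 (\<lambda>n. ft (u n)) F"
    using assms(1) unfolding ft2_def by blast
  show ?thesis
  proof (rule ft2I[of "\<lambda>n x. z * u n x"])
    have "ft (\<lambda>x. z * u n x) = (\<lambda>x. z * ft (u n) x)" for n
      by (intro ext ft_cmult)
    then show "Lr_tendsto 2 (\<lambda>n. ft (\<lambda>x. z * u n x)) (\<lambda>x. z * F x)"
      using Lr_tendsto_cmult[OF u(4)] by simp
    show "Lr_tendsto 2 (\<lambda>n x. z * u n x) (\<lambda>x. z * f x)"
      using Lr_tendsto_cmult[OF u(3)] by simp
  qed (rule Lr_cmult[OF u(1)] Lr_cmult[OF u(2)])+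
qed

lemma ft2_diff:
  assumes "ft2 f F" "ft2 g G"
  shows "ft2 (\<lambda>x. f x - g x) (\<lambda>x. F x - G x)"
  using ft2_add[OF assms(1) ft2_cmult[OF assms(2), of "-1"]] by simp

text \<open>\<open>8 * pi\<close> is Plancherel's \<open>2 * pi\<close> times the factor
  \<open>2 powr 2\<close> lost in \<open>Lr_int_le_transfer\<close>.\<close>

lemma ft2_bound:
  assumes "ft2 f F"
  shows "Lr_int 2 F \<le> ennreal (8 * pi) * Lr_int 2 f"
proof -
  obtain u where u: "\<And>n. u n \<in> Lr 1" "Lr_tendsto 2 u f" "Lr_tendsto 2 (\<lambda>n. ft (u n)) F"
    using assms unfolding ft2_def by blast
  have "Lr_int 2 F \<le> ennreal (2 * pi * 2 powr 2) * Lr_int 2 f"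
    using u(1) by (intro Lr_int_le_transfer[OF u(3,2)] Plancherel_le) (auto simp: Lr_1_iff)
  then show ?thesis by simp
qed

lemma ft2_tendsto:
  assumes "\<And>n. ft2 (u n) (U n)" "Lr_tendsto 2 u f" "ft2 f F"
  shows "Lr_tendsto 2 U F"
  using assms(1,3) by (intro Lr_tendsto_dominated[OF assms(2), of _ _ "8 * pi"] ft2_bound ft2_diff) (auto intro: ft2_Lr)

lemma ft2_unique:
  assumes "ft2 f F" "ft2 f G"
  shows "AE x in lborel. F x = G x"
  by (rule Lr_tendsto_unique[OF Lr_tendsto_const ft2_tendsto[OF assms(1) Lr_tendsto_const assms(2)]])
     (use ft2_Lr[OF assms(1)] in auto)

text \<open>Plancherel's inequality, applied to differences, makes the transforms of approximating
  step functions a Cauchy sequence.\<close>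

lemma ft2_exists:
  assumes f: "f \<in> Lr 2"
  obtains F where "ft2 f F"
proof -
  obtain s where s: "\<And>n. step_fun (s n)" "Lr_tendsto 2 s f"
    using step_fun_dense[OF f f] by auto
  have s1: "s n \<in> Lr 1" "s n \<in> Lr 2" for n
    using bounded_support_Lr[OF step_fun_bounded_support[OF s(1)]] by auto
  obtain F where "Lr_tendsto 2 (\<lambda>n. ft (s n)) F"
  proof (rule Lr_complete_dominated[OF s(2), where c="2 * pi" and r=2 and v="\<lambda>n. ft (s n)"])
    fix m n
    have i: "integrable lborel (s n)" for n
      using s1(1) by (simp add: Lr_1_iff)
    have "(\<lambda>x. ft (s m) x - ft (s n) x) = ft (\<lambda>x. s m x - s n x)"
      using i by (intro ext ft_diff[symmetric])
    then show "Lr_int 2 (\<lambda>x. ft (s m) x - ft (s n) x) \<le> ennreal (2 * pi) * Lr_int 2 (\<lambda>x. s m x - s n x)"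
      using i by (simp add: Plancherel_le)
  qed (use ft_Lr2[OF s1] that in auto)
  then show ?thesis
    using ft2I[OF s1 s(2)] that by blast
qed

lemma Lr_tendsto_diagonal:
  assumes h: "Lr_tendsto r h f" and r: "r > 0" and v: "\<And>n. v n \<in> Lr r"
    and le: "\<And>n. Lr_int r (\<lambda>x. v n x - h n x) \<le> ennreal (1 / (real n + 1))"
  shows "Lr_tendsto r v f"
proof (rule Lr_tendstoI[OF r v Lr_tendstoD(2)[OF h r]])
  note m = LrD(1)[OF Lr_tendstoD(1)[OF h r]] LrD(1)[OF Lr_tendstoD(2)[OF h r]] LrD(1)[OF v]
  have "(\<lambda>n. ennreal (1 / (real n + 1))) \<longlonglongrightarrow> ennreal 0"
    by (intro tendsto_ennrealI) real_asymp
  then have "(\<lambda>n. ennreal (1 / (real n + 1)) + Lr_int r (\<lambda>x. h n x - f x)) \<longlonglongrightarrow> 0 + 0"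
    by (intro tendsto_add Lr_tendstoD(3)[OF h r]) simp
  then have "(\<lambda>n. ennreal (1 / (real n + 1)) + Lr_int r (\<lambda>x. h n x - f x)) \<longlonglongrightarrow> 0"
    by simp
  then show "(\<lambda>n. Lr_int r (\<lambda>x. v n x - f x)) \<longlonglongrightarrow> 0"
  proof (rule tendsto_0_le_ennreal)
    fix n
    have "Lr_int r (\<lambda>x. v n x - f x) \<le> ennreal (2 powr r) * (Lr_int r (\<lambda>x. v n x - h n x) + Lr_int r (\<lambda>x. h n x - f x))"
      by (rule Lr_int_triangle[OF m(3) m(1) m(2) r])
    also have "\<dots> \<le> ennreal (2 powr r) * (ennreal (1 / (real n + 1)) + Lr_int r (\<lambda>x. h n x - f x))"
      by (intro mult_left_mono add_right_mono le) auto
    finally show "Lr_int r (\<lambda>x. v n x - f x) \<le> ennreal (2 powr r) * (ennreal (1 / (real n + 1)) + Lr_int r (\<lambda>x. h n x - f x))" .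
  qed
qed

text \<open>\<open>ft2\<close> is the closure of a graph, hence closed: a diagonal choice picks for
  each \<open>n\<close> one integrable approximant that is good for \<open>h n\<close> and
  \<open>H n\<close> simultaneously.\<close>

lemma ft2_closed:
  assumes h: "\<And>n. ft2 (h n) (H n)" and f: "Lr_tendsto 2 h f" and F: "Lr_tendsto 2 H F"
  shows "ft2 f F"
proof -
  have "\<exists>v. v \<in> Lr 1 \<and> v \<in> Lr 2 \<and> Lr_int 2 (\<lambda>x. v x - h n x) \<le> ennreal (1 / (real n + 1)) \<and>
      Lr_int 2 (\<lambda>x. ft v x - H n x) \<le> ennreal (1 / (real n + 1))" for n
  proof -
    obtain u where u: "\<And>k. u k \<in> Lr 1" "\<And>k. u k \<in> Lr 2" "Lr_tendsto 2 u (h n)"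
        "Lr_tendsto 2 (\<lambda>k. ft (u k)) (H n)"
      using h[of n] unfolding ft2_def by blast
    have "\<forall>\<^sub>F k in sequentially. Lr_int 2 (\<lambda>x. u k x - h n x) < ennreal (1 / (real n + 1)) \<and>
        Lr_int 2 (\<lambda>x. ft (u k) x - H n x) < ennreal (1 / (real n + 1))"
      using order_tendstoD(2)[OF Lr_tendstoD(3)[OF u(3)]] order_tendstoD(2)[OF Lr_tendstoD(3)[OF u(4)]]
      by (intro eventually_conj) auto
    from eventually_happens'[OF sequentially_bot this] obtain k
      where k: "Lr_int 2 (\<lambda>x. u k x - h n x) < ennreal (1 / (real n + 1))"
        "Lr_int 2 (\<lambda>x. ft (u k) x - H n x) < ennreal (1 / (real n + 1))"
      by auto
    show ?thesis
      by (rule exI[of _ "u k"]) (intro conjI u(1,2) less_imp_le k)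
  qed
  then obtain v where v: "\<And>n. v n \<in> Lr 1" "\<And>n. v n \<in> Lr 2"
      "\<And>n. Lr_int 2 (\<lambda>x. v n x - h n x) \<le> ennreal (1 / (real n + 1))"
      "\<And>n. Lr_int 2 (\<lambda>x. ft (v n) x - H n x) \<le> ennreal (1 / (real n + 1))"
    by metis
  show ?thesis
    by (rule ft2I[OF v(1,2) Lr_tendsto_diagonal[OF f _ v(2,3)] Lr_tendsto_diagonal[OF F _ ft_Lr2[OF v(1,2)] v(4)]]) auto
qed

section \<open>Fourier inversion on L^2\<close>

lemma step_fun_translate:
  assumes "step_fun f"
  obtains C where "C \<ge> 0" "\<And>u. (\<integral>\<^sup>+x. ennreal (norm (f (x + u) - f x)) \<partial>lborel) \<le> ennreal (C * \<bar>u\<bar>)"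
proof -
  obtain N k where f: "\<And>x. f x = f (of_int \<lfloor>x * 2 ^ N\<rfloor> / 2 ^ N)"
      "\<And>x. x \<notin> {-(2 ^ k)..<2 ^ k} \<Longrightarrow> f x = 0"
    using assms unfolding step_fun_def by blast
  obtain B where B: "B > 0" and fB: "\<And>x. norm (f x) \<le> B"
    using bounded_supportE[OF step_fun_bounded_support[OF assms]] by metis
  \<comment> \<open>All grid points between \<open>-(2 ^ k)\<close> and \<open>2 ^ k\<close>, both
    ends included: the only places where \<open>f\<close> can change its value.\<close>
  define J :: "int set" where "J = {- (2 ^ k * 2 ^ N)..2 ^ k * 2 ^ N}"
  define D where "D j u = {real_of_int j / 2 ^ N - \<bar>u\<bar>..real_of_int j / 2 ^ N + \<bar>u\<bar>}" for j u
  \<comment> \<open>Different values at \<open>a\<close> and \<open>b\<close> force a grid point in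
    between. It is the right end of the cell of \<open>a\<close> if \<open>a\<close> lies in the
    support interval, and the left end of the cell of \<open>b\<close> otherwise.\<close>
  have cross: "\<exists>j\<in>J. a \<le> of_int j / 2 ^ N \<and> of_int j / 2 ^ N \<le> b" if "a \<le> b" "f a \<noteq> f b" for a b
  proof -
    have ne: "\<lfloor>a * 2 ^ N\<rfloor> \<noteq> \<lfloor>b * 2 ^ N\<rfloor>"
      using that(2) f(1)[of a] f(1)[of b] by metis
    have "\<lfloor>a * 2 ^ N\<rfloor> \<le> \<lfloor>b * 2 ^ N\<rfloor>"
      using that(1) by (intro floor_mono mult_right_mono) auto
    with ne have lt: "\<lfloor>a * 2 ^ N\<rfloor> + 1 \<le> \<lfloor>b * 2 ^ N\<rfloor>" by simp
    have range: "- (2 ^ k * 2 ^ N) \<le> \<lfloor>x * 2 ^ N\<rfloor> \<and> \<lfloor>x * 2 ^ N\<rfloor> < 2 ^ k * 2 ^ N" if "x \<in> {-(2 ^ k)..<2 ^ k}" for x :: real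
    proof -
      have "- (2 ^ k) \<le> x" "x < 2 ^ k"
        using that by auto
      then have "- (2 ^ k) * 2 ^ N \<le> x * 2 ^ N" "x * 2 ^ N < 2 ^ k * 2 ^ N"
        by (intro mult_right_mono; simp) (intro mult_strict_right_mono; simp add: \<open>x < 2 ^ k\<close>)
      then show ?thesis by (simp add: le_floor_iff floor_less_iff)
    qed
    show ?thesis
    proof (cases "a \<in> {-(2 ^ k)..<2 ^ k}")
      case True
      have "of_int (\<lfloor>a * 2 ^ N\<rfloor> + 1) \<le> b * 2 ^ N"
        using lt by (simp only: le_floor_iff)
      moreover have "a * 2 ^ N \<le> of_int (\<lfloor>a * 2 ^ N\<rfloor> + 1)"
        by (simp add: less_imp_le)
      moreover have "\<lfloor>a * 2 ^ N\<rfloor> + 1 \<in> J"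
        using range[OF True] by (simp add: J_def)
      ultimately show ?thesis
        by (intro bexI[of _ "\<lfloor>a * 2 ^ N\<rfloor> + 1"]) (simp_all add: pos_le_divide_eq pos_divide_le_eq)
    next
      case False
      then have "b \<in> {-(2 ^ k)..<2 ^ k}"
        using f(2)[of a] f(2)[of b] that(2) by metis
      note rb = range[OF this]
      have "a * 2 ^ N \<le> of_int \<lfloor>b * 2 ^ N\<rfloor>"
        using lt by linarith
      moreover have "of_int \<lfloor>b * 2 ^ N\<rfloor> \<le> b * 2 ^ N"
        by simp
      moreover have "\<lfloor>b * 2 ^ N\<rfloor> \<in> J"
        using rb by (simp add: J_def)
      ultimately show ?thesis
        by (intro bexI[of _ "\<lfloor>b * 2 ^ N\<rfloor>"]) (simp_all add: pos_le_divide_eq pos_divide_le_eq)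
    qed
  qed
  have le: "norm (f (x + u) - f x) \<le> (\<Sum>j\<in>J. 2 * B * indicator (D j u) x)" for x u
  proof (cases "f (x + u) = f x")
    case True
    then show ?thesis
      using B by (auto intro!: sum_nonneg)
  next
    case False
    obtain j where j: "j \<in> J" "x \<in> D j u"
    proof (cases "u \<ge> 0")
      case True
      then obtain j where "j \<in> J" "x \<le> of_int j / 2 ^ N" "of_int j / 2 ^ N \<le> x + u"
        using cross[of x "x + u"] False by auto
      then show ?thesis using that[of j] True by (auto simp: D_def)
    next
      case F: False
      then obtain j where "j \<in> J" "x + u \<le> of_int j / 2 ^ N" "of_int j / 2 ^ N \<le> x"
        using cross[of "x + u" x] False by auto
      then show ?thesis using that[of j] F by (auto simp: D_def)
    qed
    have "norm (f (x + u) - f x) \<le> 2 * B"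
      using norm_triangle_ineq4[of "f (x + u)" "f x"] fB[of "x + u"] fB[of x] by linarith
    also have "\<dots> = 2 * B * indicator (D j u) x"
      using j by simp
    also have "\<dots> \<le> (\<Sum>j\<in>J. 2 * B * indicator (D j u) x)"
      using j(1) B by (intro member_le_sum) (auto simp: J_def)
    finally show ?thesis .
  qed
  show ?thesis
  \<comment> \<open>Each grid point contributes height \<open>2 * B\<close> on an interval of length
    \<open>2 * \<bar>u\<bar>\<close>.\<close>
  proof (rule that[of "real (card J) * (4 * B)"])
    fix u
    have "(\<integral>\<^sup>+x. ennreal (norm (f (x + u) - f x)) \<partial>lborel)
        \<le> (\<integral>\<^sup>+x. (\<Sum>j\<in>J. ennreal (2 * B) * indicator (D j u) x) \<partial>lborel)"
    proof (rule nn_integral_mono)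
      fix x
      have "ennreal (\<Sum>j\<in>J. 2 * B * indicator (D j u) x) = (\<Sum>j\<in>J. ennreal (2 * B) * indicator (D j u) x)"
      proof -
        have "(\<Sum>j\<in>J. ennreal (2 * B) * indicator (D j u) x) = (\<Sum>j\<in>J. ennreal (2 * B * indicator (D j u) x))"
          by (intro sum.cong) (auto simp: indicator_def)
        also have "\<dots> = ennreal (\<Sum>j\<in>J. 2 * B * indicator (D j u) x)"
          using B by (intro sum_ennreal) auto
        finally show ?thesis by simp
      qed
      then show "ennreal (norm (f (x + u) - f x)) \<le> (\<Sum>j\<in>J. ennreal (2 * B) * indicator (D j u) x)"
        using le[of x u] by (metis ennreal_leI)
    qed
    also have "\<dots> = (\<Sum>j\<in>J. ennreal (2 * B) * emeasure lborel (D j u))"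
      by (subst nn_integral_sum) (auto simp: D_def nn_integral_cmult_indicator)
    also have "\<dots> = (\<Sum>j\<in>J. ennreal (4 * B * \<bar>u\<bar>))"
      using B by (intro sum.cong) (auto simp: D_def ennreal_mult[symmetric])
    also have "\<dots> = ennreal (real (card J) * (4 * B) * \<bar>u\<bar>)"
      using B by (simp add: ennreal_mult ennreal_of_nat_eq_real_of_nat mult.assoc)
    finally show "(\<integral>\<^sup>+x. ennreal (norm (f (x + u) - f x)) \<partial>lborel) \<le> ennreal (real (card J) * (4 * B) * \<bar>u\<bar>)" .
  qed (use B in auto)
qed

lemma Lr_int_scale:
  assumes [measurable]: "f \<in> borel_measurable borel" and "c \<noteq> 0"
  shows "Lr_int r f = ennreal \<bar>c\<bar> * Lr_int r (\<lambda>x. f (c * x))"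
  unfolding Lr_int_def
  using nn_integral_real_affine[of "\<lambda>x. ennreal (norm (f x) powr r)" c 0] assms(2) by simp

lemma Lr_scale:
  assumes f: "f \<in> Lr r" and c: "c \<noteq> 0"
  shows "(\<lambda>x. f (c * x)) \<in> Lr r"
proof -
  have [measurable]: "f \<in> borel_measurable borel" using f by (rule LrD)
  have "Lr_int r (\<lambda>x. f (c * x)) < \<infinity>"
    using f Lr_int_scale[of f c r] c by (auto simp: Lr_iff ennreal_mult_less_top)
  then show ?thesis
    by (simp add: Lr_iff)
qed

lemma Lr_tendsto_scale:
  assumes u: "Lr_tendsto r u f" and r: "r > 0" and c: "c \<noteq> 0"
  shows "Lr_tendsto r (\<lambda>n x. u n (c * x)) (\<lambda>x. f (c * x))"
proof (rule Lr_tendsto_dominated[OF u r, of _ _ "\<bar>1 / c\<bar>"])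
  fix n
  have [measurable]: "f \<in> borel_measurable borel" "u n \<in> borel_measurable borel"
    using Lr_tendstoD(1,2)[OF u r] by (auto dest: LrD)
  have "Lr_int r (\<lambda>x. u n (c * x) - f (c * x))
      = ennreal \<bar>1 / c\<bar> * Lr_int r (\<lambda>x. u n (c * (1 / c * x)) - f (c * (1 / c * x)))"
    using c by (intro Lr_int_scale) auto
  then show "Lr_int r (\<lambda>x. u n (c * x) - f (c * x)) \<le> ennreal \<bar>1 / c\<bar> * Lr_int r (\<lambda>x. u n x - f x)"
    using c by simp
qed (use Lr_tendstoD(1,2)[OF u r] c in \<open>auto intro: Lr_scale\<close>)

text \<open>An approximate identity with an explicit rate: translating \<open>G\<close> by
  \<open>e n * z\<close> costs at most \<open>C * e n * \<bar>z\<bar>\<close> in L^1, which is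
  integrable against the normal density. Since the differences are uniformly bounded, the L^2
  statement follows from the L^1 estimate.\<close>

lemma gauss_average_tendsto:
  assumes G: "step_fun G"
  shows "Lr_tendsto 2 (\<lambda>n \<xi>. complex_of_real (1 / sqrt (2 * pi)) *
    (LINT x|lborel. G x * complex_of_real (gauss (1 / (real n + 1)) (x - \<xi>)))) G"
proof -
  define e where "e n = 1 / (real n + 1)" for n :: nat
  have e: "e n > 0" for n by (simp add: e_def)
  have bG: "bounded_support G"
    using G by (rule step_fun_bounded_support)
  obtain B where B: "B > 0" "\<And>x. norm (G x) \<le> B"
    using bounded_supportE[OF bG] by metis
  have [measurable]: "G \<in> borel_measurable borel"
    using bG by (simp add: bounded_support_def)
  obtain C where C: "C \<ge> 0" "\<And>u. (\<integral>\<^sup>+x. ennreal (norm (G (x + u) - G x)) \<partial>lborel) \<le> ennreal (C * \<bar>u\<bar>)"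
    using step_fun_translate[OF G] by blast
  have N1: "(LINT z|lborel. std_normal_density z) = 1"
    using integral_normal_density[of 1 0] by simp
  have Ni: "integrable lborel std_normal_density"
    using integrable_normal_density[of 1 0] by simp
  have Nc: "integrable lborel (\<lambda>z. complex_of_real (std_normal_density z))"
    using Ni by (simp add: complex_of_real_integrable_eq)
  have bi: "integrable lborel (\<lambda>z. complex_of_real (std_normal_density z) * h z)"
    if "h \<in> borel_measurable borel" "\<And>z. norm (h z) \<le> K" for h K
    by (rule integrable_mult_bounded[OF Nc that])
  define A where "A n \<xi> = complex_of_real (1 / sqrt (2 * pi)) *
    (LINT x|lborel. G x * complex_of_real (gauss (e n) (x - \<xi>)))" for n \<xi>
  have A_eq: "A n \<xi> - G \<xi> = (LINT z|lborel. complex_of_real (std_normal_density z) * (G (\<xi> + e n * z) - G \<xi>))" for n \<xi>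
  proof -
    have "(LINT x|lborel. G x * complex_of_real (gauss (e n) (x - \<xi>)))
        = e n *\<^sub>R (LINT z|lborel. G (\<xi> + e n * z) * complex_of_real (gauss (e n) (e n * z)))"
      using e[of n] by (subst lborel_integral_real_affine[of "e n" _ \<xi>]) auto
    also have "\<dots> = e n *\<^sub>R (LINT z|lborel. complex_of_real (sqrt (2 * pi) / e n) * (complex_of_real (std_normal_density z) * G (\<xi> + e n * z)))"
      using e[of n] by (simp add: gauss_eq mult_ac)
    finally have "A n \<xi> = (LINT z|lborel. complex_of_real (std_normal_density z) * G (\<xi> + e n * z))"
      using e[of n] by (simp add: A_def scaleR_conv_of_real flip: of_real_mult)
    moreover have "G \<xi> = (LINT z|lborel. complex_of_real (std_normal_density z) * G \<xi>)"
      by (simp add: integral_complex_of_real N1)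
    moreover have "(LINT z|lborel. complex_of_real (std_normal_density z) * (G (\<xi> + e n * z) - G \<xi>))
        = (LINT z|lborel. complex_of_real (std_normal_density z) * G (\<xi> + e n * z))
          - (LINT z|lborel. complex_of_real (std_normal_density z) * G \<xi>)"
      unfolding right_diff_distrib
      by (intro Bochner_Integration.integral_diff bi[where K=B] B(2)) measurable
    ultimately show ?thesis by simp
  qed
  have [measurable]: "A n \<in> borel_measurable borel" for n
  proof -
    have "(\<lambda>p. G (snd p) * complex_of_real (gauss (e n) (snd p - fst p))) \<in> borel_measurable (borel \<Otimes>\<^sub>M borel)"
      by measurable
    also have "borel_measurable (borel \<Otimes>\<^sub>M borel) = (borel_measurable (borel \<Otimes>\<^sub>M lborel) :: (real \<times> real \<Rightarrow> complex) set)"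
      by (intro measurable_cong_sets sets_pair_measure_cong) auto
    finally show ?thesis
      unfolding A_def by (intro borel_measurable_times borel_measurable_const lborel.borel_measurable_lebesgue_integral) (simp add: split_beta')
  qed
  \<comment> \<open>The summand 1 keeps the bound at least one, as \<open>Lr_int_le_L1\<close>
    demands.\<close>
  have A_bound: "norm (A n \<xi> - G \<xi>) \<le> 2 * B + 1" for n \<xi>
  proof -
    have "norm (A n \<xi> - G \<xi>) \<le> (LINT z|lborel. norm (complex_of_real (std_normal_density z) * (G (\<xi> + e n * z) - G \<xi>)))"
      unfolding A_eq by (rule integral_norm_bound)
    also have "\<dots> \<le> (LINT z|lborel. 2 * B * std_normal_density z)"
    proof (rule integral_mono')
      fix z
      have "norm (G (\<xi> + e n * z) - G \<xi>) \<le> 2 * B"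
        using norm_triangle_ineq4[of "G (\<xi> + e n * z)" "G \<xi>"] B(2)[of "\<xi> + e n * z"] B(2)[of \<xi>] by linarith
      then show "norm (complex_of_real (std_normal_density z) * (G (\<xi> + e n * z) - G \<xi>)) \<le> 2 * B * std_normal_density z"
        by (simp add: norm_mult normal_density_nonneg mult.commute[of "2 * B"] mult_left_mono)
    qed (use Ni B(1) in \<open>auto simp: normal_density_nonneg\<close>)
    also have "\<dots> = 2 * B" by (simp add: N1)
    finally show ?thesis by simp
  qed
  define M where "M = (LINT z|lborel. std_normal_density z * \<bar>z\<bar>)"
  have Mi: "integrable lborel (\<lambda>z. std_normal_density z * \<bar>z\<bar>)"
    using integrable_std_normal_moment_abs[of 1] by simp
  have A_L1: "Lr_int 1 (\<lambda>\<xi>. A n \<xi> - G \<xi>) \<le> ennreal (C * M * e n)" for n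
  proof -
    have "Lr_int 1 (\<lambda>\<xi>. A n \<xi> - G \<xi>)
        \<le> (\<integral>\<^sup>+\<xi>. \<integral>\<^sup>+z. ennreal (std_normal_density z * norm (G (\<xi> + e n * z) - G \<xi>)) \<partial>lborel \<partial>lborel)"
      unfolding Lr_int_1
    proof (rule nn_integral_mono)
      fix \<xi>
      have "norm (G (\<xi> + e n * z) - G \<xi>) \<le> 2 * B" for z
        using norm_triangle_ineq4[of "G (\<xi> + e n * z)" "G \<xi>"] B(2)[of "\<xi> + e n * z"] B(2)[of \<xi>] by linarith
      then have "integrable lborel (\<lambda>z. complex_of_real (std_normal_density z) * (G (\<xi> + e n * z) - G \<xi>))"
        by (intro bi) auto
      from integral_norm_bound_ennreal[OF this]
      show "ennreal (norm (A n \<xi> - G \<xi>)) \<le> (\<integral>\<^sup>+z. ennreal (std_normal_density z * norm (G (\<xi> + e n * z) - G \<xi>)) \<partial>lborel)"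
        by (simp add: A_eq norm_mult normal_density_nonneg)
    qed
    also have "\<dots> = (\<integral>\<^sup>+z. \<integral>\<^sup>+\<xi>. ennreal (std_normal_density z * norm (G (\<xi> + e n * z) - G \<xi>)) \<partial>lborel \<partial>lborel)"
      by (rule lborel_pair.Fubini') measurable
    also have "\<dots> = (\<integral>\<^sup>+z. ennreal (std_normal_density z) * (\<integral>\<^sup>+\<xi>. ennreal (norm (G (\<xi> + e n * z) - G \<xi>)) \<partial>lborel) \<partial>lborel)"
      by (intro nn_integral_cong, subst nn_integral_cmult[symmetric]) (auto simp: ennreal_mult' normal_density_nonneg)
    also have "\<dots> \<le> (\<integral>\<^sup>+z. ennreal (std_normal_density z) * ennreal (C * \<bar>e n * z\<bar>) \<partial>lborel)"
      by (intro nn_integral_mono mult_left_mono C(2)) auto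
    also have "\<dots> = (\<integral>\<^sup>+z. ennreal (C * e n * (std_normal_density z * \<bar>z\<bar>)) \<partial>lborel)"
      using e[of n] C(1) by (intro nn_integral_cong) (auto simp: ennreal_mult[symmetric] normal_density_nonneg abs_mult mult_ac)
    also have "\<dots> = ennreal (C * e n * M)"
      using e[of n] C(1) Mi unfolding M_def
      by (subst nn_integral_eq_integral) (auto simp: normal_density_nonneg)
    finally show ?thesis by (simp add: mult_ac)
  qed
  have A2: "Lr_int 2 (\<lambda>\<xi>. A n \<xi> - G \<xi>) \<le> ennreal ((2 * B + 1) powr 2) * ennreal (C * M * e n)" for n
    by (rule order_trans[OF Lr_int_le_L1[OF _ A_bound] mult_left_mono[OF A_L1]]) (use B(1) in auto)
  have "(\<lambda>n. ennreal (C * M * e n)) \<longlonglongrightarrow> ennreal (C * M * 0)"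
    by (intro tendsto_ennrealI tendsto_mult tendsto_const) (unfold e_def, real_asymp)
  then have lim: "(\<lambda>n. Lr_int 2 (\<lambda>\<xi>. A n \<xi> - G \<xi>)) \<longlonglongrightarrow> 0"
    by (intro tendsto_0_le_ennreal[OF _ A2]) simp
  have G2: "G \<in> Lr 2"
    using bG by (rule bounded_support_Lr) simp
  have "(\<lambda>\<xi>. A n \<xi> - G \<xi>) \<in> Lr 2" for n
    using A2[of n] by (auto simp: Lr_iff ennreal_mult_less_top intro: order.strict_trans1)
  from Lr_add[OF this G2] have "A n \<in> Lr 2" for n by simp
  then have "Lr_tendsto 2 A G"
    by (intro Lr_tendstoI G2 lim) auto
  then show ?thesis
    by (simp add: A_def[abs_def] e_def[abs_def])
qed

lemma ft_reflect: "ft (\<lambda>t. f (- t)) \<xi> = ft f (- \<xi>)"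
  unfolding ft_def
  using lborel_integral_real_affine[of "-1" "\<lambda>t. f t * cis (\<xi> * t)" 0] by simp

text \<open>The inverse transform of \<open>G\<close> need not be integrable, since \<open>G\<close>
  may jump; it is therefore damped to \<open>h n\<close>, which lies in \<open>Lr 1\<close>. The
  transform of \<open>h n\<close> is a Gaussian average of \<open>G\<close> and tends to
  \<open>G\<close> in L^2, while \<open>h n\<close> tends to the undamped function by dominated
  convergence.\<close>

lemma ft2_inversion_step:
  assumes G: "step_fun G"
  shows "ft2 (\<lambda>x. complex_of_real (1 / (2 * pi)) * ft G (- x)) G"
proof -
  define e where "e n = 1 / (real n + 1)" for n :: nat
  have e: "e n > 0" for n by (simp add: e_def)
  have bG: "bounded_support G"
    using G by (rule step_fun_bounded_support)
  have Gi: "integrable lborel G" and G1: "G \<in> Lr 1" and G2: "G \<in> Lr 2"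
    using bG by (auto intro: bounded_support_integrable bounded_support_Lr)
  have [measurable]: "G \<in> borel_measurable borel"
    using G2 by (rule LrD)
  define g where "g x = complex_of_real (1 / (2 * pi)) * ft G (- x)" for x
  have g2: "g \<in> Lr 2"
    unfolding g_def using Lr_cmult[OF Lr_scale[OF ft_Lr2[OF G1 G2], of "-1"], of "complex_of_real (1 / (2 * pi))"] by simp
  define h where "h n x = complex_of_real (1 / sqrt (2 * pi)) * (complex_of_real (std_normal_density (e n * x)) * ft G (- x))" for n x
  have [measurable]: "h n \<in> borel_measurable borel" "g \<in> borel_measurable borel" for n
    unfolding h_def g_def by measurable
  have hg: "norm (h n x) \<le> norm (g x)" for n x
  proof -
    have "std_normal_density (e n * x) \<le> 1 / sqrt (2 * pi)"
      by (simp add: std_normal_density_def divide_right_mono)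
    then have "1 / sqrt (2 * pi) * std_normal_density (e n * x) \<le> 1 / sqrt (2 * pi) * (1 / sqrt (2 * pi))"
      by (intro mult_left_mono) auto
    also have "\<dots> = 1 / (2 * pi)" by simp
    finally have "1 / sqrt (2 * pi) * std_normal_density (e n * x) * norm (ft G (- x)) \<le> 1 / (2 * pi) * norm (ft G (- x))"
      by (rule mult_right_mono) simp
    then show ?thesis
      by (simp add: h_def g_def norm_mult normal_density_nonneg norm_divide)
  qed
  have hlim: "(\<lambda>n. h n x) \<longlonglongrightarrow> g x" for x
  proof -
    have e0: "e \<longlonglongrightarrow> 0" unfolding e_def by real_asymp
    have "(\<lambda>n. 1 / sqrt (2 * pi) * exp (- (e n * x)\<^sup>2 / 2)) \<longlonglongrightarrow> 1 / sqrt (2 * pi) * exp (- (0 * x)\<^sup>2 / 2)"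
      by (intro tendsto_intros e0) auto
    then have "(\<lambda>n. std_normal_density (e n * x)) \<longlonglongrightarrow> 1 / sqrt (2 * pi)"
      by (simp add: std_normal_density_def)
    then have "(\<lambda>n. h n x) \<longlonglongrightarrow> complex_of_real (1 / sqrt (2 * pi)) * (complex_of_real (1 / sqrt (2 * pi)) * ft G (- x))"
      unfolding h_def by (intro tendsto_mult tendsto_of_real tendsto_const)
    also have "complex_of_real (1 / sqrt (2 * pi)) * (complex_of_real (1 / sqrt (2 * pi)) * ft G (- x)) = g x"
      by (simp add: g_def mult.assoc[symmetric] flip: of_real_mult)
    finally show ?thesis .
  qed
  have h1: "h n \<in> Lr 1" for n
  proof -
    have "integrable lborel (\<lambda>x. complex_of_real (std_normal_density (e n * x)) * ft G (- x))"
      by (rule integrable_mult_bounded[OF std_normal_integrable[OF e] _ ft_bound]) measurable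
    then show ?thesis
      unfolding h_def Lr_1_iff by (rule integrable_mult_right)
  qed
  have h2: "h n \<in> Lr 2" for n
    by (rule Lr_mono[OF g2 _ _ hg]) auto
  have "ft (h n) \<xi> = complex_of_real (1 / sqrt (2 * pi)) * (LINT x|lborel. G x * complex_of_real (gauss (e n) (x - \<xi>)))" for n \<xi>
  proof -
    have "ft (h n) \<xi> = complex_of_real (1 / sqrt (2 * pi)) * ft (\<lambda>x. complex_of_real (std_normal_density (e n * x)) * ft G (- x)) \<xi>"
      unfolding h_def by (rule ft_cmult)
    also have "ft (\<lambda>x. complex_of_real (std_normal_density (e n * x)) * ft G (- x)) \<xi>
        = ft (\<lambda>x. complex_of_real (std_normal_density (e n * x)) * ft G x) (- \<xi>)"
      by (subst ft_reflect[symmetric]) (simp add: std_normal_density_def)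
    also have "\<dots> = (LINT x|lborel. G x * complex_of_real (gauss (e n) (x - \<xi>)))"
      by (subst ft_gauss_regularised[OF Gi e]) simp
    finally show ?thesis .
  qed
  then have "(\<lambda>n. ft (h n)) = (\<lambda>n \<xi>. complex_of_real (1 / sqrt (2 * pi)) *
    (LINT x|lborel. G x * complex_of_real (gauss (1 / (real n + 1)) (x - \<xi>))))"
    by (simp add: e_def fun_eq_iff)
  then have "Lr_tendsto 2 (\<lambda>n. ft (h n)) G"
    using gauss_average_tendsto[OF G] by simp
  moreover have "Lr_tendsto 2 h g"
    by (rule Lr_tendsto_dct[OF _ _ g2]) (use hlim hg in auto)
  ultimately have "ft2 g G"
    by (intro ft2I[OF h1 h2])
  then show ?thesis
    by (simp add: g_def[abs_def])
qed

text \<open>The step functions approximate \<open>g\<close>, not \<open>G\<close>: inversion holds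
  for each of them, their transforms tend to \<open>G\<close>, and closedness of \<open>ft2\<close>
  yields the claim.\<close>

lemma ft2_inversion:
  assumes "ft2 g G"
  shows "ft2 (\<lambda>x. complex_of_real (1 / (2 * pi)) * G (- x)) g"
proof -
  have g: "g \<in> Lr 2" using assms by (rule ft2_Lr)
  obtain s where s: "\<And>n. step_fun (s n)" "Lr_tendsto 2 s g"
    using step_fun_dense[OF g g] by auto
  have s1: "ft2 (s n) (ft (s n))" for n
    using bounded_support_Lr[OF step_fun_bounded_support[OF s(1)]] by (intro ft2_ft) auto
  have "Lr_tendsto 2 (\<lambda>n. ft (s n)) G"
    by (rule ft2_tendsto[OF s1 s(2) assms])
  then have "Lr_tendsto 2 (\<lambda>n x. ft (s n) (- 1 * x)) (\<lambda>x. G (- 1 * x))"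
    by (rule Lr_tendsto_scale) auto
  then have "Lr_tendsto 2 (\<lambda>n x. complex_of_real (1 / (2 * pi)) * ft (s n) (- x)) (\<lambda>x. complex_of_real (1 / (2 * pi)) * G (- x))"
    by (intro Lr_tendsto_cmult) auto
  then show ?thesis
    by (rule ft2_closed[OF ft2_inversion_step[OF s(1)] _ s(2)])
qed

lemma norm_inverse_2pi_mult_le: "norm (complex_of_real (1 / (2 * pi)) * z) \<le> norm z"
proof -
  have "1 / (2 * pi) \<le> 1"
    using pi_ge_two by simp
  then have "norm (complex_of_real (1 / (2 * pi))) \<le> 1"
    unfolding norm_of_real by simp
  then have "norm (complex_of_real (1 / (2 * pi))) * norm z \<le> 1 * norm z"
    by (intro mult_right_mono) auto
  then show ?thesis
    by (simp only: norm_mult mult_1)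
qed

text \<open>Boundedness of the transform, applied to the inversion formula; the factor
  \<open>1 / (2 * pi)\<close> is simply estimated by one.\<close>

lemma ft2_inverse_bound:
  assumes "ft2 g G"
  shows "Lr_int 2 g \<le> ennreal (8 * pi) * Lr_int 2 G"
proof -
  have [measurable]: "G \<in> borel_measurable borel"
    using ft2_Lr(2)[OF assms] by (rule LrD)
  have "Lr_int 2 g \<le> ennreal (8 * pi) * Lr_int 2 (\<lambda>x. complex_of_real (1 / (2 * pi)) * G (- x))"
    by (rule ft2_bound[OF ft2_inversion[OF assms]])
  also have "Lr_int 2 (\<lambda>x. complex_of_real (1 / (2 * pi)) * G (- x)) \<le> Lr_int 2 (\<lambda>x. G (- 1 * x))"
    using norm_inverse_2pi_mult_le by (intro Lr_int_mono) (simp_all only: mult_minus1)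
  also have "Lr_int 2 (\<lambda>x. G (- 1 * x)) = Lr_int 2 G"
    using Lr_int_scale[of G "-1" 2] by simp
  finally show ?thesis by (simp add: mult_left_mono)
qed

text \<open>Surjectivity from inversion: the preimage is, up to a factor, the reflected transform of
  \<open>G\<close>.\<close>

lemma ft2_inverse_exists:
  assumes "G \<in> Lr 2"
  obtains g where "ft2 g G"
  using ft2_exists[OF assms] ft2_inversion by metis

section \<open>Multipliers on \<open>L\<^sup>2\<close> and convolution kernels\<close>

definition mult2 :: "(real \<Rightarrow> complex) \<Rightarrow> (real \<Rightarrow> complex) \<Rightarrow> (real \<Rightarrow> complex) \<Rightarrow> bool" where
  "mult2 m f g \<longleftrightarrow> (\<exists>F. ft2 f F \<and> ft2 g (\<lambda>x. m x * F x))"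

lemma Lr_int_mult_bounded:
  assumes [measurable]: "f \<in> borel_measurable borel" and "\<And>x. norm (m x) \<le> B" "r \<ge> 0"
  shows "Lr_int r (\<lambda>x. m x * f x) \<le> ennreal (B powr r) * Lr_int r f"
proof -
  have "B \<ge> 0" using assms(2)[of 0] norm_ge_zero order_trans by blast
  have "Lr_int r (\<lambda>x. m x * f x) \<le> Lr_int r (\<lambda>x. complex_of_real B * f x)"
    using assms(2,3) \<open>B \<ge> 0\<close> by (intro Lr_int_mono) (auto simp: norm_mult intro!: mult_right_mono)
  also have "\<dots> = ennreal (B powr r) * Lr_int r f"
    using \<open>B \<ge> 0\<close> by (subst Lr_int_cmult) auto
  finally show ?thesis .
qed

lemma Lr_mult_bounded:
  assumes "f \<in> Lr r" "m \<in> borel_measurable borel" "\<And>x. norm (m x) \<le> B" "r \<ge> 0"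
  shows "(\<lambda>x. m x * f x) \<in> Lr r"
  using Lr_int_mult_bounded[of f m B r] assms
  by (auto simp: Lr_iff ennreal_mult_less_top intro: order.strict_trans1)

lemma mult2_exists:
  assumes "f \<in> Lr 2" "m \<in> borel_measurable borel" "\<And>x. norm (m x) \<le> B"
  obtains g where "mult2 m f g"
proof -
  obtain F where F: "ft2 f F"
    using ft2_exists[OF assms(1)] .
  obtain g where "ft2 g (\<lambda>x. m x * F x)"
    by (rule ft2_inverse_exists[OF Lr_mult_bounded[OF ft2_Lr(2)[OF F] assms(2,3)]]) auto
  with F that show ?thesis
    unfolding mult2_def by blast
qed

lemma mult2_add: "mult2 m f g \<Longrightarrow> mult2 m f' g' \<Longrightarrow> mult2 m (\<lambda>x. f x + f' x) (\<lambda>x. g x + g' x)"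
  unfolding mult2_def
proof (elim exE conjE)
  fix F F' assume *: "ft2 f F" "ft2 g (\<lambda>x. m x * F x)" "ft2 f' F'" "ft2 g' (\<lambda>x. m x * F' x)"
  show "\<exists>F. ft2 (\<lambda>x. f x + f' x) F \<and> ft2 (\<lambda>x. g x + g' x) (\<lambda>x. m x * F x)"
    using ft2_add[OF *(1,3)] ft2_add[OF *(2,4)] by (intro exI[of _ "\<lambda>x. F x + F' x"]) (simp add: distrib_left)
qed

lemma mult2_cmult: "mult2 m f g \<Longrightarrow> mult2 m (\<lambda>x. z * f x) (\<lambda>x. z * g x)"
  unfolding mult2_def
proof (elim exE conjE)
  fix F assume *: "ft2 f F" "ft2 g (\<lambda>x. m x * F x)"
  show "\<exists>F. ft2 (\<lambda>x. z * f x) F \<and> ft2 (\<lambda>x. z * g x) (\<lambda>x. m x * F x)"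
    using ft2_cmult[OF *(1)] ft2_cmult[OF *(2)] by (intro exI[of _ "\<lambda>x. z * F x"]) (simp add: mult_ac)
qed

lemma mult2_diff: "mult2 m f g \<Longrightarrow> mult2 m f' g' \<Longrightarrow> mult2 m (\<lambda>x. f x - f' x) (\<lambda>x. g x - g' x)"
  using mult2_add[of m f g, OF _ mult2_cmult[of m f' g' "-1"]] by simp

lemma mult2_Lr: "mult2 m f g \<Longrightarrow> f \<in> Lr 2" "mult2 m f g \<Longrightarrow> g \<in> Lr 2"
  unfolding mult2_def by (auto intro: ft2_Lr)

lemma mult2_bound:
  assumes fg: "mult2 m f g" and m: "\<And>x. norm (m x) \<le> B"
  shows "Lr_int 2 g \<le> ennreal (8 * pi * (B powr 2) * (8 * pi)) * Lr_int 2 f"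
proof -
  define p where "p = 8 * pi"
  have p: "p \<ge> 0" by (simp add: p_def)
  obtain F where F: "ft2 f F" "ft2 g (\<lambda>x. m x * F x)"
    using fg unfolding mult2_def by blast
  have "Lr_int 2 g \<le> ennreal (8 * pi) * Lr_int 2 (\<lambda>x. m x * F x)"
    by (rule ft2_inverse_bound[OF F(2)])
  also have "\<dots> \<le> ennreal (8 * pi) * (ennreal (B powr 2) * Lr_int 2 F)"
    using LrD(1)[OF ft2_Lr(2)[OF F(1)]] m by (intro mult_left_mono Lr_int_mult_bounded) auto
  also have "\<dots> \<le> ennreal (8 * pi) * (ennreal (B powr 2) * (ennreal (8 * pi) * Lr_int 2 f))"
    by (intro mult_left_mono ft2_bound[OF F(1)]) auto
  also have "\<dots> = ennreal (8 * pi * (B powr 2) * (8 * pi)) * Lr_int 2 f"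
    unfolding p_def[symmetric] using p by (simp add: ennreal_mult mult.assoc)
  finally show ?thesis .
qed

lemma mult2_tendsto:
  assumes "\<And>n. mult2 m (u n) (v n)" "Lr_tendsto 2 u f" "mult2 m f g" "\<And>x. norm (m x) \<le> B"
  shows "Lr_tendsto 2 v g"
  by (rule Lr_tendsto_dominated[OF assms(2) _ mult2_Lr(2)[OF assms(1)] mult2_Lr(2)[OF assms(3)]
        mult2_bound[OF mult2_diff[OF assms(1,3)] assms(4)]]) simp

text \<open>The operator of \<open>mult2\<close> with the inverse transform written out as an
  integral. For an integrable symbol and integrable \<open>f\<close> the integral converges for each
  \<open>x\<close>, so pointwise estimates of the image make sense.\<close>

definition mult1 :: "(real \<Rightarrow> complex) \<Rightarrow> (real \<Rightarrow> complex) \<Rightarrow> real \<Rightarrow> complex" where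
  "mult1 m f x = complex_of_real (1 / (2 * pi)) * ft (\<lambda>\<xi>. m \<xi> * ft f \<xi>) (- x)"

definition kernel :: "(real \<Rightarrow> complex) \<Rightarrow> real \<Rightarrow> complex" where
  "kernel m z = complex_of_real (1 / (2 * pi)) * ft m (- z)"

lemma kernel_measurable [measurable]:
  assumes [measurable]: "m \<in> borel_measurable borel"
  shows "kernel m \<in> borel_measurable borel"
  unfolding kernel_def by measurable

lemma kernel_bound:
  "norm (kernel m z) \<le> (LINT t|lborel. norm (m t))"
proof -
  have "norm (kernel m z) \<le> norm (ft m (- z))"
    unfolding kernel_def by (rule norm_inverse_2pi_mult_le)
  also have "\<dots> \<le> (LINT t|lborel. norm (m t))" by (rule ft_bound)
  finally show ?thesis .
qed

lemma mult1_integrable: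
  assumes "integrable lborel m" "integrable lborel f"
  shows "integrable lborel (\<lambda>\<xi>. m \<xi> * ft f \<xi>)"
  using assms by (intro integrable_mult_bounded[OF _ _ ft_bound]) auto

lemma mult1_measurable [measurable]:
  assumes [measurable]: "m \<in> borel_measurable borel" "f \<in> borel_measurable borel"
  shows "mult1 m f \<in> borel_measurable borel"
  unfolding mult1_def by measurable

text \<open>The multiplication formula moves the transform from \<open>f\<close> to the modulated
  symbol, whose transform is a translate. This exhibits the inverse transform of \<open>m\<close> as
  convolution kernel.\<close>

lemma mult1_kernel:
  assumes m: "integrable lborel m" and f: "integrable lborel f"
  shows "mult1 m f x = (LINT y|lborel. f y * kernel m (x - y))"
proof -
  have g: "integrable lborel (\<lambda>\<xi>. m \<xi> * cis (x * \<xi>))"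
    using m by (rule integrable_mult_bounded[where B=1]) auto
  have "ft (\<lambda>\<xi>. m \<xi> * ft f \<xi>) (- x) = (LINT \<xi>|lborel. (m \<xi> * cis (x * \<xi>)) * ft f \<xi>)"
    unfolding ft_def[of "\<lambda>\<xi>. m \<xi> * ft f \<xi>"] by (simp add: mult_ac)
  also have "\<dots> = (LINT y|lborel. f y * ft (\<lambda>\<xi>. m \<xi> * cis (x * \<xi>)) y)"
    by (rule ft_mult_formula[OF f g])
  also have "\<dots> = (LINT y|lborel. f y * ft m (y - x))"
    by (simp add: ft_modulate)
  finally show ?thesis
    by (simp add: mult1_def kernel_def mult.left_commute)
qed

text \<open>The two factors \<open>2 * pi\<close> from Plancherel's inequality cancel the squared
  \<open>1 / (2 * pi)\<close>, so nothing but \<open>B\<close> remains.\<close>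

lemma mult1_L2_bound:
  assumes m: "integrable lborel m" "\<And>x. norm (m x) \<le> B" and f: "integrable lborel f"
  shows "Lr_int 2 (mult1 m f) \<le> ennreal (B\<^sup>2) * Lr_int 2 f"
proof -
  have [measurable]: "m \<in> borel_measurable borel" "f \<in> borel_measurable borel"
    using m f by auto
  have "B \<ge> 0" using m(2)[of 0] norm_ge_zero order_trans by blast
  define p where "p = 2 * pi"
  have p: "p \<ge> 0" by (simp add: p_def)
  have "Lr_int 2 (mult1 m f) = ennreal ((1 / (2 * pi)) powr 2) * Lr_int 2 (\<lambda>x. ft (\<lambda>\<xi>. m \<xi> * ft f \<xi>) (- 1 * x))"
    unfolding mult1_def by (subst Lr_int_cmult) (simp_all add: norm_divide norm_mult)
  also have "Lr_int 2 (\<lambda>x. ft (\<lambda>\<xi>. m \<xi> * ft f \<xi>) (- 1 * x)) = Lr_int 2 (ft (\<lambda>\<xi>. m \<xi> * ft f \<xi>))"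
    using Lr_int_scale[of "ft (\<lambda>\<xi>. m \<xi> * ft f \<xi>)" "-1" 2] by simp
  also have "\<dots> \<le> ennreal (2 * pi) * Lr_int 2 (\<lambda>\<xi>. m \<xi> * ft f \<xi>)"
    by (rule Plancherel_le[OF mult1_integrable[OF m(1) f]])
  also have "Lr_int 2 (\<lambda>\<xi>. m \<xi> * ft f \<xi>) \<le> ennreal (B powr 2) * Lr_int 2 (ft f)"
    by (rule Lr_int_mult_bounded) (use m in auto)
  also have "Lr_int 2 (ft f) \<le> ennreal (2 * pi) * Lr_int 2 f"
    by (rule Plancherel_le[OF f])
  finally have "Lr_int 2 (mult1 m f) \<le> ennreal ((1 / (2 * pi)) powr 2) * (ennreal (2 * pi) * (ennreal (B powr 2) * (ennreal (2 * pi) * Lr_int 2 f)))"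
    by (simp add: mult_left_mono)
  also have "\<dots> = ennreal ((1 / (2 * pi)) powr 2 * (2 * pi) * (B powr 2) * (2 * pi)) * Lr_int 2 f"
    unfolding p_def[symmetric] using p by (simp add: ennreal_mult mult.assoc)
  also have "(1 / (2 * pi)) powr 2 * (2 * pi) * (B powr 2) * (2 * pi) = B\<^sup>2"
    using \<open>B \<ge> 0\<close> by (simp add: powr_numeral field_simps power2_eq_square)
  finally show ?thesis .
qed

section \<open>Hoermander's condition\<close>

text \<open>A cutoff to frequencies of size up to about \<open>1 / \<bar>y\<bar>\<close>. The
  rational profile has explicit derivatives and a known integral; at scale \<open>1 / y\<close> it
  reappears as the weight on the kernel side.\<close>

abbreviation lorentz :: "real \<Rightarrow> real \<Rightarrow> real" where
  "lorentz y x \<equiv> inverse (1 + (y * x)\<^sup>2)"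

abbreviation L1_on :: "(real \<Rightarrow> complex) \<Rightarrow> real set \<Rightarrow> ennreal" where
  "L1_on f S \<equiv> (\<integral>\<^sup>+x. ennreal (norm (f x)) * indicator S x \<partial>lborel)"

abbreviation L2_on :: "(real \<Rightarrow> complex) \<Rightarrow> real set \<Rightarrow> ennreal" where
  "L2_on f S \<equiv> (\<integral>\<^sup>+x. ennreal ((norm (f x))\<^sup>2) * indicator S x \<partial>lborel)"

lemma nn_integral_lorentz:
  assumes "y \<noteq> 0"
  shows "(\<integral>\<^sup>+x. ennreal (lorentz y x) \<partial>lborel) = ennreal (pi / \<bar>y\<bar>)"
proof -
  have "set_integrable lborel (einterval (- \<infinity>) \<infinity>) (\<lambda>x::real. inverse (1 + x\<^sup>2))"
    by (rule integrable_inverse_1_plus_square)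
  then have i: "integrable lborel (\<lambda>x::real. inverse (1 + x\<^sup>2))"
    by (simp add: set_integrable_def)
  have "(LINT x|lborel. inverse (1 + x\<^sup>2)) = pi"
    using LBINT_inverse_1_plus_square by (simp add: interval_lebesgue_integral_def set_lebesgue_integral_def)
  then have "(\<integral>\<^sup>+x. ennreal (inverse (1 + x\<^sup>2)) \<partial>lborel) = ennreal pi"
    using nn_integral_eq_integral[OF i] by simp
  moreover have "(\<integral>\<^sup>+x. ennreal (inverse (1 + x\<^sup>2)) \<partial>lborel) = \<bar>y\<bar> * (\<integral>\<^sup>+x. ennreal (inverse (1 + (0 + y * x)\<^sup>2)) \<partial>lborel)"
    using assms by (intro nn_integral_real_affine) measurable
  ultimately have *: "ennreal pi = ennreal \<bar>y\<bar> * (\<integral>\<^sup>+x. ennreal (lorentz y x) \<partial>lborel)"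
    by simp
  have "ennreal (pi / \<bar>y\<bar>) = ennreal (1 / \<bar>y\<bar>) * ennreal pi"
    by (simp add: ennreal_mult'[symmetric])
  also have "\<dots> = ennreal (1 / \<bar>y\<bar> * \<bar>y\<bar>) * (\<integral>\<^sup>+x. ennreal (lorentz y x) \<partial>lborel)"
    unfolding * by (subst ennreal_mult) (auto simp: mult.assoc)
  finally show ?thesis using assms by simp
qed

lemma integrable_lorentz_bound:
  fixes f :: "real \<Rightarrow> complex"
  assumes "f \<in> borel_measurable borel" "\<And>x. x \<noteq> 0 \<Longrightarrow> norm (f x) \<le> E * inverse (1 + x\<^sup>2)"
  shows "integrable lborel f"
proof (rule Bochner_Integration.integrable_bound)
  have "integrable lborel (\<lambda>x::real. inverse (1 + x\<^sup>2))"
    using integrable_inverse_1_plus_square by (simp add: set_integrable_def)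
  then show "integrable lborel (\<lambda>x::real. E * inverse (1 + x\<^sup>2))"
    by simp
  have "AE x in lborel. x \<noteq> (0 :: real)"
    by (rule AE_lborel_singleton)
  then show "AE x in lborel. norm (f x) \<le> norm (E * inverse (1 + x\<^sup>2))"
    by eventually_elim (use assms(2) in \<open>auto intro: order_trans[OF _ abs_ge_self]\<close>)
qed (use assms(1) in auto)

section \<open>Tails of transforms of functions with a square integrable derivative\<close>

lemma integral_deriv_half_lines:
  fixes G G' :: "real \<Rightarrow> complex"
  assumes G: "\<And>x. x \<noteq> 0 \<Longrightarrow> (G has_vector_derivative G' x) (at x)"
    and G': "\<And>x. x \<noteq> 0 \<Longrightarrow> isCont G' x" and int: "integrable lborel G'"
    and lim: "(G \<longlongrightarrow> 0) at_top" "(G \<longlongrightarrow> 0) at_bot" "(G \<longlongrightarrow> 0) (at 0)"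
  shows "(LINT x|lborel. G' x) = 0"
proof -
  have set_int: "set_integrable lborel A G'" if "A \<in> sets borel" for A
    using integrable_mult_indicator[OF _ int, of A] that by (simp add: set_integrable_def)
  have l0: "((G \<circ> real_of_ereal) \<longlongrightarrow> 0) (at_right 0)" "((G \<circ> real_of_ereal) \<longlongrightarrow> 0) (at_left 0)"
    using lim(3) unfolding zero_ereal_def ereal_tendsto_simps
    by (auto simp: filterlim_at_split)
  have p: "(LBINT x=0..\<infinity>. G' x) = 0 - 0"
    by (rule interval_integral_FTC_integrable[of _ _ G])
       (use G G' set_int l0 lim in \<open>auto simp: ereal_tendsto_simps\<close>)
  have n: "(LBINT x=-\<infinity>..0. G' x) = 0 - 0"
    by (rule interval_integral_FTC_integrable[of _ _ G])
       (use G G' set_int l0 lim in \<open>auto simp: ereal_tendsto_simps\<close>)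
  have "(LINT x|lborel. G' x) = (LINT x|lborel. indicator {0<..} x *\<^sub>R G' x + indicator {..<0} x *\<^sub>R G' x)"
  proof (rule integral_cong_AE)
    show "AE x in lborel. G' x = indicator {0<..} x *\<^sub>R G' x + indicator {..<0} x *\<^sub>R G' x"
      using AE_lborel_singleton[of 0] by eventually_elim (auto simp: indicator_def)
  qed (use int in auto)
  also have "\<dots> = (LINT x|lborel. indicator {0<..} x *\<^sub>R G' x) + (LINT x|lborel. indicator {..<0} x *\<^sub>R G' x)"
    using set_int by (intro Bochner_Integration.integral_add) (auto simp: set_integrable_def)
  also have "\<dots> = 0"
    using p n by (simp add: interval_lebesgue_integral_def set_lebesgue_integral_def einterval_def
        greaterThan_def lessThan_def zero_ereal_def)
  finally show ?thesis .
qed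

text \<open>Integration by parts on the two half lines. \<open>n\<close> is differentiable only away
  from 0, and its limit zero at 0 removes the boundary terms there.\<close>

lemma ft_deriv:
  fixes n n' :: "real \<Rightarrow> complex"
  assumes n: "\<And>x. x \<noteq> 0 \<Longrightarrow> (n has_vector_derivative n' x) (at x)"
    and n': "\<And>x. x \<noteq> 0 \<Longrightarrow> isCont n' x" and int: "integrable lborel n" "integrable lborel n'"
    and lim: "(n \<longlongrightarrow> 0) at_top" "(n \<longlongrightarrow> 0) at_bot" "(n \<longlongrightarrow> 0) (at 0)"
  shows "ft n' x = \<i> * complex_of_real x * ft n x"
proof -
  let ?c = "\<lambda>t. cis (- (x * t))"
  let ?G' = "\<lambda>t. n' t * ?c t - (\<i> * complex_of_real x) * (n t * ?c t)"
  have dc: "(?c has_vector_derivative - (\<i> * complex_of_real x) * ?c t) (at t)" for t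
  proof -
    have "((\<lambda>t. exp (- (\<i> * complex_of_real x) * complex_of_real t)) has_vector_derivative
        - (\<i> * complex_of_real x) * exp (- (\<i> * complex_of_real x) * complex_of_real t)) (at t)"
      by (rule has_vector_derivative_real_field[of "\<lambda>z. exp (- (\<i> * complex_of_real x) * z)"])
         (auto intro!: derivative_eq_intros)
    then show ?thesis
      by (simp add: cis_conv_exp mult.assoc)
  qed
  have lim0: "((\<lambda>t. n t * ?c t) \<longlongrightarrow> 0) F" if "(n \<longlongrightarrow> 0) F" for F
    by (rule Lim_null_comparison[where g="\<lambda>t. norm (n t)"])
       (use that in \<open>auto simp: norm_mult tendsto_norm_zero\<close>)
  have i: "integrable lborel (\<lambda>t. n' t * ?c t)" "integrable lborel (\<lambda>t. n t * ?c t)"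
    using int by (auto intro: ft_integrand)
  have "(LINT t|lborel. ?G' t) = 0"
  proof (rule integral_deriv_half_lines[where G="\<lambda>t. n t * ?c t"])
    fix t :: real assume t: "t \<noteq> 0"
    have "((\<lambda>t. n t * ?c t) has_vector_derivative (n t * (- (\<i> * complex_of_real x) * ?c t) + n' t * ?c t)) (at t)"
      by (rule has_vector_derivative_mult[OF n[OF t] dc])
    then show "((\<lambda>t. n t * ?c t) has_vector_derivative ?G' t) (at t)"
      by (simp add: algebra_simps)
    have "isCont n t"
      using n[OF t] by (rule has_vector_derivative_continuous)
    then show "isCont ?G' t"
      using n'[OF t] has_vector_derivative_continuous[OF dc] by (intro continuous_intros) auto
  next
    show "integrable lborel ?G'"
      using i by (intro Bochner_Integration.integrable_diff integrable_mult_right)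
  qed (intro lim0 lim)+
  moreover have "(LINT t|lborel. ?G' t) = (LINT t|lborel. n' t * ?c t) - (\<i> * complex_of_real x) * (LINT t|lborel. n t * ?c t)"
    by (subst Bochner_Integration.integral_diff) (use i in auto)
  ultimately show ?thesis
    unfolding ft_def by simp
qed

text \<open>Bernstein's argument: \<open>ft n'\<close> is \<open>ft n\<close> times a factor of
  modulus \<open>\<bar>x\<bar>\<close>, so Plancherel bounds a weighted L^2 norm of
  \<open>ft n\<close>, and the inverse weight is integrable. All powers of \<open>y\<close> cancel:
  the first summand stems from \<open>n'\<close>, and \<open>pi / 2\<close> is the integral of the
  weight.\<close>

lemma ft_tail_bound:
  fixes n n' :: "real \<Rightarrow> complex"
  assumes n: "\<And>x. x \<noteq> 0 \<Longrightarrow> (n has_vector_derivative n' x) (at x)"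
    and n': "\<And>x. x \<noteq> 0 \<Longrightarrow> isCont n' x" and int: "integrable lborel n" "integrable lborel n'"
    and lim: "(n \<longlongrightarrow> 0) at_top" "(n \<longlongrightarrow> 0) at_bot" "(n \<longlongrightarrow> 0) (at 0)"
    and y: "y \<noteq> 0" and D: "\<And>x. x \<noteq> 0 \<Longrightarrow> (norm (n' x))\<^sup>2 \<le> D\<^sup>2 * y\<^sup>2 * lorentz y x"
  shows "L1_on (ft n) {x. \<bar>y\<bar> < \<bar>x\<bar>} \<le> ennreal (2 * pi\<^sup>2 * D\<^sup>2 + pi / 2)"
proof -
  have [measurable]: "n \<in> borel_measurable borel" "n' \<in> borel_measurable borel"
    using int by auto
  let ?b = "\<lambda>x. (norm (ft n' x))\<^sup>2 / \<bar>y\<bar> + lorentz (1 / y) x / (2 * \<bar>y\<bar>)"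
  have le: "norm (ft n x) \<le> ?b x" if "\<bar>y\<bar> < \<bar>x\<bar>" for x
  proof -
    define s where "s = norm (ft n x)"
    have d: "norm (ft n' x) = \<bar>x\<bar> * s"
      by (simp add: ft_deriv[OF n n' int lim] norm_mult s_def)
    have xy: "y\<^sup>2 \<le> x\<^sup>2"
      using that abs_le_square_iff[of y x] by simp
    have inv: "lorentz (1 / y) x = y\<^sup>2 / (x\<^sup>2 + y\<^sup>2)"
      using y by (simp add: field_simps power_divide power_mult_distrib)
    have pos: "x\<^sup>2 + y\<^sup>2 > 0" using y by (simp add: sum_power2_gt_zero_iff)
    \<comment> \<open>Cauchy-Schwarz in pointwise form, with weight \<open>w\<close>. On the tail
      \<open>w\<^sup>2\<close> is at most twice \<open>x\<^sup>2\<close>, so the first square is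
      controlled by \<open>ft n'\<close>; the second is \<open>lorentz (1 / y) x\<close>.\<close>
    define w where "w = sqrt (x\<^sup>2 + y\<^sup>2)"
    have w: "w > 0" "w\<^sup>2 = x\<^sup>2 + y\<^sup>2" using pos by (auto simp: w_def)
    have "2 * (w * s) * (\<bar>y\<bar> / w) \<le> (w * s)\<^sup>2 + (\<bar>y\<bar> / w)\<^sup>2"
      by (rule sum_squares_bound)
    moreover have "2 * (w * s) * (\<bar>y\<bar> / w) = 2 * \<bar>y\<bar> * s" using w by simp
    moreover have "(\<bar>y\<bar> / w)\<^sup>2 = y\<^sup>2 / (x\<^sup>2 + y\<^sup>2)" using w(2) by (simp add: power_divide)
    moreover have "(w * s)\<^sup>2 \<le> 2 * (\<bar>x\<bar> * s)\<^sup>2"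
      using mult_right_mono[OF xy, of "s\<^sup>2"] w(2) by (simp add: power_mult_distrib algebra_simps)
    ultimately have "2 * \<bar>y\<bar> * s \<le> 2 * (\<bar>x\<bar> * s)\<^sup>2 + y\<^sup>2 / (x\<^sup>2 + y\<^sup>2)"
      by linarith
    then have "2 * \<bar>y\<bar> * s / (2 * \<bar>y\<bar>) \<le> (2 * (\<bar>x\<bar> * s)\<^sup>2 + y\<^sup>2 / (x\<^sup>2 + y\<^sup>2)) / (2 * \<bar>y\<bar>)"
      by (rule divide_right_mono) simp
    then show ?thesis
      using y unfolding d inv s_def[symmetric] by (simp add: add_divide_distrib)
  qed
  have "L1_on (ft n) {x. \<bar>y\<bar> < \<bar>x\<bar>} \<le> (\<integral>\<^sup>+x. ennreal (?b x) \<partial>lborel)"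
    by (intro nn_integral_mono) (use le in \<open>auto simp: indicator_def simp del: ennreal_plus intro!: ennreal_leI\<close>)
  also have "\<dots> = (\<integral>\<^sup>+x. ennreal (1 / \<bar>y\<bar>) * ennreal ((norm (ft n' x))\<^sup>2)
      + ennreal (1 / (2 * \<bar>y\<bar>)) * ennreal (lorentz (1 / y) x) \<partial>lborel)"
    by (intro nn_integral_cong) (simp add: ennreal_mult[symmetric] ennreal_plus[symmetric] del: ennreal_plus)
  also have "\<dots> = ennreal (1 / \<bar>y\<bar>) * Lr_int 2 (ft n') + ennreal (1 / (2 * \<bar>y\<bar>)) * ennreal (pi / \<bar>1 / y\<bar>)"
    using y nn_integral_lorentz[of "1 / y"] by (simp add: nn_integral_add nn_integral_cmult Lr_int_2)
  also have "Lr_int 2 (ft n') \<le> ennreal (2 * pi * (D\<^sup>2 * y\<^sup>2 * (pi / \<bar>y\<bar>)))"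
  proof -
    have "Lr_int 2 n' \<le> (\<integral>\<^sup>+x. ennreal (D\<^sup>2 * y\<^sup>2) * ennreal (lorentz y x) \<partial>lborel)"
      unfolding Lr_int_2
    proof (intro nn_integral_mono_AE)
      show "AE x in lborel. ennreal ((norm (n' x))\<^sup>2) \<le> ennreal (D\<^sup>2 * y\<^sup>2) * ennreal (lorentz y x)"
        using AE_lborel_singleton[of 0] by eventually_elim (use D in \<open>simp add: ennreal_mult[symmetric] ennreal_leI\<close>)
    qed
    also have "\<dots> = ennreal (D\<^sup>2 * y\<^sup>2 * (pi / \<bar>y\<bar>))"
      by (subst nn_integral_cmult, measurable, subst nn_integral_lorentz[OF y], rule ennreal_mult[symmetric]) auto
    finally have "ennreal (2 * pi) * Lr_int 2 n' \<le> ennreal (2 * pi) * ennreal (D\<^sup>2 * y\<^sup>2 * (pi / \<bar>y\<bar>))"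
      by (rule mult_left_mono) simp
    with Plancherel_le[OF int(2)] show ?thesis
      by (simp add: ennreal_mult[symmetric])
  qed
  also have "ennreal (1 / \<bar>y\<bar>) * ennreal (2 * pi * (D\<^sup>2 * y\<^sup>2 * (pi / \<bar>y\<bar>))) + ennreal (1 / (2 * \<bar>y\<bar>)) * ennreal (pi / \<bar>1 / y\<bar>)
      = ennreal (1 / \<bar>y\<bar> * (2 * pi * (D\<^sup>2 * y\<^sup>2 * (pi / \<bar>y\<bar>))) + 1 / (2 * \<bar>y\<bar>) * (pi / \<bar>1 / y\<bar>))"
    by (subst ennreal_mult[symmetric], simp, simp)+ (simp add: ennreal_plus[symmetric] del: ennreal_plus)
  also have "1 / \<bar>y\<bar> * (2 * pi * (D\<^sup>2 * y\<^sup>2 * (pi / \<bar>y\<bar>))) + 1 / (2 * \<bar>y\<bar>) * (pi / \<bar>1 / y\<bar>) = 2 * pi\<^sup>2 * D\<^sup>2 + pi / 2"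
    using y by (simp add: field_simps power2_eq_square abs_mult_self_eq)
  finally show ?thesis by (simp add: mult_left_mono add_right_mono)
qed

lemma tendsto_bound_0:
  fixes n :: "real \<Rightarrow> complex"
  assumes "\<And>x. norm (n x) \<le> K * inverse (1 + x\<^sup>2)"
  shows "(n \<longlongrightarrow> 0) at_top" "(n \<longlongrightarrow> 0) at_bot"
proof -
  have "((\<lambda>x::real. K * inverse (1 + x\<^sup>2)) \<longlongrightarrow> 0) at_top" "((\<lambda>x::real. K * inverse (1 + x\<^sup>2)) \<longlongrightarrow> 0) at_bot"
    by real_asymp+
  note lim = this
  have "\<forall>x. norm (n x) \<le> K * inverse (1 + x\<^sup>2)"
    using assms by blast
  note le = always_eventually[OF this]
  show "(n \<longlongrightarrow> 0) at_top"
    by (rule Lim_null_comparison[OF le lim(1)])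
  show "(n \<longlongrightarrow> 0) at_bot"
    by (rule Lim_null_comparison[OF le lim(2)])
qed

lemma norm_cis_minus_1_le: "norm (cis t - 1) \<le> \<bar>t\<bar>"
  using iexp_approx1[of t 0] by (simp add: cis_conv_exp)

lemma emeasure_gt_le:
  assumes [measurable]: "g \<in> borel_measurable borel" "S \<in> sets borel" and l: "l > 0" and le: "\<And>x. x \<in> S \<Longrightarrow> g x > l"
  shows "emeasure lborel S \<le> ennreal (1 / l) * (\<integral>\<^sup>+x. ennreal (g x) * indicator S x \<partial>lborel)"
proof -
  have "emeasure lborel S = (\<integral>\<^sup>+x. indicator S x \<partial>lborel)" by simp
  also have "\<dots> \<le> (\<integral>\<^sup>+x. ennreal (1 / l) * (ennreal (g x) * indicator S x) \<partial>lborel)"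
  proof (intro nn_integral_mono)
    fix x
    show "indicator S x \<le> ennreal (1 / l) * (ennreal (g x) * indicator S x)"
    proof (cases "x \<in> S")
      case True
      have "1 \<le> 1 / l * g x" using le[OF True] l by (simp add: field_simps)
      then have "ennreal 1 \<le> ennreal (1 / l * g x)" by (rule ennreal_leI)
      then show ?thesis using True l by (simp add: ennreal_mult'[symmetric])
    qed simp
  qed
  also have "\<dots> = ennreal (1 / l) * (\<integral>\<^sup>+x. ennreal (g x) * indicator S x \<partial>lborel)"
    by (rule nn_integral_cmult) measurable
  finally show ?thesis .
qed

text \<open>
  Only \<open>B\<close> and \<open>C\<close> may enter the bounds below; \<open>E\<close> is there to make the integrals converge and blows
  up when the regularisation is removed.
\<close>

locale mikhlin_symbol =
  fixes m m' :: "real \<Rightarrow> complex" and B C E :: real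
  assumes deriv: "x \<noteq> 0 \<Longrightarrow> (m has_vector_derivative m' x) (at x)"
    and cont_deriv: "x \<noteq> 0 \<Longrightarrow> isCont m' x"
    and bound: "norm (m x) \<le> B"
    and deriv_bound: "x \<noteq> 0 \<Longrightarrow> norm (m' x) \<le> C / \<bar>x\<bar>"
    and decay: "norm (m x) \<le> E * inverse (1 + x\<^sup>2)"
    and deriv_decay: "x \<noteq> 0 \<Longrightarrow> norm (m' x) \<le> E * inverse (1 + x\<^sup>2) / \<bar>x\<bar>"
    and meas [measurable]: "m \<in> borel_measurable borel" "m' \<in> borel_measurable borel"
begin

lemma integrable: "integrable lborel m"
  by (rule integrable_lorentz_bound[OF meas(1) decay])

lemma B_nonneg: "B \<ge> 0"
  using bound[of 0] norm_ge_zero order_trans by blast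

lemma C_nonneg: "C \<ge> 0"
  using order_trans[OF norm_ge_zero deriv_bound[of 1]] by simp

lemma E_nonneg: "E \<ge> 0"
  using order_trans[OF norm_ge_zero decay[of 0]] by simp

text \<open>The bound of \<open>ft_tail_bound\<close> at \<open>D = C + 3 * B\<close>:
  \<open>C\<close> comes from the derivative of \<open>m\<close>, and 3 from that of the
  cutoff.\<close>

abbreviation tail_const :: real where
  "tail_const \<equiv> 2 * pi\<^sup>2 * (C + 3 * B)\<^sup>2 + pi / 2"

lemma integrable_cutoff:
  assumes "\<psi> \<in> borel_measurable borel" "\<And>x. norm (\<psi> x) \<le> K"
  shows "integrable lborel (\<lambda>x. m x * \<psi> x)"
  by (rule integrable_mult_bounded[OF integrable assms])

text \<open>The bound on \<open>\<psi>\<close> supplies a zero at the origin: it compensates the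
  singularity \<open>C / \<bar>x\<bar>\<close> of \<open>m'\<close> and makes the product tend to
  zero there however \<open>m\<close> behaves. Both bounds contain
  \<open>sqrt (lorentz y x)\<close>, whose square has the integral
  \<open>pi / \<bar>y\<bar>\<close>.\<close>

lemma cutoff_tail:
  assumes \<psi>: "\<And>x. (\<psi> has_vector_derivative \<psi>' x) (at x)" and \<psi>': "\<And>x. isCont \<psi>' x" and y: "y \<noteq> 0"
    and le: "\<And>x. norm (\<psi> x) \<le> \<bar>y * x\<bar> * sqrt (lorentz y x)"
    and le': "\<And>x. norm (\<psi>' x) \<le> 3 * \<bar>y\<bar> * sqrt (lorentz y x)"
  shows "L1_on (ft (\<lambda>x. m x * \<psi> x)) {x. \<bar>y\<bar> < \<bar>x\<bar>} \<le> ennreal tail_const"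
proof -
  let ?w = "\<lambda>x. sqrt (lorentz y x)"
  have w: "?w x \<ge> 0" "?w x \<le> 1" for x
    by (auto simp: inverse_le_1_iff add_pos_nonneg)
  have tw: "\<bar>y * x\<bar> * ?w x \<le> 1" for x
  proof (rule power2_le_imp_le)
    have "(\<bar>y * x\<bar> * ?w x)\<^sup>2 = (y * x)\<^sup>2 * lorentz y x"
      by (subst power_mult_distrib) (simp add: add_nonneg_nonneg)
    also have "\<dots> \<le> 1"
      by (simp add: divide_simps add_pos_nonneg)
    finally show "(\<bar>y * x\<bar> * ?w x)\<^sup>2 \<le> 1\<^sup>2" by simp
  qed simp
  have \<psi>_le1: "norm (\<psi> x) \<le> 1" for x
    using le[of x] tw[of x] by linarith
  have \<psi>_le: "norm (\<psi> x) \<le> \<bar>y * x\<bar>" for x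
    using le[of x] mult_left_le[OF w(2)[of x], of "\<bar>y * x\<bar>"] by simp
  have \<psi>'_le: "norm (\<psi>' x) \<le> 3 * \<bar>y\<bar>" for x
    using le'[of x] mult_left_le[OF w(2)[of x], of "3 * \<bar>y\<bar>"] by simp
  have \<psi>c: "isCont \<psi> x" for x
    using \<psi> by (rule has_vector_derivative_continuous)
  have [measurable]: "\<psi> \<in> borel_measurable borel" "\<psi>' \<in> borel_measurable borel"
    using \<psi>c \<psi>' by (auto intro!: borel_measurable_continuous_onI continuous_at_imp_continuous_on)
  let ?n = "\<lambda>x. m x * \<psi> x"
  let ?n' = "\<lambda>x. m x * \<psi>' x + m' x * \<psi> x"
  have nE: "norm (?n x) \<le> E * inverse (1 + x\<^sup>2)" for x
  proof -
    have "norm (?n x) \<le> norm (m x) * 1"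
      unfolding norm_mult by (intro mult_left_mono \<psi>_le1) auto
    then show ?thesis using decay[of x] by simp
  qed
  show ?thesis
  proof (rule ft_tail_bound[of ?n ?n' y "C + 3 * B"])
    fix x :: real assume x: "x \<noteq> 0"
    show "(?n has_vector_derivative ?n' x) (at x)"
      by (rule has_vector_derivative_mult[OF deriv[OF x] \<psi>])
    show "isCont ?n' x"
      using has_vector_derivative_continuous[OF deriv[OF x]] \<psi>' \<psi>c cont_deriv[OF x]
      by (intro continuous_intros)
    have 1: "norm (m' x * \<psi> x) \<le> C / \<bar>x\<bar> * (\<bar>y * x\<bar> * ?w x)"
      unfolding norm_mult by (intro mult_mono deriv_bound[OF x] le) (use C_nonneg in auto)
    have 2: "norm (m x * \<psi>' x) \<le> B * (3 * \<bar>y\<bar> * ?w x)"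
      unfolding norm_mult by (intro mult_mono bound le') (use B_nonneg in auto)
    have "norm (?n' x) \<le> (C + 3 * B) * \<bar>y\<bar> * ?w x"
    proof -
      have "C / \<bar>x\<bar> * (\<bar>y * x\<bar> * ?w x) = C * \<bar>y\<bar> * ?w x"
        using x by (simp add: abs_mult)
      with 1 2 norm_triangle_ineq[of "m x * \<psi>' x" "m' x * \<psi> x"] show ?thesis
        by (simp add: algebra_simps)
    qed
    then have "(norm (?n' x))\<^sup>2 \<le> ((C + 3 * B) * \<bar>y\<bar> * ?w x)\<^sup>2"
      by (rule power_mono) simp
    also have "\<dots> = (C + 3 * B)\<^sup>2 * y\<^sup>2 * lorentz y x"
      by (simp only: power_mult_distrib power2_abs) (simp add: add_nonneg_nonneg)
    finally show "(norm (?n' x))\<^sup>2 \<le> (C + 3 * B)\<^sup>2 * y\<^sup>2 * lorentz y x" .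
  next
    show "integrable lborel ?n"
      by (rule integrable_cutoff[OF _ \<psi>_le1]) measurable
    show "integrable lborel ?n'"
    proof (rule integrable_lorentz_bound)
      fix x :: real assume x: "x \<noteq> 0"
      have 1: "norm (m' x * \<psi> x) \<le> E * inverse (1 + x\<^sup>2) / \<bar>x\<bar> * \<bar>y * x\<bar>"
        unfolding norm_mult by (intro mult_mono deriv_decay[OF x] \<psi>_le) (use E_nonneg in auto)
      have 2: "norm (m x * \<psi>' x) \<le> E * inverse (1 + x\<^sup>2) * (3 * \<bar>y\<bar>)"
        unfolding norm_mult by (intro mult_mono decay \<psi>'_le) (use E_nonneg in auto)
      have "E * inverse (1 + x\<^sup>2) / \<bar>x\<bar> * \<bar>y * x\<bar> = E * inverse (1 + x\<^sup>2) * \<bar>y\<bar>"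
        using x by (simp add: abs_mult)
      with 1 have 1: "norm (m' x * \<psi> x) \<le> E * inverse (1 + x\<^sup>2) * \<bar>y\<bar>"
        by simp
      have "norm (?n' x) \<le> E * inverse (1 + x\<^sup>2) * (3 * \<bar>y\<bar>) + E * inverse (1 + x\<^sup>2) * \<bar>y\<bar>"
        by (rule order_trans[OF norm_triangle_ineq add_mono[OF 2 1]])
      then show "norm (?n' x) \<le> (4 * E * \<bar>y\<bar>) * inverse (1 + x\<^sup>2)"
        by (simp add: algebra_simps)
    qed measurable
    show "(?n \<longlongrightarrow> 0) at_top" "(?n \<longlongrightarrow> 0) at_bot"
      using tendsto_bound_0[OF nE] by auto
    have "((\<lambda>x. B * \<bar>y * x\<bar>) \<longlongrightarrow> B * \<bar>y * 0\<bar>) (at 0)"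
      by (intro tendsto_intros)
    then have l0: "((\<lambda>x. B * \<bar>y * x\<bar>) \<longlongrightarrow> 0) (at 0)"
      by simp
    have "norm (?n x) \<le> B * \<bar>y * x\<bar>" for x
      unfolding norm_mult by (rule mult_mono[OF bound \<psi>_le B_nonneg]) simp
    then have "\<forall>x. norm (?n x) \<le> B * \<bar>y * x\<bar>"
      by blast
    from Lim_null_comparison[OF always_eventually[OF this] l0] show "(?n \<longlongrightarrow> 0) (at 0)" .
  qed (rule y)
qed

text \<open>With \<open>w = sqrt (lorentz y x)\<close> the factor is
  \<open>(\<bar>y * x\<bar> * w)\<^sup>2\<close>, and \<open>\<bar>y * x\<bar> * w\<close> is at
  most one; the two bounds follow from this.\<close>

lemma high_freq_tail:
  assumes y: "y \<noteq> 0"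
  shows "L1_on (ft (\<lambda>x. m x * complex_of_real (1 - lorentz y x))) {x. \<bar>y\<bar> < \<bar>x\<bar>} \<le> ennreal tail_const"
proof (rule cutoff_tail[where \<psi>'="\<lambda>x. complex_of_real (2 * y\<^sup>2 * x * (lorentz y x)\<^sup>2)"])
  fix x
  have p: "1 + (y * x)\<^sup>2 > 0" for x by (simp add: add_pos_nonneg)
  define w where "w = sqrt (lorentz y x)"
  have w2: "lorentz y x = w\<^sup>2" and w0: "w \<ge> 0" "w \<le> 1"
    using p[of x] by (auto simp: w_def inverse_le_1_iff)
  have t: "(y * x)\<^sup>2 * w\<^sup>2 + w\<^sup>2 = 1"
    using p[of x] by (simp add: w2[symmetric] field_simps)
  have tw: "\<bar>y * x\<bar> * w \<le> 1"
  proof (rule power2_le_imp_le)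
    have "(\<bar>y * x\<bar> * w)\<^sup>2 = (y * x)\<^sup>2 * w\<^sup>2"
      by (simp add: power_mult_distrib)
    then have "(\<bar>y * x\<bar> * w)\<^sup>2 \<le> 1"
      using t zero_le_power2[of w] by linarith
    then show "(\<bar>y * x\<bar> * w)\<^sup>2 \<le> 1\<^sup>2"
      by (simp only: one_power2)
  qed simp
  have "((\<lambda>x. 1 - lorentz y x) has_real_derivative 2 * y\<^sup>2 * x * (lorentz y x)\<^sup>2) (at x)"
    using p[of x] by (auto intro!: derivative_eq_intros simp: power2_eq_square)
  then show "((\<lambda>x. complex_of_real (1 - lorentz y x)) has_vector_derivative
      complex_of_real (2 * y\<^sup>2 * x * (lorentz y x)\<^sup>2)) (at x)"
    by (intro has_vector_derivative_of_real) (simp add: has_real_derivative_iff_has_vector_derivative)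
  show "isCont (\<lambda>x. complex_of_real (2 * y\<^sup>2 * x * (lorentz y x)\<^sup>2)) x"
    using p[of x] by (intro continuous_intros) auto
  have "norm (complex_of_real (1 - lorentz y x)) = (y * x)\<^sup>2 * w\<^sup>2"
  proof -
    have eq: "1 - w\<^sup>2 = (y * x)\<^sup>2 * w\<^sup>2" using t by linarith
    show ?thesis unfolding norm_of_real w2 eq by simp
  qed
  also have "\<dots> = (\<bar>y * x\<bar> * w)\<^sup>2"
    by (simp add: power_mult_distrib)
  also have "\<dots> = (\<bar>y * x\<bar> * w) * (\<bar>y * x\<bar> * w)"
    by (rule power2_eq_square)
  also have "\<dots> \<le> (\<bar>y * x\<bar> * w) * 1"
    by (rule mult_left_mono[OF tw]) (use w0 in auto)
  finally show "norm (complex_of_real (1 - lorentz y x)) \<le> \<bar>y * x\<bar> * sqrt (lorentz y x)"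
    by (simp add: w_def)
  have "norm (complex_of_real (2 * y\<^sup>2 * x * (lorentz y x)\<^sup>2)) = 2 * \<bar>y\<bar> * w * ((\<bar>y * x\<bar> * w) * w\<^sup>2)"
    unfolding norm_of_real w2 using w0 by (simp add: abs_mult power2_eq_square mult_ac)
  also have "\<dots> \<le> 2 * \<bar>y\<bar> * w * (1 * 1)"
    by (intro mult_left_mono mult_mono tw) (use w0 in \<open>auto simp: power_le_one\<close>)
  also have "\<dots> \<le> 3 * \<bar>y\<bar> * w"
    using w0 by (simp add: mult_right_mono)
  finally show "norm (complex_of_real (2 * y\<^sup>2 * x * (lorentz y x)\<^sup>2)) \<le> 3 * \<bar>y\<bar> * sqrt (lorentz y x)"
    by (simp add: w_def)
qed (rule y)

text \<open>The zero at the origin now comes from \<open>cis (- (y * x)) - 1\<close> and the decay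
  from the cutoff. Differentiating the cutoff contributes \<open>2 * \<bar>y\<bar>\<close> and
  differentiating the exponential \<open>\<bar>y\<bar>\<close>, which is the origin of the 3 in
  \<open>cutoff_tail\<close>.\<close>

lemma low_freq_tail:
  assumes y: "y \<noteq> 0"
  shows "L1_on (ft (\<lambda>x. m x * ((cis (- (y * x)) - 1) * complex_of_real (lorentz y x)))) {x. \<bar>y\<bar> < \<bar>x\<bar>} \<le> ennreal tail_const"
proof (rule cutoff_tail[where \<psi>'="\<lambda>x. (cis (- (y * x)) - 1) * complex_of_real (- (2 * y\<^sup>2 * x * (lorentz y x)\<^sup>2))
        + (- (\<i> * complex_of_real y) * cis (- (y * x))) * complex_of_real (lorentz y x)"])
  fix x
  have p: "1 + (y * x)\<^sup>2 > 0" for x by (simp add: add_pos_nonneg)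
  define w where "w = sqrt (lorentz y x)"
  have w2: "lorentz y x = w\<^sup>2" and w0: "w \<ge> 0" "w \<le> 1"
    using p[of x] by (auto simp: w_def inverse_le_1_iff)
  have t: "(y * x)\<^sup>2 * w\<^sup>2 + w\<^sup>2 = 1"
    using p[of x] by (simp add: w2[symmetric] field_simps)
  have "((\<lambda>x. lorentz y x) has_real_derivative - (2 * y\<^sup>2 * x * (lorentz y x)\<^sup>2)) (at x)"
    using p[of x] by (auto intro!: derivative_eq_intros simp: power2_eq_square)
  then have d1: "((\<lambda>x. complex_of_real (lorentz y x)) has_vector_derivative
      complex_of_real (- (2 * y\<^sup>2 * x * (lorentz y x)\<^sup>2))) (at x)"
    by (intro has_vector_derivative_of_real) (simp add: has_real_derivative_iff_has_vector_derivative)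
  have "((\<lambda>t. exp (- (\<i> * complex_of_real y) * complex_of_real t)) has_vector_derivative
        - (\<i> * complex_of_real y) * exp (- (\<i> * complex_of_real y) * complex_of_real x)) (at x)"
    by (rule has_vector_derivative_real_field[of "\<lambda>z. exp (- (\<i> * complex_of_real y) * z)"])
       (auto intro!: derivative_eq_intros)
  then have dc: "((\<lambda>x. cis (- (y * x))) has_vector_derivative - (\<i> * complex_of_real y) * cis (- (y * x))) (at x)"
    by (simp add: cis_conv_exp mult.assoc)
  then have "((\<lambda>x. cis (- (y * x)) - 1) has_vector_derivative (- (\<i> * complex_of_real y) * cis (- (y * x))) - 0) (at x)"
    by (intro has_vector_derivative_diff has_vector_derivative_const)
  then have d2: "((\<lambda>x. cis (- (y * x)) - 1) has_vector_derivative (- (\<i> * complex_of_real y) * cis (- (y * x)))) (at x)"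
    by simp
  show "((\<lambda>x. (cis (- (y * x)) - 1) * complex_of_real (lorentz y x)) has_vector_derivative
     ((cis (- (y * x)) - 1) * complex_of_real (- (2 * y\<^sup>2 * x * (lorentz y x)\<^sup>2))
        + (- (\<i> * complex_of_real y) * cis (- (y * x))) * complex_of_real (lorentz y x))) (at x)"
    by (rule has_vector_derivative_mult[OF d2 d1])
  show "isCont (\<lambda>x. (cis (- (y * x)) - 1) * complex_of_real (- (2 * y\<^sup>2 * x * (lorentz y x)\<^sup>2))
        + (- (\<i> * complex_of_real y) * cis (- (y * x))) * complex_of_real (lorentz y x)) x"
    using p[of x] has_vector_derivative_continuous[OF dc] by (intro continuous_intros) auto
  have c: "norm (cis (- (y * x)) - 1) \<le> \<bar>y * x\<bar>"
    using norm_cis_minus_1_le[of "- (y * x)"] by simp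
  have ww: "w\<^sup>2 \<le> w"
    using w0 by (simp add: power2_eq_square mult_left_le)
  have "norm ((cis (- (y * x)) - 1) * complex_of_real (lorentz y x)) \<le> \<bar>y * x\<bar> * w"
    unfolding norm_mult norm_of_real w2 by (intro mult_mono c) (use w0 ww in auto)
  then show "norm ((cis (- (y * x)) - 1) * complex_of_real (lorentz y x)) \<le> \<bar>y * x\<bar> * sqrt (lorentz y x)"
    by (simp add: w_def)
  have 1: "norm ((cis (- (y * x)) - 1) * complex_of_real (- (2 * y\<^sup>2 * x * (w\<^sup>2)\<^sup>2))) \<le> 2 * \<bar>y\<bar> * w"
  proof -
    have "norm ((cis (- (y * x)) - 1) * complex_of_real (- (2 * y\<^sup>2 * x * (w\<^sup>2)\<^sup>2)))
        \<le> \<bar>y * x\<bar> * \<bar>- (2 * y\<^sup>2 * x * (w\<^sup>2)\<^sup>2)\<bar>"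
      unfolding norm_mult norm_of_real by (intro mult_right_mono c) auto
    also have "\<dots> = 2 * \<bar>y\<bar> * (((y * x)\<^sup>2 * w\<^sup>2) * w\<^sup>2)"
    proof -
      have "\<bar>y * x\<bar> * \<bar>- (2 * y\<^sup>2 * x * (w\<^sup>2)\<^sup>2)\<bar> = 2 * (\<bar>y\<bar> * (\<bar>y\<bar> * \<bar>y\<bar> * (\<bar>x\<bar> * \<bar>x\<bar>) * (w\<^sup>2)\<^sup>2))"
        by (simp add: abs_mult power2_eq_square mult_ac)
      then show ?thesis
        by (simp add: abs_mult_self_eq power2_eq_square mult_ac)
    qed
    also have "\<dots> \<le> 2 * \<bar>y\<bar> * (1 * w)"
    proof (intro mult_left_mono mult_mono)
      show "(y * x)\<^sup>2 * w\<^sup>2 \<le> 1" using t zero_le_power2[of w] by linarith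
    qed (use ww w0 in auto)
    finally show ?thesis by simp
  qed
  have 2: "norm ((- (\<i> * complex_of_real y) * cis (- (y * x))) * complex_of_real (w\<^sup>2)) \<le> \<bar>y\<bar> * w"
    unfolding norm_mult norm_of_real using ww by (simp add: norm_mult mult_left_mono)
  show "norm ((cis (- (y * x)) - 1) * complex_of_real (- (2 * y\<^sup>2 * x * (lorentz y x)\<^sup>2))
        + (- (\<i> * complex_of_real y) * cis (- (y * x))) * complex_of_real (lorentz y x))
     \<le> 3 * \<bar>y\<bar> * sqrt (lorentz y x)"
    unfolding w_def[symmetric] unfolding w2 using 1 2 by (intro order_trans[OF norm_triangle_ineq]) linarith
qed (rule y)

lemma hormander:
  "L1_on (\<lambda>x. kernel m (x - y) - kernel m x) {x. 2 * \<bar>y\<bar> < \<bar>x\<bar>} \<le> ennreal (3 * tail_const)"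
proof (cases "y = 0")
  case False
  let ?h = "\<lambda>x. m x * complex_of_real (1 - lorentz y x)"
  let ?l = "\<lambda>x. m x * ((cis (- (y * x)) - 1) * complex_of_real (lorentz y x))"
  have p: "1 + (y * x)\<^sup>2 \<ge> 1" for x by simp
  have inv: "0 \<le> lorentz y x" "lorentz y x \<le> 1" for x
    using p[of x] by (auto simp: inverse_le_1_iff)
  have hi: "integrable lborel ?h"
    by (rule integrable_cutoff[of _ 1]) (measurable, use inv in \<open>simp del: of_real_diff of_real_inverse\<close>)
  have li: "integrable lborel ?l"
  proof (rule integrable_cutoff[of _ 2])
    fix x
    have "norm (cis (- (y * x)) - 1) \<le> 2"
      using norm_triangle_ineq4[of "cis (- (y * x))" 1] by simp
    then have "norm (cis (- (y * x)) - 1) * norm (complex_of_real (lorentz y x)) \<le> 2 * 1"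
      using inv[of x] by (intro mult_mono) (auto simp only: norm_of_real abs_of_nonneg norm_ge_zero)
    then show "norm ((cis (- (y * x)) - 1) * complex_of_real (lorentz y x)) \<le> 2"
      by (simp only: norm_mult)
  qed measurable
  have hm: "integrable lborel (\<lambda>x. ?h x * cis (- y * x))"
    by (rule integrable_mult_bounded[OF hi, of _ 1]) auto
  \<comment> \<open>The low-frequency part keeps the difference inside one symbol; in the
    high-frequency part the two translates appear separately.\<close>
  have diff: "ft m (y - x) - ft m (- x) = ft ?l (- x) + (ft ?h (y - x) - ft ?h (- x))" for x
  proof -
    have mm: "integrable lborel (\<lambda>x. m x * cis (- y * x))"
      by (rule integrable_mult_bounded[OF integrable, of _ 1]) auto
    have "ft m (y - x) - ft m (- x) = ft (\<lambda>t. m t * cis (- y * t) - m t) (- x)"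
      by (subst ft_diff[OF mm integrable], subst ft_modulate) (simp add: add.commute)
    also have "(\<lambda>t. m t * cis (- y * t) - m t) = (\<lambda>t. ?l t + (?h t * cis (- y * t) - ?h t))"
      by (auto simp: algebra_simps)
    also have "ft \<dots> (- x) = ft ?l (- x) + (ft (\<lambda>t. ?h t * cis (- y * t)) (- x) - ft ?h (- x))"
      by (subst ft_add[OF li Bochner_Integration.integrable_diff[OF hm hi]], subst ft_diff[OF hm hi]) simp
    also have "ft (\<lambda>t. ?h t * cis (- y * t)) (- x) = ft ?h (y - x)"
      by (subst ft_modulate) (simp add: add.commute)
    finally show ?thesis .
  qed
  have [measurable]: "?h \<in> borel_measurable borel" "?l \<in> borel_measurable borel"
    using hi li by auto
  let ?I = "\<lambda>x. indicator {x. \<bar>y\<bar> < \<bar>x\<bar>} x :: ennreal"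
  have "L1_on (\<lambda>x. kernel m (x - y) - kernel m x) {x. 2 * \<bar>y\<bar> < \<bar>x\<bar>}
      \<le> (\<integral>\<^sup>+x. ennreal (norm (ft ?l (0 + - 1 * x))) * ?I (0 + - 1 * x) + (ennreal (norm (ft ?h (y + - 1 * x))) * ?I (y + - 1 * x)
          + ennreal (norm (ft ?h (0 + - 1 * x))) * ?I (0 + - 1 * x)) \<partial>lborel)"
  proof (rule nn_integral_mono)
    fix x
    have "norm (kernel m (x - y) - kernel m x) = norm (complex_of_real (1 / (2 * pi)) * (ft m (y - x) - ft m (- x)))"
      by (simp add: kernel_def right_diff_distrib)
    also have "\<dots> \<le> norm (ft m (y - x) - ft m (- x))"
      by (rule norm_inverse_2pi_mult_le)
    also have "\<dots> \<le> norm (ft ?l (- x)) + (norm (ft ?h (y - x)) + norm (ft ?h (- x)))"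
      unfolding diff by (intro order_trans[OF norm_triangle_ineq] add_left_mono norm_triangle_ineq4)
    finally have "ennreal (norm (kernel m (x - y) - kernel m x)) \<le>
        ennreal (norm (ft ?l (- x))) + (ennreal (norm (ft ?h (y - x))) + ennreal (norm (ft ?h (- x))))"
      by (simp add: ennreal_plus[symmetric] del: ennreal_plus)
    note * = this
    show "ennreal (norm (kernel m (x - y) - kernel m x)) * indicator {x. 2 * \<bar>y\<bar> < \<bar>x\<bar>} x
       \<le> ennreal (norm (ft ?l (0 + - 1 * x))) * ?I (0 + - 1 * x) + (ennreal (norm (ft ?h (y + - 1 * x))) * ?I (y + - 1 * x)
          + ennreal (norm (ft ?h (0 + - 1 * x))) * ?I (0 + - 1 * x))"
    proof (cases "2 * \<bar>y\<bar> < \<bar>x\<bar>")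
      case True
      \<comment> \<open>A point beyond \<open>2 * \<bar>y\<bar>\<close>, shifted by
        \<open>y\<close>, is still beyond \<open>\<bar>y\<bar>\<close>, where the tail estimates
        hold.\<close>
      then have "\<bar>y\<bar> < \<bar>0 + - 1 * x\<bar>" "\<bar>y\<bar> < \<bar>y + - 1 * x\<bar>"
        by linarith+
      then have i: "?I (0 + - 1 * x) = 1" "?I (y + - 1 * x) = 1" "indicator {x. 2 * \<bar>y\<bar> < \<bar>x\<bar>} x = (1 :: ennreal)"
        using True by (simp_all only: indicator_def mem_Collect_eq if_True of_bool_eq)
      show ?thesis
        unfolding i mult_1_right using * by simp
    qed simp
  qed
  also have "\<dots> = (\<integral>\<^sup>+x. ennreal (norm (ft ?l (0 + - 1 * x))) * ?I (0 + - 1 * x) \<partial>lborel)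
      + ((\<integral>\<^sup>+x. ennreal (norm (ft ?h (y + - 1 * x))) * ?I (y + - 1 * x) \<partial>lborel)
      + (\<integral>\<^sup>+x. ennreal (norm (ft ?h (0 + - 1 * x))) * ?I (0 + - 1 * x) \<partial>lborel))"
    by (simp add: nn_integral_add)
  also have "\<dots> \<le> ennreal tail_const + (ennreal tail_const + ennreal tail_const)"
  proof (intro add_mono)
    have aff: "(\<integral>\<^sup>+x. g (t + - 1 * x) \<partial>lborel) = (\<integral>\<^sup>+x. g x \<partial>lborel)" if [measurable]: "g \<in> borel_measurable borel" for g :: "real \<Rightarrow> ennreal" and t
      using nn_integral_real_affine[OF that, of "-1" t] by simp
    show "(\<integral>\<^sup>+x. ennreal (norm (ft ?l (0 + - 1 * x))) * ?I (0 + - 1 * x) \<partial>lborel) \<le> ennreal tail_const"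
      using low_freq_tail[OF False] by (subst aff[of "\<lambda>x. ennreal (norm (ft ?l x)) * ?I x"]) auto
    have h: "(\<integral>\<^sup>+x. ennreal (norm (ft ?h (t + - 1 * x))) * ?I (t + - 1 * x) \<partial>lborel) \<le> ennreal tail_const" for t
      using high_freq_tail[OF False] by (subst aff[of "\<lambda>x. ennreal (norm (ft ?h x)) * ?I x"]) auto
    show "(\<integral>\<^sup>+x. ennreal (norm (ft ?h (y + - 1 * x))) * ?I (y + - 1 * x) \<partial>lborel) \<le> ennreal tail_const"
      by (rule h)
    show "(\<integral>\<^sup>+x. ennreal (norm (ft ?h (0 + - 1 * x))) * ?I (0 + - 1 * x) \<partial>lborel) \<le> ennreal tail_const"
      by (rule h)
  qed
  also have "\<dots> = ennreal (3 * tail_const)"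
    by (simp add: ennreal_plus[symmetric] del: ennreal_plus)
  finally show ?thesis .
qed simp

section \<open>The Calderon-Zygmund decomposition\<close>

text \<open>One \<open>tail_const\<close> for the low frequencies and one for each of the two
  translates of the high-frequency part.\<close>

abbreviation horm_const :: real where
  "horm_const \<equiv> 3 * tail_const"

text \<open>
  \<open>g\<close> and \<open>b\<close> are the good and the bad part of \<open>f\<close> on \<open>J\<close> at height \<open>l\<close>, \<open>w\<close> is the total length of
  the selected intervals and \<open>\<Omega>\<close> the union of their doubles. Every clause is additive over disjoint \<open>J\<close>,
  so the family of selected intervals never has to be mentioned.
\<close>

definition cz :: "(real \<Rightarrow> complex) \<Rightarrow> real \<Rightarrow> real set \<Rightarrow> (real \<Rightarrow> complex) \<Rightarrow> (real \<Rightarrow> complex) \<Rightarrow> real set \<Rightarrow> real \<Rightarrow> bool" where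
  "cz f l J g b \<Omega> w \<longleftrightarrow> bounded_support g \<and> bounded_support b \<and> \<Omega> \<in> sets borel \<and> w \<ge> 0 \<and>
    (\<forall>x. g x + b x = f x * indicator J x) \<and> (\<forall>x. x \<notin> J \<longrightarrow> g x = 0) \<and>
    Lr_int 2 g \<le> L2_on f {x \<in> J. norm (f x) \<le> l} + ennreal (4 * l\<^sup>2 * w) \<and>
    emeasure lborel \<Omega> \<le> ennreal (2 * w) \<and>
    L1_on (mult1 m b) (- \<Omega>) \<le> ennreal (4 * horm_const * l * w) \<and>
    ennreal w \<le> ennreal (2 / l) * L1_on f {x \<in> J. norm (f x) > l / 2}"

lemma horm_const_nonneg: "horm_const \<ge> 0"
  by simp

lemma kernel_integrand: "integrable lborel f \<Longrightarrow> integrable lborel (\<lambda>y. f y * kernel m (x - y))"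
  by (rule integrable_mult_bounded[OF _ _ kernel_bound]) measurable

lemma mult1_add:
  assumes "integrable lborel f" "integrable lborel g"
  shows "mult1 m (\<lambda>x. f x + g x) x = mult1 m f x + mult1 m g x"
  using assms by (simp add: mult1_kernel[OF integrable] distrib_right kernel_integrand)

lemma mult1_diff:
  assumes "integrable lborel f" "integrable lborel g"
  shows "mult1 m (\<lambda>x. f x - g x) x = mult1 m f x - mult1 m g x"
  using assms by (simp add: mult1_kernel[OF integrable] left_diff_distrib kernel_integrand)

text \<open>Vanishing mean allows \<open>kernel m (x - c)\<close> to be subtracted under the
  integral. Outside the doubled interval \<open>\<bar>x - c\<bar>\<close> exceeds \<open>L\<close>,
  hence \<open>2 * \<bar>y - c\<bar>\<close>, so that \<open>hormander\<close> applies for each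
  \<open>y\<close> after the integrals are exchanged.\<close>

lemma mult1_mean_zero:
  assumes b: "bounded_support b" and L: "L > 0" and supp: "\<And>y. b y \<noteq> 0 \<Longrightarrow> 2 * \<bar>y - c\<bar> \<le> L"
    and mean: "(LINT y|lborel. b y) = 0"
  shows "L1_on (mult1 m b) (- {c - L..c + L}) \<le> ennreal horm_const * Lr_int 1 b"
proof -
  have bi: "integrable lborel b" using b by (rule bounded_support_integrable)
  have [measurable]: "b \<in> borel_measurable borel" using b by (simp add: bounded_support_def)
  let ?K = "kernel m"
  let ?I = "\<lambda>x. indicator (- {c - L..c + L}) x :: ennreal"
  note Ki = kernel_integrand[OF bi]
  have T: "mult1 m b x = (LINT y|lborel. b y * (?K (x - y) - ?K (x - c)))" for x
  proof -
    have "(LINT y|lborel. b y * (?K (x - y) - ?K (x - c))) = (LINT y|lborel. b y * ?K (x - y)) - (LINT y|lborel. b y * ?K (x - c))"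
      unfolding right_diff_distrib by (intro Bochner_Integration.integral_diff Ki integrable_mult_left bi)
    then show ?thesis
      by (simp add: mult1_kernel[OF integrable bi] mean)
  qed
  have "(\<integral>\<^sup>+x. ennreal (norm (mult1 m b x)) * ?I x \<partial>lborel)
      \<le> (\<integral>\<^sup>+x. \<integral>\<^sup>+y. ennreal (norm (b y)) * (ennreal (norm (?K (x - y) - ?K (x - c))) * ?I x) \<partial>lborel \<partial>lborel)"
  proof (rule nn_integral_mono)
    fix x
    have "integrable lborel (\<lambda>y. b y * (?K (x - y) - ?K (x - c)))"
      unfolding right_diff_distrib by (intro Bochner_Integration.integrable_diff Ki integrable_mult_left bi)
    from integral_norm_bound_ennreal[OF this]
    have "ennreal (norm (mult1 m b x)) * ?I x \<le> (\<integral>\<^sup>+y. ennreal (norm (b y * (?K (x - y) - ?K (x - c)))) \<partial>lborel) * ?I x"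
      unfolding T by (rule mult_right_mono) simp
    also have "\<dots> = (\<integral>\<^sup>+y. ennreal (norm (b y)) * (ennreal (norm (?K (x - y) - ?K (x - c))) * ?I x) \<partial>lborel)"
      by (subst nn_integral_multc[symmetric]) (auto simp: norm_mult ennreal_mult mult.assoc)
    finally show "ennreal (norm (mult1 m b x)) * ?I x \<le> \<dots>" .
  qed
  also have "\<dots> = (\<integral>\<^sup>+y. \<integral>\<^sup>+x. ennreal (norm (b y)) * (ennreal (norm (?K (x - y) - ?K (x - c))) * ?I x) \<partial>lborel \<partial>lborel)"
    by (rule lborel_pair.Fubini') measurable
  also have "\<dots> \<le> (\<integral>\<^sup>+y. ennreal horm_const * ennreal (norm (b y)) \<partial>lborel)"
  proof (rule nn_integral_mono)
    fix y
    have "(\<integral>\<^sup>+x. ennreal (norm (b y)) * (ennreal (norm (?K (x - y) - ?K (x - c))) * ?I x) \<partial>lborel)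
        = ennreal (norm (b y)) * (\<integral>\<^sup>+x. ennreal (norm (?K (x - y) - ?K (x - c))) * ?I x \<partial>lborel)"
      by (rule nn_integral_cmult) measurable
    also have "\<dots> \<le> ennreal (norm (b y)) * ennreal horm_const"
    proof (cases "b y = 0")
      case False
      have le: "2 * \<bar>y - c\<bar> \<le> L" by (rule supp[OF False])
      have "(\<integral>\<^sup>+x. ennreal (norm (?K (x - y) - ?K (x - c))) * ?I x \<partial>lborel)
          \<le> (\<integral>\<^sup>+x. ennreal (norm (?K (x - y) - ?K (x - c))) * indicator {x. 2 * \<bar>y - c\<bar> < \<bar>x\<bar>} (x - c) \<partial>lborel)"
        using le by (intro nn_integral_mono mult_left_mono) (auto simp: indicator_def)
      also have "\<dots> = (\<integral>\<^sup>+x. ennreal (norm (?K ((c + 1 * x) - y) - ?K ((c + 1 * x) - c))) * indicator {x. 2 * \<bar>y - c\<bar> < \<bar>x\<bar>} ((c + 1 * x) - c) \<partial>lborel)"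
        by (subst nn_integral_real_affine[of _ 1 c]) simp_all
      also have "\<dots> = L1_on (\<lambda>x. ?K (x - (y - c)) - ?K x) {x. 2 * \<bar>y - c\<bar> < \<bar>x\<bar>}"
        by (simp add: algebra_simps)
      also have "\<dots> \<le> ennreal horm_const"
        by (rule hormander)
      finally show ?thesis by (intro mult_left_mono) auto
    qed simp
    finally show "(\<integral>\<^sup>+x. ennreal (norm (b y)) * (ennreal (norm (?K (x - y) - ?K (x - c))) * ?I x) \<partial>lborel) \<le> ennreal horm_const * ennreal (norm (b y))"
      by (simp add: mult.commute)
  qed
  also have "\<dots> = ennreal horm_const * Lr_int 1 b"
    by (simp add: nn_integral_cmult Lr_int_1)
  finally show ?thesis .
qed

text \<open>The selection rule: the average of \<open>norm (f x)\<close> exceeds \<open>l\<close>,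
  but is at most \<open>2 * l\<close> because the interval is half of one with average at most
  \<open>l\<close>. The good part is the mean of \<open>f\<close>, and the bad part has mean
  zero.\<close>

lemma cz_select:
  assumes f: "bounded_support f" and l: "l > 0" and L: "L > 0"
    and big: "ennreal (l * L) < L1_on f {a..<a + L}"
    and le: "L1_on f {a..<a + L} \<le> ennreal (2 * l * L)"
  shows "\<exists>g b \<Omega> w. cz f l {a..<a + L} g b \<Omega> w"
proof -
  let ?J = "{a..<a + L}"
  have [measurable]: "f \<in> borel_measurable borel" using f by (simp add: bounded_support_def)
  obtain B0 where B0: "B0 > 0" and fB0: "\<And>x. norm (f x) \<le> B0"
    using bounded_supportE[OF f] by metis
  define J where "J x = complex_of_real (indicator ?J x)" for x
  have [measurable]: "J \<in> borel_measurable borel" unfolding J_def by measurable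
  have J_supp: "x \<notin> {- (\<bar>a\<bar> + L)..\<bar>a\<bar> + L} \<Longrightarrow> J x = 0" for x
    using L by (auto simp: J_def indicator_def)
  have Jn: "norm (J x) \<le> 1" for x by (simp add: J_def indicator_def)
  have fJ: "bounded_support (\<lambda>x. f x * J x)"
  proof (rule bounded_supportI[of _ B0 "\<bar>a\<bar> + L"])
    show "norm (f x * J x) \<le> B0" for x
      using fB0[of x] B0 by (simp add: J_def indicator_def norm_mult)
  qed (use J_supp in auto)
  define A where "A = (1 / L) *\<^sub>R (LINT x|lborel. f x * J x)"
  define g where "g x = A * J x" for x
  define b where "b x = f x * J x - A * J x" for x
  have gs: "bounded_support g"
  proof (rule bounded_supportI[of _ "norm A" "\<bar>a\<bar> + L"])
    show "norm (g x) \<le> norm A" for x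
      by (simp add: g_def J_def indicator_def norm_mult)
  qed (use J_supp in \<open>auto simp: g_def[abs_def]\<close>)
  have bs: "bounded_support b"
  proof (rule bounded_supportI[of _ "B0 + norm A" "\<bar>a\<bar> + L"])
    show "norm (b x) \<le> B0 + norm A" for x
      using fB0[of x] B0 norm_triangle_ineq4[of "f x" A] by (auto simp: b_def J_def indicator_def)
  qed (use J_supp in \<open>auto simp: b_def[abs_def]\<close>)
  have X1: "Lr_int 1 (\<lambda>x. f x * J x) = L1_on f ?J"
    unfolding Lr_int_1 by (intro nn_integral_cong) (auto simp: J_def indicator_def)
  have J1: "(\<integral>\<^sup>+x. ennreal (norm (J x)) \<partial>lborel) = ennreal L"
  proof -
    have "(\<integral>\<^sup>+x. ennreal (norm (J x)) \<partial>lborel) = (\<integral>\<^sup>+x. indicator ?J x \<partial>lborel)"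
      by (intro nn_integral_cong) (auto simp: J_def indicator_def)
    then show ?thesis using L by simp
  qed
  have A_le: "norm A \<le> 2 * l"
  proof -
    have "ennreal (norm (LINT x|lborel. f x * J x)) \<le> Lr_int 1 (\<lambda>x. f x * J x)"
      unfolding Lr_int_1 by (rule integral_norm_bound_ennreal[OF bounded_support_integrable[OF fJ]])
    also have "\<dots> \<le> ennreal (2 * l * L)" unfolding X1 by (rule le)
    finally have "norm (LINT x|lborel. f x * J x) \<le> 2 * l * L"
      using l L by simp
    then show ?thesis using L by (simp add: A_def field_simps)
  qed
  have Ji: "integrable lborel J"
    using J1 by (intro integrableI_bounded) auto
  have mean: "(LINT x|lborel. b x) = 0"
  proof -
    have "(LINT x|lborel. b x) = (LINT x|lborel. f x * J x) - A * (LINT x|lborel. J x)"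
      unfolding b_def using bounded_support_integrable[OF fJ] Ji by simp
    also have "(LINT x|lborel. J x) = complex_of_real L"
      unfolding J_def integral_complex_of_real using L by (simp add: measure_def)
    finally show ?thesis using L by (simp add: A_def scaleR_conv_of_real)
  qed
  \<comment> \<open>\<open>2 * l * L\<close> from \<open>f\<close>, and as much again from its
    mean.\<close>
  have b1: "Lr_int 1 b \<le> ennreal (4 * l * L)"
  proof -
    have "Lr_int 1 b \<le> (\<integral>\<^sup>+x. ennreal (norm (f x * J x)) + ennreal (norm A) * ennreal (norm (J x)) \<partial>lborel)"
      unfolding Lr_int_1 b_def
      by (intro nn_integral_mono) (simp add: ennreal_mult[symmetric] ennreal_plus[symmetric] norm_mult[symmetric] norm_triangle_ineq4 del: ennreal_plus)
    also have "\<dots> = Lr_int 1 (\<lambda>x. f x * J x) + ennreal (norm A) * ennreal L"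
      by (simp add: nn_integral_add nn_integral_cmult Lr_int_1 J1)
    also have "\<dots> \<le> ennreal (2 * l * L) + ennreal (2 * l) * ennreal L"
      unfolding X1 using A_le by (intro add_mono le mult_right_mono ennreal_leI) auto
    also have "\<dots> = ennreal (4 * l * L)"
      using l L by (simp add: ennreal_mult[symmetric] ennreal_plus[symmetric] del: ennreal_plus)
    finally show ?thesis .
  qed
  define c where "c = a + L / 2"
  have supp: "2 * \<bar>y - c\<bar> \<le> L" if "b y \<noteq> 0" for y
  proof -
    have "y \<in> ?J"
      using that by (auto simp: b_def J_def indicator_def split: if_splits)
    then have "y - c \<le> L / 2" "- (y - c) \<le> L / 2" by (auto simp: c_def)
    then have "\<bar>y - c\<bar> \<le> L / 2" by (rule abs_leI)
    then show ?thesis by simp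
  qed
  \<comment> \<open>\<open>\<Omega>\<close> is the concentric interval of twice the length, and
    \<open>w\<close> the length itself.\<close>
  have "cz f l ?J g b {c - L..c + L} L"
    unfolding cz_def
  proof (intro conjI allI impI gs bs)
    show "g x + b x = f x * indicator ?J x" for x
      by (simp add: g_def b_def J_def indicator_def)
    show "g x = 0" if "x \<notin> ?J" for x
      using that by (simp add: g_def J_def)
    have "Lr_int 2 g = (\<integral>\<^sup>+x. ennreal ((norm A)\<^sup>2) * indicator ?J x \<partial>lborel)"
      unfolding Lr_int_2 by (intro nn_integral_cong) (auto simp: g_def J_def indicator_def norm_mult)
    also have "\<dots> = ennreal ((norm A)\<^sup>2 * L)"
      using L by (simp add: nn_integral_cmult_indicator ennreal_mult)
    also have "\<dots> \<le> ennreal (4 * l\<^sup>2 * L)"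
      using power_mono[OF A_le, of 2] L by (intro ennreal_leI mult_right_mono) (auto simp: power_mult_distrib)
    finally show "Lr_int 2 g \<le> L2_on f {x \<in> ?J. norm (f x) \<le> l} + ennreal (4 * l\<^sup>2 * L)"
      by (simp add: add_increasing)
    show "emeasure lborel {c - L..c + L} \<le> ennreal (2 * L)"
      using L by simp
    have "L1_on (mult1 m b) (- {c - L..c + L}) \<le> ennreal horm_const * Lr_int 1 b"
      by (rule mult1_mean_zero[OF bs L supp mean])
    also have "\<dots> \<le> ennreal horm_const * ennreal (4 * l * L)"
      by (intro mult_left_mono b1) simp
    also have "\<dots> = ennreal (horm_const * (4 * l * L))"
      using l L by (intro ennreal_mult[symmetric] horm_const_nonneg) auto
    also have "horm_const * (4 * l * L) = 4 * horm_const * l * L"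
      by (simp only: mult_ac)
    finally show "L1_on (mult1 m b) (- {c - L..c + L}) \<le> ennreal (4 * horm_const * l * L)" .
    let ?X = "\<integral>\<^sup>+x. ennreal (norm (f x)) * indicator {x \<in> ?J. norm (f x) > l / 2} x \<partial>lborel"
    \<comment> \<open>Points with \<open>norm (f x) \<le> l / 2\<close> account for at most
      \<open>l / 2 * L\<close> of a mass above \<open>l * L\<close>, so at least
      \<open>l / 2 * L\<close> is left where \<open>norm (f x) > l / 2\<close>.\<close>
    have "L1_on f ?J
        \<le> (\<integral>\<^sup>+x. ennreal (norm (f x)) * indicator {x \<in> ?J. norm (f x) > l / 2} x + ennreal (l / 2) * indicator ?J x \<partial>lborel)"
      by (intro nn_integral_mono) (auto simp: indicator_def intro!: ennreal_leI)
    also have "\<dots> = ?X + ennreal (l / 2 * L)"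
      using L l by (subst nn_integral_add) (auto simp: nn_integral_cmult_indicator ennreal_mult[symmetric])
    finally have "ennreal (l * L) < ?X + ennreal (l / 2 * L)"
      using big by (rule order.strict_trans2[rotated])
    moreover have "?X < \<infinity>"
    proof -
      have "?X \<le> L1_on f ?J"
        by (intro nn_integral_mono) (auto simp: indicator_def)
      also have "\<dots> < \<infinity>" using le by (auto intro: order.strict_trans1)
      finally show ?thesis .
    qed
    ultimately obtain X where X: "?X = ennreal X" "X \<ge> 0" "ennreal (l * L) < ennreal X + ennreal (l / 2 * L)"
      by (cases ?X) auto
    then have "l * L < X + l / 2 * L"
      using l L by (simp add: ennreal_plus[symmetric] ennreal_less_iff del: ennreal_plus)
    then have "L \<le> 2 / l * X"
      using l by (simp add: field_simps)
    then show "ennreal L \<le> ennreal (2 / l) * ?X"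
      unfolding X(1) using l X(2) by (simp add: ennreal_mult[symmetric])
  qed (use L in auto)
  then show ?thesis by blast
qed

text \<open>No interval is selected: where \<open>f\<close> stays below the height it is its own
  good part.\<close>

lemma cz_cell:
  assumes f: "bounded_support f" and l: "l > 0" and J [measurable]: "J \<in> sets borel" and le: "\<And>x. x \<in> J \<Longrightarrow> norm (f x) \<le> l"
  shows "\<exists>g b \<Omega> w. cz f l J g b \<Omega> w"
proof -
  have [measurable]: "f \<in> borel_measurable borel" using f by (simp add: bounded_support_def)
  obtain B0 R where B0: "\<And>x. norm (f x) \<le> B0 * indicator {-R..R} x"
    using bounded_supportE[OF f] by metis
  let ?g = "\<lambda>x. f x * indicator J x"
  have g: "bounded_support ?g"
    unfolding bounded_support_def
  proof (intro conjI exI allI)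
    show "norm (?g x) \<le> B0 * indicator {-R..R} x" for x
      using B0[of x] by (auto simp: indicator_def norm_mult split: if_splits intro: order_trans[OF norm_ge_zero])
  qed measurable
  have "cz f l J ?g (\<lambda>x. 0) {} 0"
    unfolding cz_def
  proof (intro conjI allI impI g)
    show "bounded_support (\<lambda>x. 0)"
      by (rule bounded_supportI[of _ 0 0]) auto
    have "mult1 m (\<lambda>x. 0) x = 0" for x
      by (simp add: mult1_def ft_def)
    then show "L1_on (\<lambda>x. mult1 m (\<lambda>x. 0) x) (- {}) \<le> ennreal (4 * horm_const * l * 0)"
      by simp
    show "Lr_int 2 ?g \<le> L2_on f {x \<in> J. norm (f x) \<le> l} + ennreal (4 * l\<^sup>2 * 0)"
      unfolding Lr_int_2 using le by (auto intro!: nn_integral_mono simp: indicator_def norm_mult)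
  qed auto
  then show ?thesis by blast
qed

lemma cz_merge:
  assumes f: "bounded_support f" and l: "l > 0" and dis: "I \<inter> J = {}" and [measurable]: "I \<in> sets borel" "J \<in> sets borel"
    and 1: "\<exists>g b \<Omega> w. cz f l I g b \<Omega> w" and 2: "\<exists>g b \<Omega> w. cz f l J g b \<Omega> w"
  shows "\<exists>g b \<Omega> w. cz f l (I \<union> J) g b \<Omega> w"
proof -
  have [measurable]: "f \<in> borel_measurable borel" using f by (simp add: bounded_support_def)
  obtain g1 b1 W1 w1 where c1: "cz f l I g1 b1 W1 w1" using 1 by blast
  obtain g2 b2 W2 w2 where c2: "cz f l J g2 b2 W2 w2" using 2 by blast
  note c = c1[unfolded cz_def] c2[unfolded cz_def]
  have [measurable]: "g1 \<in> borel_measurable borel" "g2 \<in> borel_measurable borel"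
      "b1 \<in> borel_measurable borel" "b2 \<in> borel_measurable borel" "W1 \<in> sets borel" "W2 \<in> sets borel"
    using c by (auto simp: bounded_support_def)
  have w: "w1 \<ge> 0" "w2 \<ge> 0" using c by auto
  have ind: "indicator {x \<in> I \<union> J. P x} x = (indicator {x \<in> I. P x} x + indicator {x \<in> J. P x} x :: ennreal)" for P x
    using dis by (auto simp: indicator_def)
  have "cz f l (I \<union> J) (\<lambda>x. g1 x + g2 x) (\<lambda>x. b1 x + b2 x) (W1 \<union> W2) (w1 + w2)"
    unfolding cz_def
  proof (intro conjI allI impI bounded_support_add)
    fix x
    have "(g1 x + b1 x) + (g2 x + b2 x) = f x * indicator I x + f x * indicator J x"
      using c by simp
    also have "\<dots> = f x * indicator (I \<union> J) x"
      using dis by (auto simp: indicator_def)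
    finally show "g1 x + g2 x + (b1 x + b2 x) = f x * indicator (I \<union> J) x"
      by (simp add: algebra_simps)
  next
    have "Lr_int 2 (\<lambda>x. g1 x + g2 x) \<le> (\<integral>\<^sup>+x. ennreal ((norm (g1 x))\<^sup>2) + ennreal ((norm (g2 x))\<^sup>2) \<partial>lborel)"
      unfolding Lr_int_2
    proof (intro nn_integral_mono)
      fix x
      \<comment> \<open>Disjoint supports: the squares add without cross terms, so the constant does
        not grow with the number of intervals.\<close>
      have "g1 x = 0 \<or> g2 x = 0" using c dis by blast
      then show "ennreal ((norm (g1 x + g2 x))\<^sup>2) \<le> ennreal ((norm (g1 x))\<^sup>2) + ennreal ((norm (g2 x))\<^sup>2)"
        by auto
    qed
    also have "\<dots> = Lr_int 2 g1 + Lr_int 2 g2"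
      by (simp add: nn_integral_add Lr_int_2)
    also have "\<dots> \<le> (L2_on f {x \<in> I. norm (f x) \<le> l} + ennreal (4 * l\<^sup>2 * w1))
        + (L2_on f {x \<in> J. norm (f x) \<le> l} + ennreal (4 * l\<^sup>2 * w2))"
      using c by (intro add_mono) auto
    also have "\<dots> = (L2_on f {x \<in> I. norm (f x) \<le> l}
        + L2_on f {x \<in> J. norm (f x) \<le> l}) + (ennreal (4 * l\<^sup>2 * w1) + ennreal (4 * l\<^sup>2 * w2))"
      by (simp only: ac_simps)
    also have "ennreal (4 * l\<^sup>2 * w1) + ennreal (4 * l\<^sup>2 * w2) = ennreal (4 * l\<^sup>2 * (w1 + w2))"
      using w by (simp add: distrib_left ennreal_plus[symmetric] del: ennreal_plus)
    also have "L2_on f {x \<in> I. norm (f x) \<le> l}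
        + L2_on f {x \<in> J. norm (f x) \<le> l}
        = L2_on f {x \<in> I \<union> J. norm (f x) \<le> l}"
      unfolding ind distrib_left by (rule nn_integral_add[symmetric]) measurable
    finally show "Lr_int 2 (\<lambda>x. g1 x + g2 x) \<le> L2_on f {x \<in> I \<union> J. norm (f x) \<le> l} + ennreal (4 * l\<^sup>2 * (w1 + w2))" .
  next
    have "emeasure lborel (W1 \<union> W2) \<le> emeasure lborel W1 + emeasure lborel W2"
      by (rule emeasure_subadditive) auto
    also have "\<dots> \<le> ennreal (2 * w1) + ennreal (2 * w2)"
      using c by (intro add_mono) auto
    also have "\<dots> = ennreal (2 * (w1 + w2))"
      using w by (simp add: distrib_left ennreal_plus[symmetric] del: ennreal_plus)
    finally show "emeasure lborel (W1 \<union> W2) \<le> ennreal (2 * (w1 + w2))" .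
  next
    have bi: "integrable lborel b1" "integrable lborel b2"
      using c by (auto intro: bounded_support_integrable)
    have "L1_on (mult1 m (\<lambda>x. b1 x + b2 x)) (- (W1 \<union> W2))
        \<le> (\<integral>\<^sup>+x. ennreal (norm (mult1 m b1 x)) * indicator (- W1) x + ennreal (norm (mult1 m b2 x)) * indicator (- W2) x \<partial>lborel)"
    proof (intro nn_integral_mono)
      fix x
      have "ennreal (norm (mult1 m (\<lambda>x. b1 x + b2 x) x)) \<le> ennreal (norm (mult1 m b1 x)) + ennreal (norm (mult1 m b2 x))"
        unfolding mult1_add[OF bi] by (simp add: ennreal_plus[symmetric] norm_triangle_ineq del: ennreal_plus)
      then show "ennreal (norm (mult1 m (\<lambda>x. b1 x + b2 x) x)) * indicator (- (W1 \<union> W2)) x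
          \<le> ennreal (norm (mult1 m b1 x)) * indicator (- W1) x + ennreal (norm (mult1 m b2 x)) * indicator (- W2) x"
        by (auto simp: indicator_def)
    qed
    also have "\<dots> = L1_on (mult1 m b1) (- W1) + L1_on (mult1 m b2) (- W2)"
      by (rule nn_integral_add) measurable
    also have "\<dots> \<le> ennreal (4 * horm_const * l * w1) + ennreal (4 * horm_const * l * w2)"
      using c by (intro add_mono) auto
    also have "\<dots> = ennreal (4 * horm_const * l * w1 + 4 * horm_const * l * w2)"
      using w l horm_const_nonneg by (intro ennreal_plus[symmetric] mult_nonneg_nonneg) auto
    also have "4 * horm_const * l * w1 + 4 * horm_const * l * w2 = 4 * horm_const * l * (w1 + w2)"
      by (rule distrib_left[symmetric])
    finally show "L1_on (mult1 m (\<lambda>x. b1 x + b2 x)) (- (W1 \<union> W2)) \<le> ennreal (4 * horm_const * l * (w1 + w2))" .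
  next
    have "ennreal (w1 + w2) = ennreal w1 + ennreal w2" using w by simp
    also have "\<dots> \<le> ennreal (2 / l) * L1_on f {x \<in> I. norm (f x) > l / 2}
        + ennreal (2 / l) * L1_on f {x \<in> J. norm (f x) > l / 2}"
      using c by (intro add_mono) auto
    also have "\<dots> = ennreal (2 / l) * (L1_on f {x \<in> I. norm (f x) > l / 2}
        + L1_on f {x \<in> J. norm (f x) > l / 2})"
      by (rule distrib_left[symmetric])
    also have "L1_on f {x \<in> I. norm (f x) > l / 2}
        + L1_on f {x \<in> J. norm (f x) > l / 2}
        = L1_on f {x \<in> I \<union> J. norm (f x) > l / 2}"
      unfolding ind distrib_left by (rule nn_integral_add[symmetric]) measurable
    finally show "ennreal (w1 + w2) \<le> ennreal (2 / l) * L1_on f {x \<in> I \<union> J. norm (f x) > l / 2}" .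
  qed (use c w in auto)
  then show ?thesis by blast
qed

text \<open>A stopping-time argument in which \<open>n\<close> counts the halvings left, with the
  invariant that the average over the current interval is at most \<open>l\<close>. A half that
  violates it is selected, its average being at most \<open>2 * l\<close>; a half that satisfies it
  is halved further. On a single cell \<open>f\<close> is constant, so the invariant bounds
  \<open>f\<close> itself.\<close>

lemma cz_exists:
  assumes f: "bounded_support f" and l: "l > 0" and h: "h > 0"
    and cells: "\<And>i. i < (2::nat) ^ n \<Longrightarrow> \<exists>v. \<forall>x\<in>{a + real i * h..<a + (real i + 1) * h}. f x = v"
    and le: "L1_on f {a..<a + 2 ^ n * h} \<le> ennreal (l * (2 ^ n * h))"
  shows "\<exists>g b \<Omega> w. cz f l {a..<a + 2 ^ n * h} g b \<Omega> w"
  using cells le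
proof (induction n arbitrary: a)
  case 0
  obtain v where v: "\<And>x. x \<in> {a..<a + h} \<Longrightarrow> f x = v"
    using "0.prems"(1)[of 0] by auto
  have "ennreal (norm v * h) = (\<integral>\<^sup>+x. ennreal (norm v) * indicator {a..<a + h} x \<partial>lborel)"
    using h by (simp add: nn_integral_cmult_indicator ennreal_mult)
  also have "\<dots> = L1_on f {a..<a + h}"
    by (intro nn_integral_cong) (auto simp: indicator_def v)
  also have "\<dots> \<le> ennreal (l * h)" using "0.prems"(2) by simp
  finally have "norm v \<le> l" using h l by simp
  then show ?case
    using v by (intro cz_cell f l) auto
next
  case (Suc n)
  have [measurable]: "f \<in> borel_measurable borel" using f by (simp add: bounded_support_def)
  define L where "L = 2 ^ n * h"
  have L: "L > 0" using h by (simp add: L_def)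
  have split: "{a..<a + 2 ^ Suc n * h} = {a..<a + L} \<union> {a + L..<a + L + L}"
  proof -
    have "2 ^ Suc n * h = L + L" by (simp add: L_def)
    then show ?thesis using L by auto
  qed
  have part: "\<exists>g b \<Omega> w. cz f l {c..<c + L} g b \<Omega> w"
    if sub: "{c..<c + L} \<subseteq> {a..<a + 2 ^ Suc n * h}"
      and cl: "\<And>i. i < (2::nat) ^ n \<Longrightarrow> \<exists>v. \<forall>x\<in>{c + real i * h..<c + (real i + 1) * h}. f x = v" for c
  proof (cases "L1_on f {c..<c + L} \<le> ennreal (l * L)")
    case True
    then show ?thesis
      using Suc.IH[OF cl] unfolding L_def by blast
  next
    case False
    have "L1_on f {c..<c + L}
        \<le> L1_on f {a..<a + 2 ^ Suc n * h}"
      using sub by (intro nn_integral_mono mult_left_mono) (auto simp: indicator_def)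
    also have "\<dots> \<le> ennreal (2 * l * L)"
      using Suc.prems(2) by (simp add: L_def mult_ac)
    finally show ?thesis
      using False by (intro cz_select f l L) auto
  qed
  have "\<exists>g b \<Omega> w. cz f l ({a..<a + L} \<union> {a + L..<a + L + L}) g b \<Omega> w"
  proof (rule cz_merge[OF f l])
    show "\<exists>g b \<Omega> w. cz f l {a..<a + L} g b \<Omega> w"
    proof (rule part)
      show "{a..<a + L} \<subseteq> {a..<a + 2 ^ Suc n * h}" using split by blast
      show "\<exists>v. \<forall>x\<in>{a + real i * h..<a + (real i + 1) * h}. f x = v" if "i < 2 ^ n" for i
        using Suc.prems(1)[of i] that by simp
    qed
    show "\<exists>g b \<Omega> w. cz f l {a + L..<a + L + L} g b \<Omega> w"
    proof (rule part)
      show "{a + L..<a + L + L} \<subseteq> {a..<a + 2 ^ Suc n * h}" using split by blast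
      \<comment> \<open>In the parent interval the cells of the right half are numbered from
        \<open>2 ^ n\<close> onwards.\<close>
      show "\<exists>v. \<forall>x\<in>{a + L + real i * h..<a + L + (real i + 1) * h}. f x = v" if "i < 2 ^ n" for i
        using Suc.prems(1)[of "2 ^ n + i"] that by (simp add: L_def algebra_simps)
    qed
  qed auto
  then show ?case unfolding split .
qed

text \<open>Per unit of \<open>w\<close>: \<open>4 * B\<^sup>2\<close> from the selected means in
  the good part, 2 from the doubled intervals, and \<open>4 * horm_const\<close> from the bad part
  outside them. The outer 2 is the factor in the bound on \<open>w\<close>.\<close>

definition weak_const :: real where
  "weak_const = 2 * (4 * B\<^sup>2 + 2 + 4 * horm_const)"

lemma weak_const_nonneg: "weak_const \<ge> 0"
  unfolding weak_const_def using horm_const_nonneg by (intro mult_nonneg_nonneg add_nonneg_nonneg) auto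

lemma step_fun_cz:
  assumes f: "step_fun f" and l: "l > 0"
  shows "\<exists>J g b \<Omega> w. cz f l J g b \<Omega> w \<and> (\<forall>x. x \<notin> J \<longrightarrow> f x = 0)"
proof -
  have bf: "bounded_support f" using f by (rule step_fun_bounded_support)
  obtain N k where fN: "\<And>x. f x = f (of_int \<lfloor>x * 2 ^ N\<rfloor> / 2 ^ N)"
      "\<And>x. x \<notin> {-(2 ^ k)..<2 ^ k} \<Longrightarrow> f x = 0"
    using f unfolding step_fun_def by blast
  have "Lr_int 1 f < \<infinity>" using bounded_support_Lr[OF bf, of 1] by (simp add: Lr_iff)
  then obtain X where X: "Lr_int 1 f = ennreal X" "X \<ge> 0" by (cases "Lr_int 1 f") auto
  \<comment> \<open>Provides a starting interval so long that the average of
    \<open>norm (f x)\<close> over it is at most \<open>l\<close>.\<close>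
  obtain k0 where k0: "X / l < 2 ^ k0" using real_arch_pow[of 2 "X / l"] by auto
  define K where "K = max k k0"
  have kK: "(2::real) ^ k \<le> 2 ^ K" "(2::real) ^ k0 \<le> 2 ^ K" by (simp_all add: K_def)
  define h where "h = 1 / (2::real) ^ N"
  define a where "a = - ((2::real) ^ K)"
  have tot: "2 ^ (K + 1 + N) * h = 2 * 2 ^ K" by (simp add: h_def power_add)
  have "\<exists>g b \<Omega> w. cz f l {a..<a + 2 ^ (K + 1 + N) * h} g b \<Omega> w"
  proof (rule cz_exists[OF bf l])
    show "h > 0" by (simp add: h_def)
    fix i :: nat
    have "\<lfloor>x * 2 ^ N\<rfloor> = - (2 ^ K * 2 ^ N) + int i" if x: "x \<in> {a + real i * h..<a + (real i + 1) * h}" for x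
    proof -
      have "(a + real i * h) * 2 ^ N \<le> x * 2 ^ N" "x * 2 ^ N < (a + (real i + 1) * h) * 2 ^ N"
        using x by (simp_all only: atLeastLessThan_iff mult_right_mono mult_strict_right_mono zero_le_power zero_less_power zero_le_numeral zero_less_numeral)
      moreover have "(a + real i * h) * 2 ^ N = - (2 ^ K * 2 ^ N) + real i" "(a + (real i + 1) * h) * 2 ^ N = - (2 ^ K * 2 ^ N) + real i + 1"
        by (simp_all add: a_def h_def distrib_right left_diff_distrib add_divide_distrib)
      ultimately have "- (2 ^ K * 2 ^ N) + real i \<le> x * 2 ^ N" "x * 2 ^ N < - (2 ^ K * 2 ^ N) + real i + 1"
        by simp_all
      then show ?thesis by (intro floor_unique) auto
    qed
    then show "\<exists>v. \<forall>x\<in>{a + real i * h..<a + (real i + 1) * h}. f x = v"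
      using fN(1) by metis
  next
    have "L1_on f {a..<a + 2 ^ (K + 1 + N) * h} \<le> Lr_int 1 f"
      unfolding Lr_int_1 by (intro nn_integral_mono) (auto simp: indicator_def)
    also have "\<dots> \<le> ennreal (l * (2 ^ (K + 1 + N) * h))"
    proof -
      have "X / l \<le> 2 * 2 ^ K" using k0 kK zero_le_power[of "2::real" K] by linarith
      then show ?thesis
        unfolding X(1) tot using l by (intro ennreal_leI) (simp add: field_simps)
    qed
    finally show "L1_on f {a..<a + 2 ^ (K + 1 + N) * h} \<le> ennreal (l * (2 ^ (K + 1 + N) * h))" .
  qed
  moreover have "f x = 0" if "x \<notin> {a..<a + 2 ^ (K + 1 + N) * h}" for x
  proof (rule fN(2), rule notI)
    assume "x \<in> {-(2 ^ k)..<2 ^ k}"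
    then have "- (2 ^ k) \<le> x" "x < 2 ^ k" by auto
    then have "a \<le> x" "x < a + 2 * 2 ^ K" using kK unfolding a_def by linarith+
    then show False using that unfolding tot by simp
  qed
  ultimately show ?thesis by blast
qed

text \<open>A point of the level set lies in the level set of the image of the good part (Chebyshev
  in L^2), in \<open>W\<close>, or in the level set of the image of the bad part outside
  \<open>W\<close> (Chebyshev in L^1). Each is bounded by means of \<open>w\<close>, and
  \<open>w\<close> by the mass of \<open>f\<close> above \<open>l / 2\<close>.\<close>

lemma weak_type:
  assumes f: "step_fun f" and l: "l > 0"
  shows "emeasure lborel {x. norm (mult1 m f x) > 2 * l}
    \<le> ennreal (B\<^sup>2 / l\<^sup>2) * L2_on f {x. norm (f x) \<le> l}
      + ennreal (weak_const / l) * L1_on f {x. norm (f x) > l / 2}"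
    (is "_ \<le> ennreal (B\<^sup>2 / l\<^sup>2) * ?P + ennreal (weak_const / l) * ?Q")
proof -
  have bf: "bounded_support f" using f by (rule step_fun_bounded_support)
  obtain J g b W w where cz: "cz f l J g b W w" and J: "\<And>x. x \<notin> J \<Longrightarrow> f x = 0"
    using step_fun_cz[OF f l] by blast
  note c = cz[unfolded cz_def]
  have [measurable]: "f \<in> borel_measurable borel" "g \<in> borel_measurable borel" "b \<in> borel_measurable borel" "W \<in> sets borel"
    using c bf by (auto simp: bounded_support_def)
  have w: "w \<ge> 0" using c by blast
  have gi: "integrable lborel g" and bi: "integrable lborel b"
    using c by (auto intro: bounded_support_integrable)
  have "f x = g x + b x" for x
  proof -
    have "g x + b x = f x * indicator J x" using c by blast
    then show ?thesis using J[of x] by (cases "x \<in> J") simp_all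
  qed
  then have "f = (\<lambda>x. g x + b x)" by (rule ext)
  then have T: "mult1 m f x = mult1 m g x + mult1 m b x" for x
    using mult1_add[OF gi bi] by simp
  have "?P < \<infinity>"
  proof -
    have "?P \<le> Lr_int 2 f" unfolding Lr_int_2 by (intro nn_integral_mono) (auto simp: indicator_def)
    also have "\<dots> < \<infinity>" using bounded_support_Lr[OF bf, of 2] by (simp add: Lr_iff)
    finally show ?thesis .
  qed
  then obtain P where P: "?P = ennreal P" "P \<ge> 0" by (cases ?P) auto
  have "?Q < \<infinity>"
  proof -
    have "?Q \<le> Lr_int 1 f" unfolding Lr_int_1 by (intro nn_integral_mono) (auto simp: indicator_def)
    also have "\<dots> < \<infinity>" using bounded_support_Lr[OF bf, of 1] by (simp add: Lr_iff)
    finally show ?thesis .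
  qed
  then obtain Q where Q: "?Q = ennreal Q" "Q \<ge> 0" by (cases ?Q) auto
  have "ennreal w \<le> ennreal (2 / l) * ?Q"
  proof -
    have "L1_on f {x \<in> J. norm (f x) > l / 2} \<le> ?Q"
      by (intro nn_integral_mono) (auto simp: indicator_def)
    then show ?thesis
      using c by (meson mult_left_mono order_trans zero_le)
  qed
  then have wQ: "w \<le> 2 / l * Q"
    unfolding Q(1) using l Q(2) by (simp add: ennreal_mult'[symmetric])
  have g2: "Lr_int 2 g \<le> ennreal (P + 4 * l\<^sup>2 * w)"
  proof -
    have "L2_on f {x \<in> J. norm (f x) \<le> l} \<le> ?P"
      by (intro nn_integral_mono) (auto simp: indicator_def)
    then have "Lr_int 2 g \<le> ?P + ennreal (4 * l\<^sup>2 * w)"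
      using c by (meson add_right_mono order_trans)
    then show ?thesis using P w by (simp add: ennreal_plus[symmetric] del: ennreal_plus)
  qed
  let ?S1 = "{x. norm (mult1 m g x) > l}" and ?S2 = "{x. norm (mult1 m b x) > l \<and> x \<notin> W}"
  have [measurable]: "?S1 \<in> sets borel" "?S2 \<in> sets borel" "{x. norm (mult1 m f x) > 2 * l} \<in> sets borel"
    by measurable
  have "emeasure lborel {x. norm (mult1 m f x) > 2 * l} \<le> emeasure lborel (?S1 \<union> (W \<union> ?S2))"
  proof (intro emeasure_mono subsetI)
    fix x assume "x \<in> {x. norm (mult1 m f x) > 2 * l}"
    then have "norm (mult1 m g x) + norm (mult1 m b x) > 2 * l"
      unfolding T using norm_triangle_ineq[of "mult1 m g x" "mult1 m b x"] by simp
    then have "norm (mult1 m g x) > l \<or> norm (mult1 m b x) > l" by linarith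
    then show "x \<in> ?S1 \<union> (W \<union> ?S2)" by auto
  qed measurable
  also have "\<dots> \<le> emeasure lborel ?S1 + (emeasure lborel W + emeasure lborel ?S2)"
    by (intro order_trans[OF emeasure_subadditive] add_mono order_refl emeasure_subadditive) auto
  also have "emeasure lborel ?S1 \<le> ennreal (B\<^sup>2 / l\<^sup>2 * (P + 4 * l\<^sup>2 * w))"
  proof -
    have "emeasure lborel ?S1 \<le> ennreal (1 / l\<^sup>2) * L2_on (\<lambda>x. mult1 m g x) ?S1"
      using l by (intro emeasure_gt_le) (auto intro: power_strict_mono)
    also have "\<dots> \<le> ennreal (1 / l\<^sup>2) * Lr_int 2 (mult1 m g)"
      unfolding Lr_int_2 by (intro mult_left_mono nn_integral_mono) (auto simp: indicator_def)
    also have "\<dots> \<le> ennreal (1 / l\<^sup>2) * (ennreal (B\<^sup>2) * ennreal (P + 4 * l\<^sup>2 * w))"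
      by (intro mult_left_mono order_trans[OF mult1_L2_bound[OF integrable bound gi]] g2) auto
    also have "\<dots> = ennreal (B\<^sup>2 / l\<^sup>2 * (P + 4 * l\<^sup>2 * w))"
      using P(2) w by (simp add: ennreal_mult'[symmetric] del: ennreal_plus)
    finally show ?thesis .
  qed
  also have "emeasure lborel W \<le> ennreal (2 * w)" using c by blast
  also have "emeasure lborel ?S2 \<le> ennreal (4 * horm_const * w)"
  proof -
    have "emeasure lborel ?S2 \<le> ennreal (1 / l) * L1_on (mult1 m b) ?S2"
      using l by (intro emeasure_gt_le) auto
    also have "\<dots> \<le> ennreal (1 / l) * L1_on (mult1 m b) (- W)"
      by (intro mult_left_mono nn_integral_mono) (auto simp: indicator_def)
    also have "\<dots> \<le> ennreal (1 / l) * ennreal (4 * horm_const * l * w)"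
      using c by (intro mult_left_mono) auto
    also have "\<dots> = ennreal (1 / l * (4 * horm_const * l * w))"
      using l w horm_const_nonneg by (intro ennreal_mult[symmetric] mult_nonneg_nonneg) auto
    also have "1 / l * (4 * horm_const * l * w) = 4 * horm_const * w"
      using l by simp
    finally show ?thesis .
  qed
  finally have "emeasure lborel {x. norm (mult1 m f x) > 2 * l}
      \<le> ennreal (B\<^sup>2 / l\<^sup>2 * (P + 4 * l\<^sup>2 * w)) + (ennreal (2 * w) + ennreal (4 * horm_const * w))"
    by (simp add: add_mono)
  also have "\<dots> = ennreal (B\<^sup>2 / l\<^sup>2 * (P + 4 * l\<^sup>2 * w) + (2 * w + 4 * horm_const * w))"
  proof -
    have 1: "0 \<le> 4 * horm_const * w"
      using w horm_const_nonneg by (intro mult_nonneg_nonneg) auto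
    have 2: "0 \<le> 2 * w + 4 * horm_const * w"
      using 1 w by (intro add_nonneg_nonneg) auto
    have 3: "0 \<le> B\<^sup>2 / l\<^sup>2 * (P + 4 * l\<^sup>2 * w)"
      using P(2) w by (intro mult_nonneg_nonneg add_nonneg_nonneg) auto
    have 4: "0 \<le> 2 * w" using w by simp
    show ?thesis
      by (simp only: ennreal_plus[OF 3 2] ennreal_plus[OF 4 1])
  qed
  also have "\<dots> \<le> ennreal (B\<^sup>2 / l\<^sup>2 * P + weak_const / l * Q)"
  proof (rule ennreal_leI)
    have "B\<^sup>2 / l\<^sup>2 * (P + 4 * l\<^sup>2 * w) + (2 * w + 4 * horm_const * w) = B\<^sup>2 / l\<^sup>2 * P + (4 * B\<^sup>2 + 2 + 4 * horm_const) * w"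
      using l by (simp add: distrib_left distrib_right del: distrib_left_numeral)
    also have "\<dots> \<le> B\<^sup>2 / l\<^sup>2 * P + (4 * B\<^sup>2 + 2 + 4 * horm_const) * (2 / l * Q)"
      using horm_const_nonneg by (intro add_left_mono mult_left_mono wQ add_nonneg_nonneg) auto
    also have "(4 * B\<^sup>2 + 2 + 4 * horm_const) * (2 / l * Q) = weak_const / l * Q"
      unfolding weak_const_def by simp
    finally show "B\<^sup>2 / l\<^sup>2 * (P + 4 * l\<^sup>2 * w) + (2 * w + 4 * horm_const * w) \<le> B\<^sup>2 / l\<^sup>2 * P + weak_const / l * Q" .
  qed
  also have "\<dots> = ennreal (B\<^sup>2 / l\<^sup>2) * ?P + ennreal (weak_const / l) * ?Q"
    unfolding P(1) Q(1) using P(2) Q(2) l weak_const_nonneg by (simp add: ennreal_mult[symmetric])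
  finally show ?thesis .
qed

end

section \<open>From the distributional estimate to \<open>L\<^sup>r\<close>\<close>

lemma nn_integral_powr_from_0:
  assumes p: "p > -1" and c: "c \<ge> 0"
  shows "(\<integral>\<^sup>+x. ennreal (x powr p) * indicator {0<..<c} x \<partial>lborel) = ennreal (c powr (p + 1) / (p + 1))"
proof -
  have "(\<integral>\<^sup>+x. ennreal (x powr p) * indicator {0<..<c} x \<partial>lborel) = (\<integral>\<^sup>+x. ennreal (indicator {0..c} x * x powr p) \<partial>lborel)"
  proof (rule nn_integral_cong_AE)
    show "AE x in lborel. ennreal (x powr p) * indicator {0<..<c} x = ennreal (indicator {0..c} x * x powr p)"
      using AE_lborel_singleton[of 0] AE_lborel_singleton[of c] by eventually_elim (auto simp: indicator_def)
  qed
  also have "\<dots> = ennreal (c powr (p + 1) / (p + 1))"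
    by (rule nn_integral_has_integral_lebesgue[OF _ has_integral_powr_from_0[OF p c]]) simp
  finally show ?thesis .
qed

lemma nn_integral_powr_to_inf:
  assumes p: "p < -1" and c: "c > 0"
  shows "(\<integral>\<^sup>+x. ennreal (x powr p) * indicator {c..} x \<partial>lborel) = ennreal (c powr (p + 1) / (- p - 1))"
proof -
  have "(\<integral>\<^sup>+x. ennreal (x powr p) * indicator {c..} x \<partial>lborel) = (\<integral>\<^sup>+x. ennreal (indicator {c..} x * x powr p) \<partial>lborel)"
    by (intro nn_integral_cong) (auto simp: indicator_def)
  also have "\<dots> = ennreal (- (c powr (p + 1)) / (p + 1))"
    by (rule nn_integral_has_integral_lebesgue[OF _ has_integral_powr_to_inf[OF p c]]) simp
  also have "- (c powr (p + 1)) / (p + 1) = c powr (p + 1) / (- p - 1)"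
    using p by (simp add: field_simps)
  finally show ?thesis .
qed

text \<open>The layer-cake formula and Tonelli. For fixed \<open>x\<close> there remain the integral
  of \<open>l powr (r - 3)\<close> over \<open>l \<ge> norm (f x)\<close>, which converges because
  \<open>r < 2\<close>, and that of \<open>l powr (r - 2)\<close> over
  \<open>0 < l < 2 * norm (f x)\<close>, which converges because \<open>r > 1\<close>. Multiplied by
  \<open>(norm (f x))\<^sup>2\<close> and \<open>norm (f x)\<close>, both are multiples of
  \<open>norm (f x) powr r\<close>.\<close>

lemma Lr_int_le_weak:
  fixes f g :: "real \<Rightarrow> complex"
  assumes [measurable]: "f \<in> borel_measurable borel" "g \<in> borel_measurable borel"
    and r: "1 < r" "r < 2" and b: "b \<ge> 0" and W: "W \<ge> 0"
    and weak: "\<And>l. l > 0 \<Longrightarrow> emeasure lborel {x. norm (g x) > 2 * l}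
      \<le> ennreal (b / l\<^sup>2) * L2_on f {x. norm (f x) \<le> l}
        + ennreal (W / l) * L1_on f {x. norm (f x) > l / 2}"
  shows "Lr_int r g \<le> ennreal (2 powr r * (r * b / (2 - r) + r * W * 2 powr (r - 1) / (r - 1))) * Lr_int r f"
proof -
  define S1 where "S1 = {p :: real \<times> real. 0 < fst p \<and> norm (f (snd p)) \<le> fst p}"
  define S2 where "S2 = {p :: real \<times> real. 0 < fst p \<and> fst p < 2 * norm (f (snd p))}"
  define S3 where "S3 = {p :: real \<times> real. norm (g (snd p)) > 2 * fst p}"
  have "{p \<in> space (lborel \<Otimes>\<^sub>M lborel). 0 < fst p \<and> norm (f (snd p)) \<le> fst p} \<in> sets (lborel \<Otimes>\<^sub>M lborel)"
      "{p \<in> space (lborel \<Otimes>\<^sub>M lborel). 0 < fst p \<and> fst p < 2 * norm (f (snd p))} \<in> sets (lborel \<Otimes>\<^sub>M lborel)"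
      "{p \<in> space (lborel \<Otimes>\<^sub>M lborel). norm (g (snd p)) > 2 * fst p} \<in> sets (lborel \<Otimes>\<^sub>M lborel)"
    by measurable
  then have [measurable]: "S1 \<in> sets (lborel \<Otimes>\<^sub>M lborel)" "S2 \<in> sets (lborel \<Otimes>\<^sub>M lborel)" "S3 \<in> sets (lborel \<Otimes>\<^sub>M lborel)"
    by (simp_all only: S1_def S2_def S3_def space_pair_measure space_lborel space_borel UNIV_Times_UNIV UNIV_I simp_thms)
  define F1 where "F1 p = ennreal ((norm (f (snd p)))\<^sup>2) * (ennreal (r * b) * (ennreal (fst p powr (r - 3)) * indicator S1 p))" for p
  define F2 where "F2 p = ennreal (norm (f (snd p))) * (ennreal (r * W) * (ennreal (fst p powr (r - 2)) * indicator S2 p))" for p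
  define F3 where "F3 p = ennreal (r * fst p powr (r - 1)) * (indicator {0<..} (fst p) * indicator S3 p)" for p
  have F: "F1 \<in> borel_measurable (lborel \<Otimes>\<^sub>M lborel)" "F2 \<in> borel_measurable (lborel \<Otimes>\<^sub>M lborel)"
      "F3 \<in> borel_measurable (lborel \<Otimes>\<^sub>M lborel)"
    unfolding F1_def F2_def F3_def by measurable
  \<comment> \<open>Halving \<open>norm (g x)\<close> matches the threshold \<open>2 * l\<close> of
    the weak estimate; the factor \<open>2 powr r\<close> is restored afterwards.\<close>
  have lay: "ennreal ((norm (g x) / 2) powr r)
      = (\<integral>\<^sup>+l. F3 (l, x) \<partial>lborel)" for x
  proof -
    have "(\<integral>\<^sup>+l. F3 (l, x) \<partial>lborel)
        = (\<integral>\<^sup>+l. ennreal r * (ennreal (l powr (r - 1)) * indicator {0<..<norm (g x) / 2} l) \<partial>lborel)"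
      using r by (intro nn_integral_cong) (auto simp: indicator_def S1_def S2_def S3_def F1_def F2_def F3_def ennreal_mult)
    also have "\<dots> = ennreal r * ennreal ((norm (g x) / 2) powr r / r)"
      using r nn_integral_powr_from_0[of "r - 1" "norm (g x) / 2"] by (subst nn_integral_cmult) auto
    also have "\<dots> = ennreal ((norm (g x) / 2) powr r)"
      using r by (simp add: ennreal_mult[symmetric])
    finally show ?thesis by simp
  qed
  have "Lr_int r g = (\<integral>\<^sup>+x. ennreal (2 powr r) * ennreal ((norm (g x) / 2) powr r) \<partial>lborel)"
    unfolding Lr_int_def using r by (intro nn_integral_cong) (simp add: ennreal_mult[symmetric] powr_divide)
  also have "\<dots> = ennreal (2 powr r) * (\<integral>\<^sup>+x. \<integral>\<^sup>+l. F3 (l, x) \<partial>lborel \<partial>lborel)"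
    unfolding lay[symmetric] by (rule nn_integral_cmult) measurable
  also have "(\<integral>\<^sup>+x. \<integral>\<^sup>+l. F3 (l, x) \<partial>lborel \<partial>lborel)
      = (\<integral>\<^sup>+l. \<integral>\<^sup>+x. F3 (l, x) \<partial>lborel \<partial>lborel)"
    by (intro lborel_pair.Fubini F)
  also have "\<dots> \<le> (\<integral>\<^sup>+l. (\<integral>\<^sup>+x. F1 (l, x) \<partial>lborel)
      + (\<integral>\<^sup>+x. F2 (l, x) \<partial>lborel) \<partial>lborel)"
  proof (rule nn_integral_mono)
    fix l :: real
    show "(\<integral>\<^sup>+x. F3 (l, x) \<partial>lborel)
       \<le> (\<integral>\<^sup>+x. F1 (l, x) \<partial>lborel)
      + (\<integral>\<^sup>+x. F2 (l, x) \<partial>lborel)"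
    proof (cases "l > 0")
      case True
      have "(\<integral>\<^sup>+x. F3 (l, x) \<partial>lborel)
          = (\<integral>\<^sup>+x. ennreal (r * l powr (r - 1)) * indicator {x. norm (g x) > 2 * l} x \<partial>lborel)"
        using True by (intro nn_integral_cong) (auto simp: indicator_def S1_def S2_def S3_def F1_def F2_def F3_def)
      also have "\<dots> = ennreal (r * l powr (r - 1)) * emeasure lborel {x. norm (g x) > 2 * l}"
        by (rule nn_integral_cmult_indicator) measurable
      also have "\<dots> \<le> ennreal (r * l powr (r - 1)) * (ennreal (b / l\<^sup>2) * L2_on f {x. norm (f x) \<le> l}
        + ennreal (W / l) * L1_on f {x. norm (f x) > l / 2})"
        by (intro mult_left_mono weak True) auto
      also have "\<dots> = ennreal (r * l powr (r - 1) * (b / l\<^sup>2)) * L2_on f {x. norm (f x) \<le> l}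
        + ennreal (r * l powr (r - 1) * (W / l)) * L1_on f {x. norm (f x) > l / 2}"
        using r b W True by (simp add: distrib_left mult.assoc[symmetric] ennreal_mult[symmetric] del: times_divide_eq_right)
      also have "r * l powr (r - 1) * (b / l\<^sup>2) = r * b * l powr (r - 3)"
      proof -
        have "l powr (r - 1) = l powr (r - 3) * l powr 2"
          by (simp flip: powr_add)
        then show ?thesis using True by (simp add: powr_numeral)
      qed
      also have "r * l powr (r - 1) * (W / l) = r * W * l powr (r - 2)"
      proof -
        have "l powr (r - 1) = l powr (r - 2) * l powr 1"
          by (simp only: powr_add[symmetric]) simp
        then show ?thesis using True by simp
      qed
      also have "ennreal (r * b * l powr (r - 3)) * L2_on f {x. norm (f x) \<le> l}
          = (\<integral>\<^sup>+x. F1 (l, x) \<partial>lborel)"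
        using r b True by (subst nn_integral_cmult[symmetric]) (auto intro!: nn_integral_cong simp: indicator_def S1_def S2_def S3_def F1_def F2_def F3_def ennreal_mult mult_ac)
      also have "ennreal (r * W * l powr (r - 2)) * L1_on f {x. norm (f x) > l / 2}
          = (\<integral>\<^sup>+x. F2 (l, x) \<partial>lborel)"
        using r W True by (subst nn_integral_cmult[symmetric]) (auto intro!: nn_integral_cong simp: indicator_def S1_def S2_def S3_def F1_def F2_def F3_def ennreal_mult mult_ac)
      finally show ?thesis .
    qed (simp add: F3_def)
  qed
  also have "\<dots> = (\<integral>\<^sup>+l. (\<integral>\<^sup>+x. F1 (l, x) \<partial>lborel) \<partial>lborel)
      + (\<integral>\<^sup>+l. (\<integral>\<^sup>+x. F2 (l, x) \<partial>lborel) \<partial>lborel)"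
    by (intro nn_integral_add lborel.borel_measurable_nn_integral_fst F)
  also have "(\<integral>\<^sup>+l. (\<integral>\<^sup>+x. F1 (l, x) \<partial>lborel) \<partial>lborel)
      = (\<integral>\<^sup>+x. (\<integral>\<^sup>+l. F1 (l, x) \<partial>lborel) \<partial>lborel)"
    by (intro lborel_pair.Fubini[symmetric] F)
  also have "\<dots> = (\<integral>\<^sup>+x. ennreal (r * b / (2 - r)) * ennreal (norm (f x) powr r) \<partial>lborel)"
  proof (rule nn_integral_cong)
    fix x
    show "(\<integral>\<^sup>+l. F1 (l, x) \<partial>lborel)
        = ennreal (r * b / (2 - r)) * ennreal (norm (f x) powr r)"
    proof (cases "f x = 0")
      case False
      then have pos: "0 < l" if "norm (f x) \<le> l" for l
        using that zero_less_norm_iff[of "f x"] by linarith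
      have "(\<integral>\<^sup>+l. F1 (l, x) \<partial>lborel)
          = (\<integral>\<^sup>+l. ennreal ((norm (f x))\<^sup>2 * (r * b)) * (ennreal (l powr (r - 3)) * indicator {norm (f x)..} l) \<partial>lborel)"
        using r b by (intro nn_integral_cong) (auto simp: indicator_def S1_def S2_def S3_def F1_def F2_def F3_def ennreal_mult mult.assoc dest: pos)
      also have "\<dots> = ennreal ((norm (f x))\<^sup>2 * (r * b)) * ennreal (norm (f x) powr (r - 2) / (2 - r))"
        using r False nn_integral_powr_to_inf[of "r - 3" "norm (f x)"] by (subst nn_integral_cmult) auto
      also have "\<dots> = ennreal ((norm (f x))\<^sup>2 * (r * b) * (norm (f x) powr (r - 2) / (2 - r)))"
        using r b by (intro ennreal_mult[symmetric]) auto
      also have "(norm (f x))\<^sup>2 * (r * b) * (norm (f x) powr (r - 2) / (2 - r)) = r * b / (2 - r) * norm (f x) powr r"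
      proof -
        have "norm (f x) powr r = norm (f x) powr (r - 2) * norm (f x) powr 2"
          by (simp only: powr_add[symmetric]) simp
        then show ?thesis by (simp add: powr_numeral)
      qed
      finally show ?thesis using r b by (simp add: ennreal_mult[symmetric])
    qed (simp add: F1_def)
  qed
  also have "\<dots> = ennreal (r * b / (2 - r)) * Lr_int r f"
    unfolding Lr_int_def by (rule nn_integral_cmult) measurable
  also have "(\<integral>\<^sup>+l. (\<integral>\<^sup>+x. F2 (l, x) \<partial>lborel) \<partial>lborel)
      = (\<integral>\<^sup>+x. (\<integral>\<^sup>+l. F2 (l, x) \<partial>lborel) \<partial>lborel)"
    by (intro lborel_pair.Fubini[symmetric] F)
  also have "\<dots> = (\<integral>\<^sup>+x. ennreal (r * W * 2 powr (r - 1) / (r - 1)) * ennreal (norm (f x) powr r) \<partial>lborel)"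
  proof (rule nn_integral_cong)
    fix x
    have "(\<integral>\<^sup>+l. F2 (l, x) \<partial>lborel)
        = (\<integral>\<^sup>+l. ennreal (norm (f x) * (r * W)) * (ennreal (l powr (r - 2)) * indicator {0<..<2 * norm (f x)} l) \<partial>lborel)"
      using r W by (intro nn_integral_cong) (auto simp: indicator_def S1_def S2_def S3_def F1_def F2_def F3_def ennreal_mult mult.assoc)
    also have "\<dots> = ennreal (norm (f x) * (r * W)) * ennreal ((2 * norm (f x)) powr (r - 1) / (r - 1))"
      using r nn_integral_powr_from_0[of "r - 2" "2 * norm (f x)"] by (subst nn_integral_cmult) auto
    also have "\<dots> = ennreal (norm (f x) * (r * W) * ((2 * norm (f x)) powr (r - 1) / (r - 1)))"
      using r W by (intro ennreal_mult[symmetric]) auto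
    also have "norm (f x) * (r * W) * ((2 * norm (f x)) powr (r - 1) / (r - 1)) = r * W * 2 powr (r - 1) / (r - 1) * norm (f x) powr r"
    proof -
      have "norm (f x) powr r = norm (f x) powr (r - 1) * norm (f x) powr 1"
        by (simp only: powr_add[symmetric]) simp
      then show ?thesis by (simp add: powr_mult)
    qed
    finally show "(\<integral>\<^sup>+l. F2 (l, x) \<partial>lborel)
        = ennreal (r * W * 2 powr (r - 1) / (r - 1)) * ennreal (norm (f x) powr r)"
      using r W by (simp add: ennreal_mult[symmetric])
  qed
  also have "\<dots> = ennreal (r * W * 2 powr (r - 1) / (r - 1)) * Lr_int r f"
    unfolding Lr_int_def by (rule nn_integral_cmult) measurable
  finally have "Lr_int r g \<le> ennreal (2 powr r) * (ennreal (r * b / (2 - r)) * Lr_int r f + ennreal (r * W * 2 powr (r - 1) / (r - 1)) * Lr_int r f)"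
    by (simp add: mult_left_mono)
  also have "\<dots> = ennreal (2 powr r) * (ennreal (r * b / (2 - r) + r * W * 2 powr (r - 1) / (r - 1)) * Lr_int r f)"
    using r b W by (simp add: distrib_right ennreal_plus)
  also have "\<dots> = ennreal (2 powr r * (r * b / (2 - r) + r * W * 2 powr (r - 1) / (r - 1))) * Lr_int r f"
    using r b W by (simp add: ennreal_mult mult.assoc)
  finally show ?thesis .
qed

context mikhlin_symbol
begin

lemma strong_type_below_2:
  assumes f: "step_fun f" and r: "1 < r" "r < 2"
  shows "Lr_int r (mult1 m f) \<le> ennreal (2 powr r * (r * B\<^sup>2 / (2 - r) + r * weak_const * 2 powr (r - 1) / (r - 1))) * Lr_int r f"
proof -
  have [measurable]: "f \<in> borel_measurable borel"
    using step_fun_bounded_support[OF f] by (simp add: bounded_support_def)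
  show ?thesis
    by (rule Lr_int_le_weak[OF _ _ r _ weak_const_nonneg weak_type[OF f]]) auto
qed

section \<open>Exponents above 2 by duality\<close>

lemma bounded_support_ext:
  assumes bd: "\<And>s. step_fun s \<Longrightarrow> Lr_int r (mult1 m s) \<le> ennreal A * Lr_int r s"
    and g: "bounded_support g" and r: "r \<ge> 1" and A: "A \<ge> 0"
  shows "Lr_int r (mult1 m g) \<le> ennreal (A * 2 powr r) * Lr_int r g"
proof -
  \<comment> \<open>The dual test functions need not be step functions. Approximation in both
    exponents makes the images converge in L^2, while the bound is carried over in L^r.\<close>
  obtain s where s: "\<And>n. step_fun (s n)" "Lr_tendsto r s g" "Lr_tendsto 2 s g"
    using step_fun_dense[of g r 2] bounded_support_Lr[OF g] r by auto
  have sb: "bounded_support (s n)" for n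
    using s(1) by (rule step_fun_bounded_support)
  note i = bounded_support_integrable[OF sb] bounded_support_integrable[OF g]
  have L2: "mult1 m h \<in> Lr 2" if h: "bounded_support h" for h
  proof -
    have [measurable]: "h \<in> borel_measurable borel"
      using h by (simp add: bounded_support_def)
    show ?thesis
      using mult1_L2_bound[OF integrable bound bounded_support_integrable[OF h]] bounded_support_Lr[OF h, of 2]
      by (auto simp: Lr_iff ennreal_mult_less_top intro: order.strict_trans1)
  qed
  have "(\<lambda>x. mult1 m (s n) x - mult1 m g x) = mult1 m (\<lambda>x. s n x - g x)" for n
    by (rule ext) (rule mult1_diff[OF i, symmetric])
  then have "Lr_tendsto 2 (\<lambda>n. mult1 m (s n)) (mult1 m g)"
    using mult1_L2_bound[OF integrable bound Bochner_Integration.integrable_diff[OF i]]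
    by (intro Lr_tendsto_dominated[OF s(3) _ L2[OF sb] L2[OF g]]) auto
  then show ?thesis
    by (rule Lr_int_le_transfer[OF _ s(2) _ _ _ A bd[OF s(1)]]) (use r in auto)
qed

text \<open>The transpose of a convolution operator has the reflected kernel, hence the symbol
  \<open>m (- x)\<close>. The class is invariant under reflection with the same constants, so the
  estimate below 2 is available for the transpose.\<close>

lemma reflected: "mikhlin_symbol (\<lambda>x. m (- x)) (\<lambda>x. - m' (- x)) B C E"
proof
  fix x :: real assume x: "x \<noteq> 0"
  have "((m \<circ> uminus) has_vector_derivative (- 1) *\<^sub>R m' (- x)) (at x)"
    by (rule vector_diff_chain_at) (use x deriv[of "- x"] in \<open>auto intro!: derivative_eq_intros\<close>)
  then show "((\<lambda>x. m (- x)) has_vector_derivative - m' (- x)) (at x)"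
    by (simp add: o_def)
  show "isCont (\<lambda>x. - m' (- x)) x"
    using x cont_deriv[of "- x"] by (intro continuous_intros isCont_o2[of _ uminus]) auto
qed (use bound deriv_bound[of "- _"] decay[of "- _"] deriv_decay[of "- _"] in auto)

lemma kernel_reflect: "kernel (\<lambda>x. m (- x)) z = kernel m (- z)"
  by (simp add: kernel_def ft_reflect)

text \<open>
  The dual function is truncated to \<open>{-n..n}\<close>, so that its integral is finite and the small multiple of
  it produced by Young's inequality can be absorbed.
\<close>

lemma duality:
  assumes r: "r > 2" and q: "q = r / (r - 1)" and A: "A \<ge> 0"
    and bd: "\<And>g. bounded_support g \<Longrightarrow> Lr_int q (mult1 (\<lambda>x. m (- x)) g) \<le> ennreal A * Lr_int q g"
    and f: "bounded_support f"
  shows "Lr_int r (mult1 m f) \<le> ennreal (2 * (2 * (A + 1)) powr (r / q)) * Lr_int r f"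
proof -
  define h where "h = mult1 m f"
  have fi: "integrable lborel f" using f by (rule bounded_support_integrable)
  have [measurable]: "f \<in> borel_measurable borel" using f by (simp add: bounded_support_def)
  have [measurable]: "h \<in> borel_measurable borel" unfolding h_def by measurable
  have q1: "q > 1" "1 / r + 1 / q = 1" "(r - 1) * q = r"
    using r by (auto simp: q field_simps)
  \<comment> \<open>Makes \<open>d powr q * A\<close> at most 1/2, so that the term it multiplies
    can be absorbed.\<close>
  define d where "d = (2 * (A + 1)) powr (- 1 / q)"
  have d: "d > 0" "d powr q = 1 / (2 * (A + 1))" "(1 / d) powr r = (2 * (A + 1)) powr (r / q)"
    using A q1 r by (auto simp: d_def powr_powr powr_minus field_simps powr_divide)
  define M where "M = (LINT t|lborel. norm (m t)) * (LINT t|lborel. norm (f t)) + 1"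
  have h_le: "norm (h x) \<le> M" for x
  proof -
    have i: "integrable lborel (\<lambda>y. f y * kernel m (x - y))"
      by (rule integrable_mult_bounded[OF fi _ kernel_bound]) measurable
    have "norm (h x) \<le> (LINT y|lborel. norm (f y * kernel m (x - y)))"
      unfolding h_def mult1_kernel[OF integrable fi] by (rule integral_norm_bound)
    also have "\<dots> \<le> (LINT y|lborel. (LINT t|lborel. norm (m t)) * norm (f y))"
    proof (rule integral_mono)
      show "integrable lborel (\<lambda>y. norm (f y * kernel m (x - y)))"
        by (rule integrable_norm[OF i])
      show "integrable lborel (\<lambda>y. (LINT t|lborel. norm (m t)) * norm (f y))"
        by (intro integrable_mult_right integrable_norm fi)
      show "norm (f y * kernel m (x - y)) \<le> (LINT t|lborel. norm (m t)) * norm (f y)" for y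
        using mult_right_mono[OF kernel_bound[of m "x - y"] norm_ge_zero[of "f y"]] by (simp add: norm_mult mult.commute)
    qed
    finally show ?thesis by (simp add: M_def)
  qed
  have M: "M \<ge> 0" using h_le[of 0] norm_ge_zero order_trans by blast
  have trunc: "Lr_int r (\<lambda>x. h x * complex_of_real (indicator {- real n..real n} x)) \<le> ennreal (2 * (2 * (A + 1)) powr (r / q)) * Lr_int r f" for n
  proof -
    \<comment> \<open>The extremal function of Hoelder's inequality: on the truncation interval both
      \<open>h x * g x\<close> and \<open>norm (g x) powr q\<close> equal
      \<open>norm (h x) powr r\<close>.\<close>
    define g where "g x = cnj (h x) * complex_of_real (norm (h x) powr (r - 2) * indicator {- real n..real n} x)" for x
    have [measurable]: "g \<in> borel_measurable borel" unfolding g_def by measurable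
    have gb: "bounded_support g"
    proof (rule bounded_supportI[of _ "M * M powr (r - 2)" "real n"])
      fix x
      have "norm (h x) powr (r - 2) \<le> M powr (r - 2)"
        using r h_le[of x] by (intro powr_mono2) auto
      then have "norm (h x) * norm (h x) powr (r - 2) \<le> M * M powr (r - 2)"
        using h_le[of x] M by (intro mult_mono) auto
      moreover have "norm (g x) \<le> norm (h x) * norm (h x) powr (r - 2)"
        by (simp add: g_def norm_mult indicator_def)
      ultimately show "norm (g x) \<le> M * M powr (r - 2)" by linarith
    qed (auto simp: g_def)
    have gi: "integrable lborel g" using gb by (rule bounded_support_integrable)
    have p2: "t * t powr (r - 2) = t powr (r - 1)" if "t \<ge> 0" for t :: real
    proof -
      have "t powr (r - 1) = t powr 1 * t powr (r - 2)" by (simp only: powr_add[symmetric]) simp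
      then show ?thesis using that by simp
    qed
    let ?X = "Lr_int r (\<lambda>x. h x * complex_of_real (indicator {- real n..real n} x))"
    have gq: "Lr_int q g = ?X"
      unfolding Lr_int_def
    proof (intro nn_integral_cong)
      fix x
      have "norm (g x) powr q = norm (h x * complex_of_real (indicator {- real n..real n} x)) powr r"
      proof (cases "x \<in> {- real n..real n}")
        case True
        then have "norm (g x) = norm (h x) powr (r - 1)"
          using p2[of "norm (h x)"] by (simp add: g_def norm_mult)
        then show ?thesis using True q1 by (simp add: powr_powr)
      qed (use r q1 in \<open>simp add: g_def\<close>)
      then show "ennreal (norm (g x) powr q) = ennreal (norm (h x * complex_of_real (indicator {- real n..real n} x)) powr r)"
        by simp
    qed
    have gfin: "Lr_int q g < \<infinity>"
      using bounded_support_Lr[OF gb, of q] q1 by (simp add: Lr_iff)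
    have hg: "h x * g x = complex_of_real (norm (h x * complex_of_real (indicator {- real n..real n} x)) powr r)" for x
    proof -
      have "h x * g x = complex_of_real ((norm (h x))\<^sup>2 * (norm (h x) powr (r - 2) * indicator {- real n..real n} x))"
        unfolding g_def of_real_mult complex_norm_square by (simp add: mult_ac)
      also have "(norm (h x))\<^sup>2 * (norm (h x) powr (r - 2) * indicator {- real n..real n} x) = norm (h x * complex_of_real (indicator {- real n..real n} x)) powr r"
      proof -
        have "norm (h x) powr r = norm (h x) powr 2 * norm (h x) powr (r - 2)" by (simp only: powr_add[symmetric]) simp
        then show ?thesis using r by (simp add: powr_numeral indicator_def)
      qed
      finally show ?thesis .
    qed
    have hgi: "integrable lborel (\<lambda>x. g x * h x)"
      by (rule integrable_mult_bounded[OF gi _ h_le]) measurable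
    have "?X = (\<integral>\<^sup>+x. ennreal (norm (h x * complex_of_real (indicator {- real n..real n} x)) powr r) \<partial>lborel)"
      by (simp add: Lr_int_def)
    also have "\<dots> = ennreal (LINT x|lborel. norm (h x * complex_of_real (indicator {- real n..real n} x)) powr r)"
    proof (rule nn_integral_eq_integral)
      have "integrable lborel (\<lambda>x. complex_of_real (norm (h x * complex_of_real (indicator {- real n..real n} x)) powr r))"
        using hgi unfolding hg[symmetric] by (simp add: mult.commute)
      then show "integrable lborel (\<lambda>x. norm (h x * complex_of_real (indicator {- real n..real n} x)) powr r)"
        by (simp only: complex_of_real_integrable_eq)
    qed simp
    also have "\<dots> \<le> ennreal (norm (LINT x|lborel. g x * h x))"
      by (simp only: mult.commute[of "g _"] hg integral_complex_of_real norm_of_real abs_ge_self ennreal_leI)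
    also have "(LINT x|lborel. g x * h x) = (LINT x|lborel. g x * (LINT y|lborel. f y * kernel m (x - y)))"
      by (simp add: h_def mult1_kernel[OF integrable fi])
    \<comment> \<open>Exchanging the integrals replaces convolution with \<open>kernel m\<close> by
      convolution with its reflection.\<close>
    also have "\<dots> = (LINT y|lborel. f y * (LINT x|lborel. g x * kernel m (x - y)))"
      using Fubini_bounded_kernel[OF fi gi, of "\<lambda>y x. kernel m (x - y)" "LINT t|lborel. norm (m t)"] kernel_bound[of m] by simp
    also have "\<dots> = (LINT y|lborel. f y * mult1 (\<lambda>x. m (- x)) g y)"
      by (simp add: mult1_kernel[OF mikhlin_symbol.integrable[OF reflected] gi] kernel_reflect)
    also have "ennreal (norm \<dots>) \<le> (\<integral>\<^sup>+y. ennreal (norm (f y * mult1 (\<lambda>x. m (- x)) g y)) \<partial>lborel)"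
    proof (rule integral_norm_bound_ennreal)
      show "integrable lborel (\<lambda>y. f y * mult1 (\<lambda>x. m (- x)) g y)"
      proof (rule integrable_mult_bounded[OF fi])
        fix y
        show "norm (mult1 (\<lambda>x. m (- x)) g y) \<le> (LINT t|lborel. norm (m (- t) * ft g t))"
          unfolding mult1_def by (rule order_trans[OF norm_inverse_2pi_mult_le ft_bound])
      qed measurable
    qed
    also have "\<dots> \<le> (\<integral>\<^sup>+y. ennreal ((1 / d) powr r) * ennreal (norm (f y) powr r) + ennreal (d powr q) * ennreal (norm (mult1 (\<lambda>x. m (- x)) g y) powr q) \<partial>lborel)"
    proof (intro nn_integral_mono)
      fix y
      let ?u = "norm (f y)" and ?v = "norm (mult1 (\<lambda>x. m (- x)) g y)"
      have "(1 / d * ?u) * (d * ?v) \<le> (1 / d * ?u) powr r / r + (d * ?v) powr q / q"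
        by (rule Youngs_inequality) (use r q1 d in auto)
      also have "\<dots> \<le> (1 / d * ?u) powr r / 1 + (d * ?v) powr q / 1"
        using r q1 by (intro add_mono divide_left_mono) auto
      also have "(1 / d * ?u) * (d * ?v) = ?u * ?v" using d by simp
      finally have "?u * ?v \<le> (1 / d) powr r * ?u powr r + d powr q * ?v powr q"
        using d(1) by (simp add: powr_mult powr_divide)
      then show "ennreal (norm (f y * mult1 (\<lambda>x. m (- x)) g y)) \<le> ennreal ((1 / d) powr r) * ennreal (?u powr r) + ennreal (d powr q) * ennreal (?v powr q)"
        by (simp add: norm_mult ennreal_mult[symmetric] ennreal_plus[symmetric] del: ennreal_plus)
    qed
    also have "\<dots> = ennreal ((1 / d) powr r) * Lr_int r f + ennreal (d powr q) * Lr_int q (mult1 (\<lambda>x. m (- x)) g)"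
      unfolding Lr_int_def by (simp add: nn_integral_add nn_integral_cmult)
    also have "\<dots> \<le> ennreal ((1 / d) powr r) * Lr_int r f + ennreal (d powr q) * (ennreal A * ?X)"
      using bd[OF gb] unfolding gq by (intro add_left_mono mult_left_mono) auto
    also have "ennreal (d powr q) * (ennreal A * ?X) \<le> ennreal (1 / 2) * ?X"
    proof -
      have "d powr q * A \<le> 1 / 2" using A unfolding d by (simp add: field_simps)
      then have "ennreal (d powr q * A) * ?X \<le> ennreal (1 / 2) * ?X"
        by (intro mult_right_mono ennreal_leI) auto
      then show ?thesis using A by (simp add: ennreal_mult mult.assoc)
    qed
    finally have X: "?X \<le> ennreal ((1 / d) powr r) * Lr_int r f + ennreal (1 / 2) * ?X"
      by (simp add: add_left_mono)
    obtain X where Xr: "?X = ennreal X" "X \<ge> 0"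
      using gfin unfolding gq by (cases ?X) auto
    have "Lr_int r f < \<infinity>" using bounded_support_Lr[OF f, of r] r by (simp add: Lr_iff)
    then obtain F where F: "Lr_int r f = ennreal F" "F \<ge> 0" by (cases "Lr_int r f") auto
    have "ennreal X \<le> ennreal ((1 / d) powr r * F + 1 / 2 * X)"
      using X unfolding Xr(1) F(1) using Xr(2) F(2)
      by (simp only: ennreal_mult[symmetric] ennreal_plus[symmetric] powr_ge_zero zero_le_divide_1_iff zero_le_numeral mult_nonneg_nonneg)
    then have "X \<le> (1 / d) powr r * F + 1 / 2 * X"
      by (rule ennreal_le_iff[THEN iffD1, rotated]) (use F(2) Xr(2) in auto)
    then have "X \<le> 2 * (1 / d) powr r * F" by simp
    then show ?thesis
      unfolding Xr(1) F(1) d(3) using F(2) by (simp add: ennreal_mult'[symmetric] ennreal_leI)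
  qed
  have lim: "(\<lambda>n. h x * complex_of_real (indicator {- real n..real n} x)) \<longlonglongrightarrow> h x" for x
  proof (rule tendsto_eventually)
    obtain N where N: "\<bar>x\<bar> \<le> real N" using real_arch_simple by blast
    show "\<forall>\<^sub>F n in sequentially. h x * complex_of_real (indicator {- real n..real n} x) = h x"
      by (rule eventually_sequentiallyI[of N]) (use N in \<open>auto simp: indicator_def\<close>)
  qed
  have "Lr_int r h \<le> liminf (\<lambda>n. Lr_int r (\<lambda>x. h x * complex_of_real (indicator {- real n..real n} x)))"
    by (rule Lr_int_Fatou) (use lim r in auto)
  also have "\<dots> \<le> liminf (\<lambda>n::nat. ennreal (2 * (2 * (A + 1)) powr (r / q)) * Lr_int r f)"
    by (intro Liminf_mono always_eventually allI trunc)
  also have "\<dots> = ennreal (2 * (2 * (A + 1)) powr (r / q)) * Lr_int r f"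
    by (simp add: Liminf_const)
  finally show ?thesis by (simp add: h_def)
qed

end

text \<open>The order of quantifiers is the point: \<open>A\<close> is fixed by \<open>r\<close>,
  \<open>B\<close> and \<open>C\<close> before the symbol and its decay constant \<open>E\<close>
  are given. This uniformity is what permits the regularisation to be removed.\<close>

lemma strong_type:
  assumes r: "r > 1"
  obtains A where "A \<ge> 0"
    "\<And>m m' E f. mikhlin_symbol m m' B C E \<Longrightarrow> step_fun f \<Longrightarrow> Lr_int r (mult1 m f) \<le> ennreal A * Lr_int r f"
proof -
  \<comment> \<open>\<open>weak_const\<close> written out, since it has to be named before any
    symbol is at hand.\<close>
  define W where "W = 2 * (4 * B\<^sup>2 + 2 + 4 * (3 * (2 * pi\<^sup>2 * (C + 3 * B)\<^sup>2 + pi / 2)))"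
  have W: "W \<ge> 0" unfolding W_def by simp
  define K where "K s = 2 powr s * (s * B\<^sup>2 / (2 - s) + s * W * 2 powr (s - 1) / (s - 1))" for s
  have K: "K s \<ge> 0" if "1 < s" "s < 2" for s
    unfolding K_def using that W by (intro mult_nonneg_nonneg add_nonneg_nonneg divide_nonneg_nonneg) auto
  have below: "Lr_int s (mult1 m f) \<le> ennreal (K s) * Lr_int s f"
    if "mikhlin_symbol m m' B C E" "step_fun f" "1 < s" "s < 2" for m m' E f s
    using mikhlin_symbol.strong_type_below_2[OF that] mikhlin_symbol.weak_const_def[OF that(1)] by (simp add: K_def W_def)
  consider "r < 2" | "r = 2" | "r > 2" by linarith
  then show ?thesis
  proof cases
    case 1
    then show ?thesis using below r K that[of "K r"] by blast
  next
    case 2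
    have "Lr_int 2 (mult1 m f) \<le> ennreal (B\<^sup>2) * Lr_int 2 f" if "mikhlin_symbol m m' B C E" "step_fun f" for m m' E f
      using mult1_L2_bound[OF mikhlin_symbol.integrable[OF that(1)] mikhlin_symbol.bound[OF that(1)]]
        bounded_support_integrable[OF step_fun_bounded_support[OF that(2)]] by blast
    then show ?thesis using 2 that[of "B\<^sup>2"] by auto
  next
    case 3
    define q where "q = r / (r - 1)"
    have q: "1 < q" "q < 2" using 3 by (auto simp: q_def field_simps)
    define A where "A = K q * 2 powr q"
    have A: "A \<ge> 0" unfolding A_def using K[OF q] by simp
    have "Lr_int r (mult1 m f) \<le> ennreal (2 * (2 * (A + 1)) powr (r / q)) * Lr_int r f"
      if ms: "mikhlin_symbol m m' B C E" and f: "step_fun f" for m m' E f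
    proof (rule mikhlin_symbol.duality[OF ms 3 q_def A _ step_fun_bounded_support[OF f]])
      fix g assume g: "bounded_support g"
      note refl = mikhlin_symbol.reflected[OF ms]
      show "Lr_int q (mult1 (\<lambda>x. m (- x)) g) \<le> ennreal A * Lr_int q g"
        unfolding A_def by (rule mikhlin_symbol.bounded_support_ext[OF refl _ g]) (use below[OF refl _ q] q K[OF q] in auto)
    qed
    then show ?thesis
      by (intro that[of "2 * (2 * (A + 1)) powr (r / q)"]) auto
  qed
qed

lemma Lr_tendsto_mult_bounded:
  assumes u: "Lr_tendsto r u f" and r: "r > 0" and k: "k \<in> borel_measurable borel" "\<And>x. norm (k x) \<le> K"
  shows "Lr_tendsto r (\<lambda>n x. k x * u n x) (\<lambda>x. k x * f x)"
proof (rule Lr_tendsto_dominated[OF u r])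
  fix n
  have [measurable]: "f \<in> borel_measurable borel" "u n \<in> borel_measurable borel"
    using Lr_tendstoD(1,2)[OF u r] by (auto dest: LrD)
  show "Lr_int r (\<lambda>x. k x * u n x - k x * f x) \<le> ennreal (K powr r) * Lr_int r (\<lambda>x. u n x - f x)"
    unfolding right_diff_distrib[symmetric] by (rule Lr_int_mult_bounded) (use k r in auto)
  show "(\<lambda>x. k x * u n x) \<in> Lr r"
    by (rule Lr_mult_bounded[OF Lr_tendstoD(1)[OF u r] k]) (use r in simp)
  show "(\<lambda>x. k x * f x) \<in> Lr r"
    by (rule Lr_mult_bounded[OF Lr_tendstoD(2)[OF u r] k]) (use r in simp)
qed

section \<open>Mikhlin multipliers on \<open>L\<^sup>r\<close>\<close>

text \<open>\<open>mikhlin_symbol\<close> without the two decay conditions, so the symbol need not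
  be integrable and there may be no kernel function.\<close>

locale mikhlin_function =
  fixes m m' :: "real \<Rightarrow> complex" and B C :: real
  assumes deriv: "x \<noteq> 0 \<Longrightarrow> (m has_vector_derivative m' x) (at x)"
    and cont_deriv: "x \<noteq> 0 \<Longrightarrow> isCont m' x"
    and bound: "norm (m x) \<le> B"
    and deriv_bound: "x \<noteq> 0 \<Longrightarrow> norm (m' x) \<le> C / \<bar>x\<bar>"
    and meas [measurable]: "m \<in> borel_measurable borel" "m' \<in> borel_measurable borel"
begin

lemma B_nonneg: "B \<ge> 0"
  using bound[of 0] norm_ge_zero order_trans by blast

lemma C_nonneg: "C \<ge> 0"
  using order_trans[OF norm_ge_zero deriv_bound[of 1]] by simp

text \<open>The derivative of the regularising factor is at most \<open>2 / \<bar>x\<bar>\<close>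
  times the factor itself, uniformly in \<open>e\<close>, whence \<open>C + 2 * B\<close>. Only the
  decay constant depends on \<open>e\<close>: for \<open>e \<le> 1\<close> the factor is at most
  \<open>1 / e\<close> times \<open>inverse (1 + x\<^sup>2)\<close>.\<close>

lemma regularised:
  assumes e: "0 < e" "e \<le> 1"
  shows "mikhlin_symbol (\<lambda>x. m x * complex_of_real (inverse (1 + e * x\<^sup>2)))
    (\<lambda>x. m x * complex_of_real (- (2 * e * x * (inverse (1 + e * x\<^sup>2))\<^sup>2)) + m' x * complex_of_real (inverse (1 + e * x\<^sup>2)))
    B (C + 2 * B) ((C + 2 * B) / e)"
proof
  fix x :: real
  define w where "w = inverse (1 + e * x\<^sup>2)"
  have p: "1 + e * x\<^sup>2 > 0" for x using e by (simp add: add_pos_nonneg)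
  have w: "0 \<le> w" "w \<le> 1"
    using p[of x] e by (auto simp: w_def inverse_le_1_iff)
  have we: "w \<le> 1 / e * inverse (1 + x\<^sup>2)"
  proof -
    have "e * (1 + x\<^sup>2) \<le> 1 + e * x\<^sup>2" using e by (simp add: distrib_left)
    then have "inverse (1 + e * x\<^sup>2) \<le> inverse (e * (1 + x\<^sup>2))"
      using e by (intro le_imp_inverse_le) (auto simp: add_pos_nonneg)
    then show ?thesis by (simp add: w_def divide_inverse)
  qed
  have exw: "e * x\<^sup>2 * w \<le> 1"
    using p[of x] by (simp add: w_def divide_simps)
  have b1: "norm (m x * complex_of_real (inverse (1 + e * x\<^sup>2))) = norm (m x) * w"
    unfolding norm_mult norm_of_real w_def[symmetric] using w by simp
  show "norm (m x * complex_of_real (inverse (1 + e * x\<^sup>2))) \<le> B"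
    unfolding b1 using mult_mono[OF bound[of x] w(2)] B_nonneg w by simp
  have "norm (m x) * w \<le> (C + 2 * B) * (1 / e * inverse (1 + x\<^sup>2))"
    using bound[of x] C_nonneg B_nonneg w by (intro mult_mono we) auto
  then show "norm (m x * complex_of_real (inverse (1 + e * x\<^sup>2))) \<le> (C + 2 * B) / e * inverse (1 + x\<^sup>2)"
    unfolding b1 by simp
  assume x: "x \<noteq> 0"
  have d: "((\<lambda>x. complex_of_real (inverse (1 + e * x\<^sup>2))) has_vector_derivative complex_of_real (- (2 * e * x * (inverse (1 + e * x\<^sup>2))\<^sup>2))) (at x)"
  proof -
    have "((\<lambda>x. inverse (1 + e * x\<^sup>2)) has_real_derivative - (2 * e * x * (inverse (1 + e * x\<^sup>2))\<^sup>2)) (at x)"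
      using p[of x] by (auto intro!: derivative_eq_intros simp: power2_eq_square)
    then show ?thesis
      by (intro has_vector_derivative_of_real) (simp add: has_real_derivative_iff_has_vector_derivative)
  qed
  show "((\<lambda>x. m x * complex_of_real (inverse (1 + e * x\<^sup>2))) has_vector_derivative
      m x * complex_of_real (- (2 * e * x * (inverse (1 + e * x\<^sup>2))\<^sup>2)) + m' x * complex_of_real (inverse (1 + e * x\<^sup>2))) (at x)"
    by (rule has_vector_derivative_mult[OF deriv[OF x] d])
  show "isCont (\<lambda>x. m x * complex_of_real (- (2 * e * x * (inverse (1 + e * x\<^sup>2))\<^sup>2)) + m' x * complex_of_real (inverse (1 + e * x\<^sup>2))) x"
    using p[of x] has_vector_derivative_continuous[OF deriv[OF x]] cont_deriv[OF x] by (intro continuous_intros) auto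
  have main: "norm (m x * complex_of_real (- (2 * e * x * (inverse (1 + e * x\<^sup>2))\<^sup>2)) + m' x * complex_of_real (inverse (1 + e * x\<^sup>2))) \<le> (C + 2 * B) / \<bar>x\<bar> * w"
  proof -
    have 1: "norm (m x * complex_of_real (- (2 * e * x * w\<^sup>2))) \<le> B * (2 / \<bar>x\<bar> * w)"
    proof -
      have "\<bar>- (2 * e * x * w\<^sup>2)\<bar> = 2 / \<bar>x\<bar> * w * (e * x\<^sup>2 * w)"
        using e w x by (simp add: abs_mult power2_eq_square field_simps abs_mult_self_eq)
      also have "\<dots> \<le> 2 / \<bar>x\<bar> * w * 1"
        by (intro mult_left_mono exw) (use w in auto)
      finally show ?thesis
        unfolding norm_mult norm_of_real using B_nonneg by (intro mult_mono bound) auto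
    qed
    have 2: "norm (m' x * complex_of_real w) \<le> C / \<bar>x\<bar> * w"
      unfolding norm_mult norm_of_real abs_of_nonneg[OF w(1)] by (rule mult_right_mono[OF deriv_bound[OF x] w(1)])
    have "norm (m x * complex_of_real (- (2 * e * x * w\<^sup>2)) + m' x * complex_of_real w) \<le> B * (2 / \<bar>x\<bar> * w) + C / \<bar>x\<bar> * w"
      by (rule order_trans[OF norm_triangle_ineq add_mono[OF 1 2]])
    also have "\<dots> = (C + 2 * B) / \<bar>x\<bar> * w"
      using x by (simp add: field_simps)
    finally show ?thesis by (simp only: w_def)
  qed
  have nn: "(C + 2 * B) / \<bar>x\<bar> \<ge> 0" using B_nonneg C_nonneg by simp
  show "norm (m x * complex_of_real (- (2 * e * x * (inverse (1 + e * x\<^sup>2))\<^sup>2)) + m' x * complex_of_real (inverse (1 + e * x\<^sup>2))) \<le> (C + 2 * B) / \<bar>x\<bar>"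
    using order_trans[OF main mult_left_mono[OF w(2) nn]] by simp
  show "norm (m x * complex_of_real (- (2 * e * x * (inverse (1 + e * x\<^sup>2))\<^sup>2)) + m' x * complex_of_real (inverse (1 + e * x\<^sup>2))) \<le> (C + 2 * B) / e * inverse (1 + x\<^sup>2) / \<bar>x\<bar>"
    using order_trans[OF main mult_left_mono[OF we nn]] by (simp add: mult_ac)
qed measurable

text \<open>The regularised symbols converge pointwise and boundedly to \<open>m\<close>, so the
  images \<open>mult1 (k n) f\<close> converge in L^2 to the multiplier image. Their common L^r
  bound survives by Fatou's lemma.\<close>

lemma mult2_step_bound:
  assumes r: "r > 1"
  obtains A where "A \<ge> 0" "\<And>f. step_fun f \<Longrightarrow> \<exists>g. mult2 m f g \<and> Lr_int r g \<le> ennreal A * Lr_int r f"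
proof -
  obtain A where A: "A \<ge> 0"
    "\<And>k k' E f. mikhlin_symbol k k' B (C + 2 * B) E \<Longrightarrow> step_fun f \<Longrightarrow> Lr_int r (mult1 k f) \<le> ennreal A * Lr_int r f"
    using strong_type[OF r, of B "C + 2 * B"] by metis
  define e where "e n = 1 / (real n + 1)" for n :: nat
  have e: "0 < e n" "e n \<le> 1" for n by (auto simp: e_def)
  have e0: "e \<longlonglongrightarrow> 0" unfolding e_def by real_asymp
  define k where "k n x = m x * complex_of_real (inverse (1 + e n * x\<^sup>2))" for n x
  have kb: "norm (k n x) \<le> B" for n x
    using mikhlin_symbol.bound[OF regularised[OF e]] unfolding k_def .
  have ki: "integrable lborel (k n)" for n
    using mikhlin_symbol.integrable[OF regularised[OF e]] unfolding k_def .
  have [measurable]: "k n \<in> borel_measurable borel" for n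
    unfolding k_def by measurable
  have "\<exists>g. mult2 m f g \<and> Lr_int r g \<le> ennreal A * Lr_int r f" if f: "step_fun f" for f
  proof -
    have bf: "bounded_support f" using f by (rule step_fun_bounded_support)
    have f12: "f \<in> Lr 1" "f \<in> Lr 2" using bf by (auto intro: bounded_support_Lr)
    have fi: "integrable lborel f" using bf by (rule bounded_support_integrable)
    have F2: "ft f \<in> Lr 2" using f12 by (rule ft_Lr2)
    have [measurable]: "ft f \<in> borel_measurable borel" using F2 by (rule LrD)
    obtain g where g: "ft2 g (\<lambda>x. m x * ft f x)"
      by (rule ft2_inverse_exists[OF Lr_mult_bounded[OF F2 meas(1) bound]]) auto
    have Tn: "ft2 (mult1 (k n) f) (\<lambda>x. k n x * ft f x)" for n
    proof -
      have "(\<lambda>x. k n x * ft f x) \<in> Lr 1"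
        using mult1_integrable[OF ki fi] by (simp add: Lr_1_iff)
      moreover have "(\<lambda>x. k n x * ft f x) \<in> Lr 2"
        by (rule Lr_mult_bounded[OF F2 _ kb]) auto
      ultimately have "ft2 (\<lambda>x. k n x * ft f x) (ft (\<lambda>x. k n x * ft f x))"
        by (rule ft2_ft)
      from ft2_inversion[OF this] show ?thesis
        by (simp only: mult1_def[abs_def])
    qed
    have "Lr_tendsto 2 (\<lambda>n x. k n x * ft f x) (\<lambda>x. m x * ft f x)"
    proof (rule Lr_tendsto_dct)
      show "(\<lambda>x. complex_of_real B * ft f x) \<in> Lr 2"
        by (rule Lr_cmult[OF F2])
      have "(\<lambda>n. k n x * ft f x) \<longlonglongrightarrow> m x * complex_of_real (inverse (1 + 0 * x\<^sup>2)) * ft f x" for x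
        unfolding k_def by (intro tendsto_intros e0) auto
      then show "AE x in lborel. (\<lambda>n. k n x * ft f x) \<longlonglongrightarrow> m x * ft f x" by simp
      show "norm (k n x * ft f x) \<le> norm (complex_of_real B * ft f x)" for n x
        unfolding norm_mult using kb[of n x] by (intro mult_right_mono) auto
      show "norm (m x * ft f x) \<le> norm (complex_of_real B * ft f x)" for x
        unfolding norm_mult using bound[of x] by (intro mult_right_mono) auto
    qed auto
    then have lim: "Lr_tendsto 2 (\<lambda>n. mult1 (k n) f) g"
      by (rule Lr_tendsto_dominated) (use ft2_Lr(1)[OF Tn] ft2_Lr(1)[OF g] ft2_inverse_bound[OF ft2_diff[OF Tn g]] in auto)
    have le: "Lr_int r (mult1 (k n) f) \<le> ennreal A * Lr_int r f" for n
      using A(2)[OF regularised[OF e] f] unfolding k_def .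
    have "Lr_int r g \<le> ennreal A * Lr_int r f"
      by (rule Lr_int_Fatou_le[OF lim _ _ le tendsto_const]) (use r in auto)
    moreover have "mult2 m f g"
      unfolding mult2_def using ft2_ft[OF f12] g by blast
    ultimately show ?thesis by blast
  qed
  then show ?thesis using that[OF A(1)] by blast
qed

text \<open>The step functions converge to \<open>f\<close> in L^r and in L^2 at once; the second
  convergence sends their images to \<open>g\<close>, and the first controls the bound.\<close>

lemma mult2_Lr_bound:
  assumes r: "r > 1"
  obtains A where "A \<ge> 0" "\<And>f g. f \<in> Lr r \<Longrightarrow> mult2 m f g \<Longrightarrow> Lr_int r g \<le> ennreal A * Lr_int r f"
proof -
  obtain A where A: "A \<ge> 0" "\<And>f. step_fun f \<Longrightarrow> \<exists>g. mult2 m f g \<and> Lr_int r g \<le> ennreal A * Lr_int r f"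
    using mult2_step_bound[OF r] by blast
  have "Lr_int r g \<le> ennreal (A * 2 powr r) * Lr_int r f" if f: "f \<in> Lr r" and fg: "mult2 m f g" for f g
  proof -
    obtain s where s: "\<And>n. step_fun (s n)" "Lr_tendsto r s f" "Lr_tendsto 2 s f"
      using step_fun_dense[OF f mult2_Lr(1)[OF fg]] r by auto
    obtain v where v: "\<And>n. mult2 m (s n) (v n)" "\<And>n. Lr_int r (v n) \<le> ennreal A * Lr_int r (s n)"
      using A(2)[OF s(1)] by metis
    have "Lr_tendsto 2 v g"
      by (rule mult2_tendsto[OF v(1) s(3) fg bound])
    then show ?thesis
      by (rule Lr_int_le_transfer[OF _ s(2) _ _ _ A(1) v(2)]) (use r in auto)
  qed
  then show ?thesis
    using that[of "A * 2 powr r"] A(1) by auto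
qed

text \<open>The closure of the graph of \<open>mult2 m\<close> in L^r. It reaches functions outside
  \<open>Lr 2\<close>, on which \<open>mult2\<close> says nothing, and linearity and boundedness
  pass to the closure.\<close>

definition mult_lim :: "real \<Rightarrow> (real \<Rightarrow> complex) \<Rightarrow> (real \<Rightarrow> complex) \<Rightarrow> bool" where
  "mult_lim r f h \<longleftrightarrow> (\<exists>u v. (\<forall>n. mult2 m (u n) (v n)) \<and> Lr_tendsto r u f \<and> Lr_tendsto r v h)"

lemma mult_lim_add:
  assumes "mult_lim r f h" "mult_lim r f' h'" "r > 1"
  shows "mult_lim r (\<lambda>x. f x + f' x) (\<lambda>x. h x + h' x)"
proof -
  obtain u v where 1: "\<forall>n. mult2 m (u n) (v n)" "Lr_tendsto r u f" "Lr_tendsto r v h"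
    using assms(1) unfolding mult_lim_def by blast
  obtain u' v' where 2: "\<forall>n. mult2 m (u' n) (v' n)" "Lr_tendsto r u' f'" "Lr_tendsto r v' h'"
    using assms(2) unfolding mult_lim_def by blast
  have r: "r > 0" using assms(3) by simp
  have "\<forall>n. mult2 m (\<lambda>x. u n x + u' n x) (\<lambda>x. v n x + v' n x)"
    using 1(1) 2(1) by (blast intro: mult2_add)
  with Lr_tendsto_add[OF 1(2) 2(2) r] Lr_tendsto_add[OF 1(3) 2(3) r] show ?thesis
    unfolding mult_lim_def by (intro exI[of _ "\<lambda>n x. u n x + u' n x"] exI[of _ "\<lambda>n x. v n x + v' n x"]) simp
qed

lemma mult_lim_cmult:
  assumes "mult_lim r f h" "r > 1"
  shows "mult_lim r (\<lambda>x. z * f x) (\<lambda>x. z * h x)"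
proof -
  obtain u v where 1: "\<forall>n. mult2 m (u n) (v n)" "Lr_tendsto r u f" "Lr_tendsto r v h"
    using assms(1) unfolding mult_lim_def by blast
  have r: "r > 0" using assms(2) by simp
  have "\<forall>n. mult2 m (\<lambda>x. z * u n x) (\<lambda>x. z * v n x)"
    using 1(1) by (blast intro: mult2_cmult)
  with Lr_tendsto_cmult[OF 1(2) r] Lr_tendsto_cmult[OF 1(3) r] show ?thesis
    unfolding mult_lim_def by (intro exI[of _ "\<lambda>n x. z * u n x"] exI[of _ "\<lambda>n x. z * v n x"]) simp
qed

lemma mult_lim_bound:
  assumes A: "A \<ge> 0" "\<And>f g. f \<in> Lr r \<Longrightarrow> mult2 m f g \<Longrightarrow> Lr_int r g \<le> ennreal A * Lr_int r f"
    and fh: "mult_lim r f h" and r: "r > 1"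
  shows "Lr_int r h \<le> ennreal (A * 2 powr r) * Lr_int r f"
proof -
  obtain u v where 1: "\<And>n. mult2 m (u n) (v n)" "Lr_tendsto r u f" "Lr_tendsto r v h"
    using fh unfolding mult_lim_def by blast
  have r0: "r > 0" using r by simp
  show ?thesis
    by (rule Lr_int_le_transfer[OF 1(3,2) r0 r0 r0 A(1)])
       (rule A(2)[OF Lr_tendstoD(1)[OF 1(2) r0] 1(1)])
qed

lemma mult_lim_Lr: "mult_lim r f h \<Longrightarrow> f \<in> Lr r" "mult_lim r f h \<Longrightarrow> h \<in> Lr r"
  unfolding mult_lim_def Lr_tendsto_def by blast+

theorem extension:
  assumes r: "r > 1"
  obtains T where "bounded_linear_Lr r T" "\<And>f. f \<in> Lr 2 \<inter> Lr r \<Longrightarrow> mult2 m f (T f)"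
proof -
  have r0: "r > 0" "r \<ge> 1" using r by auto
  obtain A where A: "A \<ge> 0" "\<And>f g. f \<in> Lr r \<Longrightarrow> mult2 m f g \<Longrightarrow> Lr_int r g \<le> ennreal A * Lr_int r f"
    using mult2_Lr_bound[OF r] by blast
  have in_Lr: "g \<in> Lr r" if "f \<in> Lr r" "mult2 m f g" for f g
    using A(2)[OF that] that LrD(1)[OF mult2_Lr(2)[OF that(2)]]
    by (auto simp: Lr_iff ennreal_mult_less_top intro: order.strict_trans1)
  \<comment> \<open>On the intersection an exact multiplier image is chosen, so that the second
    claim holds for \<open>T\<close> itself; elsewhere a limit is chosen. Values of either kind
    satisfy \<open>mult_lim\<close>, from which linearity and the bound are derived.\<close>
  define T where "T f = (if f \<in> Lr 2 \<inter> Lr r then SOME g. mult2 m f g else SOME h. mult_lim r f h)" for f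
  have T2: "mult2 m f (T f)" if "f \<in> Lr 2 \<inter> Lr r" for f
  proof -
    have "\<exists>g. mult2 m f g"
      using mult2_exists[OF _ meas(1) bound] that by (metis IntD1)
    then show ?thesis
      unfolding T_def using that by (simp add: someI_ex)
  qed
  have TR: "mult_lim r f (T f)" if f: "f \<in> Lr r" for f
  proof (cases "f \<in> Lr 2 \<inter> Lr r")
    case True
    have "T f \<in> Lr r" using in_Lr[OF f T2[OF True]] .
    then show ?thesis
      unfolding mult_lim_def using T2[OF True] Lr_tendsto_const[OF f r0(1)] Lr_tendsto_const[of "T f", OF _ r0(1)]
      by (intro exI[of _ "\<lambda>n. f"] exI[of _ "\<lambda>n. T f"]) simp
  next
    case False
    obtain s where s: "\<And>n. step_fun (s n)" "Lr_tendsto r s f"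
      using step_fun_dense[OF f f r0(2) r0(2)] by metis
    have s2: "s n \<in> Lr 2" "s n \<in> Lr r" for n
      using bounded_support_Lr[OF step_fun_bounded_support[OF s(1)]] r0 by auto
    have "\<exists>g. mult2 m (s n) g" for n
      using mult2_exists[OF s2(1) meas(1) bound] by metis
    then obtain v where v: "\<And>n. mult2 m (s n) (v n)" by metis
    have vr: "v n \<in> Lr r" for n using in_Lr[OF s2(2) v] .
    obtain h where "Lr_tendsto r v h"
      by (rule Lr_complete_dominated[OF s(2) r0(1) vr r0(1) A(1)])
         (rule A(2)[OF Lr_diff[OF s2(2) s2(2) r0(1)] mult2_diff[OF v v]])
    then have "\<exists>h. mult_lim r f h"
      unfolding mult_lim_def using v s(2) by blast
    then show ?thesis
      unfolding T_def if_not_P[OF False] by (rule someI_ex)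
  qed
  \<comment> \<open>The difference of two limits is related to the zero function, and the bound for
    \<open>mult_lim\<close> forces it to vanish a.e.\<close>
  have uniq: "AE x in lborel. h x = h' x" if "mult_lim r f h" "mult_lim r f h'" for f h h'
  proof -
    have "mult_lim r (\<lambda>x. f x + (-1) * f x) (\<lambda>x. h x + (-1) * h' x)"
      by (intro mult_lim_add mult_lim_cmult that r)
    from mult_lim_bound[OF A this r] have "Lr_int r (\<lambda>x. h x - h' x) \<le> ennreal (A * 2 powr r) * Lr_int r (\<lambda>x. 0)"
      by simp
    also have "Lr_int r (\<lambda>x. 0) = 0" by (simp add: Lr_int_def)
    finally have "Lr_int r (\<lambda>x. h x - h' x) = 0" by simp
    moreover have "(\<lambda>x. h x - h' x) \<in> borel_measurable borel"
      using that[THEN mult_lim_Lr(2), THEN LrD(1)] by measurable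
    ultimately show ?thesis
      using Lr_int_eq_0_iff[of "\<lambda>x. h x - h' x" r] by auto
  qed
  have "bounded_linear_Lr r T"
    unfolding bounded_linear_Lr_def
  proof (intro conjI ballI allI exI)
    fix f assume f: "f \<in> Lr r"
    show Tf: "T f \<in> Lr r" using mult_lim_Lr(2)[OF TR[OF f]] .
    show "AE x in lborel. T (\<lambda>y. f y + g y) x = T f x + T g x" if g: "g \<in> Lr r" for g
      by (rule uniq[OF TR[OF Lr_add[OF f g r0(1)]] mult_lim_add[OF TR[OF f] TR[OF g] r]])
    show "AE x in lborel. T (\<lambda>y. z * f y) x = z * T f x" for z
      by (rule uniq[OF TR[OF Lr_cmult[OF f]] mult_lim_cmult[OF TR[OF f] r]])
    have "enn2real (Lr_int r (T f)) \<le> enn2real (ennreal (A * 2 powr r) * Lr_int r f)"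
      using f by (intro enn2real_mono mult_lim_bound[OF A TR[OF f] r]) (auto simp: Lr_iff ennreal_mult_less_top)
    also have "\<dots> = A * 2 powr r * enn2real (Lr_int r f)"
      using A(1) by (simp add: enn2real_mult)
    finally have "enn2real (Lr_int r (T f)) powr (1 / r) \<le> (A * 2 powr r * enn2real (Lr_int r f)) powr (1 / r)"
      using r0 by (intro powr_mono2) auto
    then show "Lr_norm r (T f) \<le> (A * 2 powr r) powr (1 / r) * Lr_norm r f"
      unfolding Lr_norm_eq[OF f] Lr_norm_eq[OF Tf] using A(1) by (simp add: powr_mult)
  qed
  then show ?thesis using that T2 by blast
qed

end

section \<open>The special affine Fourier transform\<close>

text \<open>One shape for two factors: with parameters \<open>a b p\<close> it modulates the input,
  with \<open>d b (b * q - d * p)\<close> the output.\<close>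

definition chirp :: "real \<Rightarrow> real \<Rightarrow> real \<Rightarrow> real \<Rightarrow> complex" where
  "chirp a b p t = cis (pi / b * (a * t\<^sup>2 + 2 * p * t))"

lemma norm_chirp [simp]: "norm (chirp a b p t) = 1"
  by (simp add: chirp_def)

lemma chirp_measurable [measurable]: "chirp a b p \<in> borel_measurable borel"
  unfolding chirp_def by measurable

lemma cnj_chirp_mult [simp]: "cnj (chirp a b p t) * (chirp a b p t * z) = z"
    "chirp a b p t * (cnj (chirp a b p t) * z) = z"
  unfolding chirp_def cis_cnj mult.assoc[symmetric] cis_mult by auto

text \<open>Only the term \<open>- 2 * \<omega> * t\<close> of the exponent couples the variables,
  and it is a Fourier exponential of frequency \<open>2 * pi / b * \<omega>\<close>. The rest
  separates into a chirp in \<open>t\<close> and a chirp in \<open>\<omega>\<close>.\<close>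

lemma saft_eq_ft:
  assumes "b \<noteq> 0"
  shows "saft (a, b, c, d, p, q) f \<omega> = complex_of_real (1 / sqrt \<bar>b\<bar>) * chirp d b (b * q - d * p) \<omega> *
    ft (\<lambda>t. chirp a b p t * f t) (2 * pi / b * \<omega>)"
proof -
  have e: "exp (of_real pi * \<i> / of_real b * of_real s) = cis (pi / b * s)" for s
    by (simp add: cis_conv_exp mult_ac)
  have "f t * exp (of_real pi * \<i> / of_real b * of_real (a * t\<^sup>2 + 2 * p * t - 2 * \<omega> * t + 2 * (b * q - d * p) * \<omega> + d * \<omega>\<^sup>2))
      = chirp d b (b * q - d * p) \<omega> * (chirp a b p t * f t * cis (- (2 * pi / b * \<omega> * t)))" for t
  proof -
    have "pi / b * (a * t\<^sup>2 + 2 * p * t - 2 * \<omega> * t + 2 * (b * q - d * p) * \<omega> + d * \<omega>\<^sup>2)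
        = pi / b * (d * \<omega>\<^sup>2 + 2 * (b * q - d * p) * \<omega>) + (pi / b * (a * t\<^sup>2 + 2 * p * t) + - (2 * pi / b * \<omega> * t))"
      by (simp add: algebra_simps add_divide_distrib diff_divide_distrib)
    then have "cis (pi / b * (a * t\<^sup>2 + 2 * p * t - 2 * \<omega> * t + 2 * (b * q - d * p) * \<omega> + d * \<omega>\<^sup>2))
        = chirp d b (b * q - d * p) \<omega> * (chirp a b p t * cis (- (2 * pi / b * \<omega> * t)))"
      unfolding chirp_def by (simp only: cis_mult)
    then show ?thesis
      unfolding e by (simp only: mult_ac)
  qed
  then show ?thesis
    by (simp only: saft.simps ft_def integral_mult_right_zero mult.assoc)
qed

context
  fixes a b c d p q :: real
  assumes b: "b \<noteq> 0"
begin

private abbreviation (input) "A \<equiv> (a, b, c, d, p, q)"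
private abbreviation (input) "ch \<equiv> chirp a b p"
private abbreviation (input) "\<eta> \<equiv> \<lambda>\<omega>. complex_of_real (1 / sqrt \<bar>b\<bar>) * chirp d b (b * q - d * p) \<omega>"

lemma norm_cnj_chirp: "norm (cnj (ch t)) \<le> 1"
  by simp

lemma is_saft_L2_of_ft2:
  assumes "ft2 (\<lambda>t. ch t * f t) F"
  shows "is_saft_L2 A f (\<lambda>\<omega>. \<eta> \<omega> * F (2 * pi / b * \<omega>))"
proof -
  obtain u where u: "\<And>n. u n \<in> Lr 1" "\<And>n. u n \<in> Lr 2" "Lr_tendsto 2 u (\<lambda>t. ch t * f t)" "Lr_tendsto 2 (\<lambda>n. ft (u n)) F"
    using assms unfolding ft2_def by blast
  have cm: "(\<lambda>t. cnj (ch t)) \<in> borel_measurable borel" by measurable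
  define v where "v n t = cnj (ch t) * u n t" for n t
  have "v n \<in> Lr 1 \<inter> Lr 2" for n
    unfolding v_def using Lr_mult_bounded[OF u(1) cm norm_cnj_chirp] Lr_mult_bounded[OF u(2) cm norm_cnj_chirp] by simp
  moreover have "Lr_tendsto 2 v f"
  proof -
    have "Lr_tendsto 2 (\<lambda>n t. cnj (ch t) * u n t) (\<lambda>t. cnj (ch t) * (ch t * f t))"
      by (rule Lr_tendsto_mult_bounded[OF u(3) _ cm norm_cnj_chirp]) simp
    then show ?thesis by (simp add: v_def[abs_def])
  qed
  moreover have "Lr_tendsto 2 (\<lambda>n. saft A (v n)) (\<lambda>\<omega>. \<eta> \<omega> * F (2 * pi / b * \<omega>))"
  proof -
    have "Lr_tendsto 2 (\<lambda>n \<omega>. ft (u n) (2 * pi / b * \<omega>)) (\<lambda>\<omega>. F (2 * pi / b * \<omega>))"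
      by (rule Lr_tendsto_scale[OF u(4)]) (use b in auto)
    then have "Lr_tendsto 2 (\<lambda>n \<omega>. \<eta> \<omega> * ft (u n) (2 * pi / b * \<omega>)) (\<lambda>\<omega>. \<eta> \<omega> * F (2 * pi / b * \<omega>))"
      by (rule Lr_tendsto_mult_bounded[where K="1 / sqrt \<bar>b\<bar>"]) (auto simp: norm_mult norm_divide)
    moreover have "saft A (v n) = (\<lambda>\<omega>. \<eta> \<omega> * ft (u n) (2 * pi / b * \<omega>))" for n
      by (rule ext) (simp only: saft_eq_ft[OF b] v_def cnj_chirp_mult)
    ultimately show ?thesis by simp
  qed
  ultimately show ?thesis
    unfolding is_saft_L2_def by blast
qed

text \<open>This direction carries uniqueness from \<open>ft2\<close> over to
  \<open>is_saft_L2\<close>, which pins down the choice made in \<open>saft_L2\<close> up to null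
  sets.\<close>

lemma ft2_of_is_saft_L2:
  assumes "is_saft_L2 A f F"
  shows "ft2 (\<lambda>t. ch t * f t) (\<lambda>\<xi>. inverse (\<eta> (b / (2 * pi) * \<xi>)) * F (b / (2 * pi) * \<xi>))"
proof -
  obtain v where v: "\<And>n. v n \<in> Lr 1 \<inter> Lr 2" "Lr_tendsto 2 v f" "Lr_tendsto 2 (\<lambda>n. saft A (v n)) F"
    using assms unfolding is_saft_L2_def by blast
  have \<eta>0: "\<eta> \<omega> \<noteq> 0" for \<omega>
    using b norm_chirp[of d b "b * q - d * p" \<omega>] by (auto simp del: norm_chirp)
  have norm_chirp_le: "norm (ch t) \<le> 1" for t by simp
  show ?thesis
  proof (rule ft2I[of "\<lambda>n t. ch t * v n t"])
    show "(\<lambda>t. ch t * v n t) \<in> Lr 1" "(\<lambda>t. ch t * v n t) \<in> Lr 2" for n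
      using v(1)[of n] by (auto intro!: Lr_mult_bounded[OF _ _ norm_chirp_le])
    show "Lr_tendsto 2 (\<lambda>n t. ch t * v n t) (\<lambda>t. ch t * f t)"
      by (rule Lr_tendsto_mult_bounded[OF v(2) _ _ norm_chirp_le]) auto
    have "Lr_tendsto 2 (\<lambda>n \<xi>. saft A (v n) (b / (2 * pi) * \<xi>)) (\<lambda>\<xi>. F (b / (2 * pi) * \<xi>))"
      by (rule Lr_tendsto_scale[OF v(3)]) (use b in auto)
    then have "Lr_tendsto 2 (\<lambda>n \<xi>. inverse (\<eta> (b / (2 * pi) * \<xi>)) * saft A (v n) (b / (2 * pi) * \<xi>)) (\<lambda>\<xi>. inverse (\<eta> (b / (2 * pi) * \<xi>)) * F (b / (2 * pi) * \<xi>))"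
      by (rule Lr_tendsto_mult_bounded[where K="sqrt \<bar>b\<bar>"]) (auto simp: norm_mult norm_divide norm_inverse)
    moreover have "inverse (\<eta> (b / (2 * pi) * \<xi>)) * saft A (v n) (b / (2 * pi) * \<xi>) = ft (\<lambda>t. ch t * v n t) \<xi>" for n \<xi>
    proof -
      have "inverse (\<eta> (b / (2 * pi) * \<xi>)) * saft A (v n) (b / (2 * pi) * \<xi>) = ft (\<lambda>t. ch t * v n t) (2 * pi / b * (b / (2 * pi) * \<xi>))"
        unfolding saft_eq_ft[OF b] mult.assoc[symmetric] using \<eta>0[of "b / (2 * pi) * \<xi>"] by (simp add: field_simps)
      then show ?thesis using b by simp
    qed
    ultimately show "Lr_tendsto 2 (\<lambda>n. ft (\<lambda>t. ch t * v n t)) (\<lambda>\<xi>. inverse (\<eta> (b / (2 * pi) * \<xi>)) * F (b / (2 * pi) * \<xi>))"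
      by simp
  qed
qed

lemma is_saft_L2_unique:
  assumes F: "is_saft_L2 A f F" and G: "is_saft_L2 A f G"
  shows "AE \<omega> in lborel. F \<omega> = G \<omega>"
proof -
  have FG: "F \<in> Lr 2" "G \<in> Lr 2"
    using F G unfolding is_saft_L2_def Lr_tendsto_def by blast+
  have [measurable]: "F \<in> borel_measurable borel" "G \<in> borel_measurable borel"
    using FG by (auto dest: LrD)
  have \<eta>0: "\<eta> \<omega> \<noteq> 0" for \<omega>
    using b norm_chirp[of d b "b * q - d * p" \<omega>] by (auto simp del: norm_chirp)
  have "AE \<xi> in lborel. inverse (\<eta> (b / (2 * pi) * \<xi>)) * F (b / (2 * pi) * \<xi>) = inverse (\<eta> (b / (2 * pi) * \<xi>)) * G (b / (2 * pi) * \<xi>)"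
    by (rule ft2_unique[OF ft2_of_is_saft_L2[OF F] ft2_of_is_saft_L2[OF G]])
  then have "AE \<xi> in lborel. F (b / (2 * pi) * \<xi>) - G (b / (2 * pi) * \<xi>) = 0"
    by eventually_elim (use \<eta>0 in \<open>simp add: nonzero_imp_inverse_nonzero\<close>)
  then have "Lr_int 2 (\<lambda>\<xi>. F (b / (2 * pi) * \<xi>) - G (b / (2 * pi) * \<xi>)) = 0"
    by (subst Lr_int_eq_0_iff) auto
  then have "Lr_int 2 (\<lambda>\<xi>. F \<xi> - G \<xi>) = 0"
    using Lr_int_scale[of "\<lambda>\<xi>. F \<xi> - G \<xi>" "b / (2 * pi)" 2] b by simp
  then show ?thesis
    using Lr_int_eq_0_iff[of "\<lambda>\<xi>. F \<xi> - G \<xi>" 2] by auto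
qed

lemma saft_L2_AE:
  assumes "is_saft_L2 A f F"
  shows "AE \<omega> in lborel. saft_L2 A f \<omega> = F \<omega>"
proof (rule is_saft_L2_unique[OF _ assms])
  show "is_saft_L2 A f (saft_L2 A f)"
    unfolding saft_L2_def by (rule someI[of "is_saft_L2 A f" F, OF assms])
qed

text \<open>The output factor \<open>\<eta>\<close> is common to both transforms, and the dilated
  symbol, evaluated at \<open>2 * pi / b * \<omega>\<close>, is \<open>m \<omega>\<close>.\<close>

lemma saft_mult_op_of_mult2:
  assumes "mult2 (\<lambda>\<xi>. m (b / (2 * pi) * \<xi>)) (\<lambda>t. ch t * f t) (\<lambda>t. ch t * g t)"
  shows "saft_mult_op A m f g"
proof -
  obtain F where F: "ft2 (\<lambda>t. ch t * f t) F" "ft2 (\<lambda>t. ch t * g t) (\<lambda>\<xi>. m (b / (2 * pi) * \<xi>) * F \<xi>)"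
    using assms unfolding mult2_def by blast
  have "(\<lambda>t. cnj (ch t) * (ch t * g t)) \<in> Lr 2"
    by (rule Lr_mult_bounded[OF ft2_Lr(1)[OF F(2)] _ norm_cnj_chirp]) auto
  then have g2: "g \<in> Lr 2" by simp
  have mm: "m (b / (2 * pi) * (2 * pi / b * \<omega>)) = m \<omega>" for \<omega>
    using b by simp
  from saft_L2_AE[OF is_saft_L2_of_ft2[OF F(1)]] saft_L2_AE[OF is_saft_L2_of_ft2[OF F(2)]]
  have "AE \<omega> in lborel. saft_L2 A g \<omega> = m \<omega> * saft_L2 A f \<omega>"
    by eventually_elim (unfold mm, simp only: mult_ac)
  with g2 show ?thesis
    unfolding saft_mult_op_def by blast
qed

text \<open>\<open>T\<close> is conjugated by the chirp. Being unimodular, the chirp preserves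
  \<open>Lr_norm\<close> exactly, so the operator bound is unchanged.\<close>

lemma saft_multiplier_of_extension:
  assumes m: "m \<in> Linf" and r: "r > 1" and T: "bounded_linear_Lr r T"
    and T2: "\<And>f. f \<in> Lr 2 \<inter> Lr r \<Longrightarrow> mult2 (\<lambda>\<xi>. m (b / (2 * pi) * \<xi>)) f (T f)"
  shows "saft_multiplier A r m"
proof -
  have r0: "r \<ge> 0" using r by simp
  have norm_chirp_le: "norm (ch t) \<le> 1" for t by simp
  have cm: "(\<lambda>t. cnj (ch t)) \<in> borel_measurable borel" by measurable
  have up: "(\<lambda>t. ch t * f t) \<in> Lr s" if "f \<in> Lr s" "s \<ge> 0" for f s
    by (rule Lr_mult_bounded[OF that(1) chirp_measurable norm_chirp_le that(2)])
  have down: "(\<lambda>t. cnj (ch t) * f t) \<in> Lr r" if "f \<in> Lr r" for f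
    by (rule Lr_mult_bounded[OF that cm norm_cnj_chirp r0])
  have norm_up: "Lr_norm r (\<lambda>t. ch t * f t) = Lr_norm r f" "Lr_norm r (\<lambda>t. cnj (ch t) * f t) = Lr_norm r f" for f
    by (simp_all add: Lr_norm_def norm_mult)
  define S where "S f t = cnj (ch t) * T (\<lambda>s. ch s * f s) t" for f t
  note T' = T[unfolded bounded_linear_Lr_def]
  note T_add = T'[THEN conjunct2, THEN conjunct1, rule_format]
  note T_cmult = T'[THEN conjunct2, THEN conjunct2, THEN conjunct1, rule_format]
  obtain K where K: "\<And>f. f \<in> Lr r \<Longrightarrow> Lr_norm r (T f) \<le> K * Lr_norm r f"
    using T' by blast
  have "bounded_linear_Lr r S"
    unfolding bounded_linear_Lr_def
  proof (intro conjI ballI allI exI[of _ K])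
    fix f assume f: "f \<in> Lr r"
    note uf = up[OF f r0]
    show "S f \<in> Lr r"
      unfolding S_def using T' uf by (intro down) blast
    show "AE x in lborel. S (\<lambda>y. f y + g y) x = S f x + S g x" if g: "g \<in> Lr r" for g
    proof -
      have "AE x in lborel. T (\<lambda>y. ch y * f y + ch y * g y) x = T (\<lambda>y. ch y * f y) x + T (\<lambda>y. ch y * g y) x"
        by (rule T_add[OF uf up[OF g r0]])
      then show ?thesis
        unfolding S_def by eventually_elim (simp add: distrib_left)
    qed
    show "AE x in lborel. S (\<lambda>y. z * f y) x = z * S f x" for z
    proof -
      have "AE x in lborel. T (\<lambda>y. z * (ch y * f y)) x = z * T (\<lambda>y. ch y * f y) x"
        by (rule T_cmult[OF uf])
      then show ?thesis
        unfolding S_def by eventually_elim (simp add: mult.left_commute)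
    qed
    show "Lr_norm r (S f) \<le> K * Lr_norm r f"
      using K[OF uf] unfolding S_def norm_up .
  qed
  moreover have "saft_mult_op A m f (S f)" if f: "f \<in> Lr 2 \<inter> Lr r" for f
  proof (rule saft_mult_op_of_mult2)
    have "(\<lambda>t. ch t * f t) \<in> Lr 2 \<inter> Lr r"
      using f up r0 by simp
    from T2[OF this] show "mult2 (\<lambda>\<xi>. m (b / (2 * pi) * \<xi>)) (\<lambda>t. ch t * f t) (\<lambda>t. ch t * S f t)"
      by (simp add: S_def)
  qed
  ultimately show ?thesis
    unfolding saft_multiplier_def using m by blast
qed

end

section \<open>From the stated hypotheses to pointwise bounds\<close>

lemma AE_bound_imp_bound_at:
  fixes m :: "real \<Rightarrow> complex"
  assumes ae: "AE x in lborel. norm (m x) \<le> B" and cont: "isCont m x0"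
  shows "norm (m x0) \<le> B"
proof (rule ccontr)
  assume "\<not> norm (m x0) \<le> B"
  then have gt: "B < norm (m x0)" by simp
  have "((\<lambda>x. norm (m x)) \<longlongrightarrow> norm (m x0)) (at x0)"
    using cont by (intro tendsto_norm) (simp add: isCont_def)
  then have "\<forall>\<^sub>F x in at x0. B < norm (m x)"
    using gt by (rule order_tendstoD)
  then obtain e where e: "e > 0" "\<And>x. x \<noteq> x0 \<Longrightarrow> dist x x0 < e \<Longrightarrow> B < norm (m x)"
    unfolding eventually_at by auto
  obtain N where N: "N \<in> null_sets lborel" "{x. \<not> norm (m x) \<le> B} \<subseteq> N"
    using ae by (auto simp: eventually_ae_filter)
  \<comment> \<open>By continuity a violation at \<open>x0\<close> would persist on an interval,
    which is not a null set.\<close>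
  have "{x0<..<x0 + e} \<subseteq> N"
    using N(2) e(2) by (force simp: dist_real_def)
  then have "emeasure lborel {x0<..<x0 + e} \<le> emeasure lborel N"
    using N(1) by (intro emeasure_mono) auto
  then show False
    using N(1) e(1) by (auto simp: null_sets_def)
qed

lemma Linf_AE_bound:
  assumes "m \<in> Linf"
  obtains B where "AE x in lborel. norm (m x) \<le> B"
proof (cases "esssup lborel (\<lambda>x. ereal (norm (m x)))")
  case (real B)
  then have "AE x in lborel. norm (m x) \<le> B"
    using esssup_AE[of "\<lambda>x. ereal (norm (m x))" lborel] by simp
  then show ?thesis by (rule that)
next
  case PInf
  then show ?thesis using assms by (simp add: Linf_def)
next
  case MInf
  then have "AE x in lborel. norm (m x) \<le> 0"
    using esssup_AE[of "\<lambda>x. ereal (norm (m x))" lborel] by auto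
  then show ?thesis by (rule that)
qed

text \<open>The condition on the derivative is invariant under dilation: the factor \<open>k\<close>
  from the chain rule cancels, and \<open>C\<close> stays the same.\<close>

lemma dilated_mikhlin_function:
  assumes m: "m \<in> Linf" and C1: "m C1_differentiable_on (UNIV - {0})" and k: "k \<noteq> (0 :: real)"
    and bd: "\<And>x. x \<noteq> 0 \<Longrightarrow> norm (vector_derivative m (at x)) \<le> C * inverse \<bar>x\<bar>"
  obtains m' B where "mikhlin_function (\<lambda>x. m (k * x)) m' B C"
proof -
  have [measurable]: "m \<in> borel_measurable borel" using m by (simp add: Linf_def)
  obtain D where D: "\<And>x. x \<noteq> 0 \<Longrightarrow> (m has_vector_derivative D x) (at x)" "continuous_on (UNIV - {0}) D"
    using C1 unfolding C1_differentiable_on_def by auto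
  have Dc: "isCont D x" if "x \<noteq> 0" for x
    using D(2) that continuous_on_eq_continuous_at[of "UNIV - {0::real}" D] by (simp add: open_Diff)
  obtain B0 where B0: "AE x in lborel. norm (m x) \<le> B0"
    using Linf_AE_bound[OF m] .
  \<comment> \<open>The essential bound becomes pointwise at points of continuity; at 0 the value of
    \<open>m\<close> is arbitrary, hence the maximum.\<close>
  define B where "B = max B0 (norm (m 0))"
  have mB: "norm (m x) \<le> B" for x
  proof (cases "x = 0")
    case False
    then show ?thesis
      using AE_bound_imp_bound_at[OF B0 has_vector_derivative_continuous[OF D(1)]] by (simp add: B_def max.coboundedI1)
  qed (simp add: B_def)
  \<comment> \<open>Nothing is known about \<open>D\<close> at 0; a fixed value there keeps
    \<open>m'\<close> measurable.\<close>
  define m' where "m' x = (if x = 0 then 0 else k *\<^sub>R D (k * x))" for x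
  show ?thesis
  proof (rule that[of m' B], unfold_locales)
    have "(\<lambda>x. indicator (UNIV - {0}) x *\<^sub>R D x) \<in> borel_measurable borel"
      by (rule borel_measurable_continuous_on_indicator[OF _ D(2)]) auto
    then have "(\<lambda>x. k *\<^sub>R (indicator (UNIV - {0}) (k * x) *\<^sub>R D (k * x))) \<in> borel_measurable borel"
      by measurable
    also have "(\<lambda>x. k *\<^sub>R (indicator (UNIV - {0}) (k * x) *\<^sub>R D (k * x))) = m'"
      using k by (auto simp: m'_def indicator_def)
    finally show "m' \<in> borel_measurable borel" .
    fix x :: real assume x: "x \<noteq> 0"
    then have kx: "k * x \<noteq> 0" using k by simp
    have "((m \<circ> (\<lambda>x. k * x)) has_vector_derivative k *\<^sub>R D (k * x)) (at x)"
      by (rule vector_diff_chain_at) (use D(1)[OF kx] in \<open>auto intro!: derivative_eq_intros\<close>)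
    then show "((\<lambda>x. m (k * x)) has_vector_derivative m' x) (at x)"
      using x by (simp add: o_def m'_def)
    have "isCont (\<lambda>x. k *\<^sub>R D (k * x)) x"
      by (intro continuous_intros isCont_o2[where f="\<lambda>x. k * x" and g=D, OF _ Dc[OF kx]])
    moreover have "\<forall>\<^sub>F y in nhds x. m' y = k *\<^sub>R D (k * y)"
    proof -
      have "\<forall>\<^sub>F y in nhds x. y \<in> UNIV - {0}"
        using x by (intro eventually_nhds_in_open) auto
      then show ?thesis by eventually_elim (simp add: m'_def)
    qed
    ultimately show "isCont m' x"
      using isCont_cong by metis
    have "vector_derivative m (at (k * x)) = D (k * x)"
      by (rule vector_derivative_at[OF D(1)[OF kx]])
    then have "norm (D (k * x)) \<le> C * inverse \<bar>k * x\<bar>"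
      using bd[OF kx] by simp
    then have "\<bar>k\<bar> * norm (D (k * x)) \<le> \<bar>k\<bar> * (C * inverse \<bar>k * x\<bar>)"
      by (rule mult_left_mono) simp
    also have "\<dots> = C / \<bar>x\<bar>"
      using k x by (simp add: abs_mult field_simps)
    finally show "norm (m' x) \<le> C / \<bar>x\<bar>"
      using x by (simp add: m'_def)
  qed (use mB in auto)
qed

theorem theorem6p3:
  fixes a b c d p q :: real
    and m :: "real \<Rightarrow> complex"
    and C :: real
  assumes "a * d - b * c = 1"
    and "b \<noteq> 0"
    and "m \<in> Linf"
    and "m C1_differentiable_on (UNIV - {0})"
    and "C > 0"
    and "\<And>x. x \<noteq> 0 \<Longrightarrow> norm (vector_derivative m (at x)) \<le> C * inverse \<bar>x\<bar>"
  shows "\<forall>r>1. saft_multiplier (a, b, c, d, p, q) r m"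
proof (intro allI impI)
  fix r :: real assume r: "r > 1"
  \<comment> \<open>The inverse of the frequency scaling in \<open>saft_eq_ft\<close>; it is
    negative when \<open>b\<close> is.\<close>
  have "b / (2 * pi) \<noteq> 0" using assms(2) by simp
  from dilated_mikhlin_function[OF assms(3,4) this assms(6)]
  obtain m' B where "mikhlin_function (\<lambda>x. m (b / (2 * pi) * x)) m' B C" by blast
  then interpret mikhlin_function "\<lambda>x. m (b / (2 * pi) * x)" m' B C .
  obtain T where "bounded_linear_Lr r T" "\<And>f. f \<in> Lr 2 \<inter> Lr r \<Longrightarrow> mult2 (\<lambda>x. m (b / (2 * pi) * x)) f (T f)"
    using extension[OF r] by blast
  then show "saft_multiplier (a, b, c, d, p, q) r m"
    using saft_multiplier_of_extension[OF assms(2,3) r] by blast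
qed

end
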